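(* Let $(\mu_n)_{n\in\mathbb N}$ be a sequence of Fourier transformable measures on $\mathbb R^d$, and let $\mu$ be a measure on $\mathbb R^d$ such that (i) for every $f\in\mathcal S(\mathbb R^d)$, $\mu_n(e^{-2\pi i t\cdot}f)\to\mu(e^{-2\pi i t\cdot}f)$ as $n\to\infty$, uniformly in $t\in\mathbb R^d$; (ii) $\{\mu_n: n\in\mathbb N\}$ is vaguely bounded; (iii) $\mu$ is tempered; (iv) $\{\widehat{\mu_n}:n\in\mathbb N\}$ is a set of equi translation bounded measures. Then $\mu$ is Fourier transformable and $\lim_{n\to\infty}\widehat{\mu_n}=\widehat\mu$ in the product topology.
   Context: Measures on $\mathbb R^d$ are complex Radon measures; $|\mu|$ is the total variation. Conventions: $\check f(y)=\int f(x)e^{2\pi ixy}dx$, $\widetilde f(x)=\overline{f(-x)}$; $e^{-2\pi i t\cdot}f$ denotes $x\mapsto e^{-2\pi i tx}f(x)$. A measure $\mu$ is Fourier transformable if there is a measure $\widehat\mu$ with $\check f\in L^2(\widehat\mu)$ and $\mu(f*\widetilde f)=\widehat\mu(|\check f|^2)$ for all $f\in C_c(\mathbb R^d)$; such measures are tempered (define tempered distributions), and $\mu(f)$ for $f\in\mathcal S(\mathbb R^d)$ denotes the action as a tempered distribution. A set of measures is vaguely bounded if $\{\nu(f)\}$ is bounded for every $f\in C_c(\mathbb R^d)$. Equi translation bounded: $\sup_n\sup_t|\widehat{\mu_n}|(t+K)<\infty$ for every compact $K$. Convergence $\nu_n\to\nu$ in the product topology means $\|(\nu_n-\nu)*g\|_\infty\to0$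 for all $g\in C_c(\mathbb R^d)$. *)

theory Defs
  imports "HOL-Analysis.Analysis"
begin

text \<open>A complex Radon measure mu on 'a is represented by its polar decomposition:
  a pair (M, h) where M = |mu| is a locally finite positive Borel measure and h is a Borel
  function with |h| = 1 M-a.e., so that mu = h M, i.e. mu(f) = integral of f h dM.\<close>

type_synonym 'a cmeasure = "'a measure \<times> ('a \<Rightarrow> complex)"

definition radon_cmeasure :: "('a::euclidean_space) cmeasure \<Rightarrow> bool" where
  "radon_cmeasure \<mu> \<longleftrightarrow>
     sets (fst \<mu>) = sets borel \<and>
     (\<forall>K. compact K \<longrightarrow> emeasure (fst \<mu>) K < \<infinity>) \<and>
     snd \<mu> \<in> borel_measurable borel \<and>
     (AE x in fst \<mu>. norm (snd \<mu> x) = 1)"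

definition cm_var :: "'a cmeasure \<Rightarrow> 'a measure" where
  "cm_var \<mu> = fst \<mu>"

definition cm_integral :: "'a cmeasure \<Rightarrow> ('a \<Rightarrow> complex) \<Rightarrow> complex" where
  "cm_integral \<mu> f = (LINT x|fst \<mu>. f x * snd \<mu> x)"

definition has_compact_support :: "('a::real_normed_vector \<Rightarrow> complex) \<Rightarrow> bool" where
  "has_compact_support f \<longleftrightarrow> (\<exists>K. compact K \<and> (\<forall>x. x \<notin> K \<longrightarrow> f x = 0))"

definition Cc :: "('a::real_normed_vector \<Rightarrow> complex) set" where
  "Cc = {f. continuous_on UNIV f \<and> has_compact_support f}"

primrec dderivs :: "'a::real_normed_vector list \<Rightarrow> ('a \<Rightarrow> complex) \<Rightarrow> 'a \<Rightarrow> complex" where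
  "dderivs [] f = f"
| "dderivs (v # vs) f = (\<lambda>x. frechet_derivative (dderivs vs f) (at x) v)"

definition smooth_fun :: "('a::real_normed_vector \<Rightarrow> complex) \<Rightarrow> bool" where
  "smooth_fun f \<longleftrightarrow> (\<forall>vs x. dderivs vs f differentiable (at x))"

definition Cc_inf :: "('a::real_normed_vector \<Rightarrow> complex) set" where
  "Cc_inf = {f. smooth_fun f \<and> has_compact_support f}"

definition schwartz :: "('a::real_normed_vector \<Rightarrow> complex) set" where
  "schwartz = {f. smooth_fun f \<and>
      (\<forall>(N::nat) vs. bounded (range (\<lambda>x. (1 + norm x) ^ N * norm (dderivs vs f x))))}"

definition schwartz_seminorm :: "nat \<Rightarrow> ('a::real_normed_vector \<Rightarrow> complex) \<Rightarrow> real" where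
  "schwartz_seminorm N f =
     (SUP p \<in> {(x, vs). length vs \<le> N \<and> (\<forall>v\<in>set vs. norm v \<le> 1)}.
        (1 + norm (fst p)) ^ N * norm (dderivs (snd p) f (fst p)))"

text \<open>mu is tempered: f \<mapsto> mu(f) on C_c^infinity is continuous for the Schwartz topology.\<close>
definition tempered :: "('a::euclidean_space) cmeasure \<Rightarrow> bool" where
  "tempered \<mu> \<longleftrightarrow> (\<exists>C N. \<forall>g\<in>Cc_inf. norm (cm_integral \<mu> g) \<le> C * schwartz_seminorm N g)"

definition tempered_action :: "('a::euclidean_space) cmeasure \<Rightarrow> ('a \<Rightarrow> complex) \<Rightarrow> complex" where
  "tempered_action \<mu> f = (THE L. \<forall>g::nat \<Rightarrow> 'a \<Rightarrow> complex.
      (\<forall>k. g k \<in> Cc_inf) \<and> (\<forall>N. (\<lambda>k. schwartz_seminorm N (\<lambda>x. g k x - f x)) \<longlonglongrightarrow> 0)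
      \<longrightarrow> (\<lambda>k. cm_integral \<mu> (g k)) \<longlonglongrightarrow> L)"

definition inv_fourier :: "('a::euclidean_space \<Rightarrow> complex) \<Rightarrow> 'a \<Rightarrow> complex" where
  "inv_fourier f y = (LINT x|lborel. f x * exp (2 * of_real pi * \<i> * of_real (x \<bullet> y)))"

definition refl_conj :: "('a::real_normed_vector \<Rightarrow> complex) \<Rightarrow> 'a \<Rightarrow> complex" where
  "refl_conj f x = cnj (f (- x))"

definition fconv :: "('a::euclidean_space \<Rightarrow> complex) \<Rightarrow> ('a \<Rightarrow> complex) \<Rightarrow> 'a \<Rightarrow> complex" where
  "fconv f g x = (LINT y|lborel. f y * g (x - y))"

definition mconv :: "('a::euclidean_space) cmeasure \<Rightarrow> ('a \<Rightarrow> complex) \<Rightarrow> 'a \<Rightarrow> complex" where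
  "mconv \<nu> g x = cm_integral \<nu> (\<lambda>y. g (x - y))"

definition is_fourier_transform :: "('a::euclidean_space) cmeasure \<Rightarrow> 'a cmeasure \<Rightarrow> bool" where
  "is_fourier_transform \<mu> \<nu> \<longleftrightarrow> radon_cmeasure \<nu> \<and>
     (\<forall>f\<in>Cc. integrable (cm_var \<nu>) (\<lambda>y. (norm (inv_fourier f y))\<^sup>2) \<and>
        cm_integral \<mu> (fconv f (refl_conj f)) =
        cm_integral \<nu> (\<lambda>y. complex_of_real ((norm (inv_fourier f y))\<^sup>2)))"

definition fourier_transformable :: "('a::euclidean_space) cmeasure \<Rightarrow> bool" where
  "fourier_transformable \<mu> \<longleftrightarrow> radon_cmeasure \<mu> \<and> (\<exists>\<nu>. is_fourier_transform \<mu> \<nu>)"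

definition vaguely_bounded :: "('a::euclidean_space) cmeasure set \<Rightarrow> bool" where
  "vaguely_bounded S \<longleftrightarrow> (\<forall>f\<in>Cc. bounded ((\<lambda>\<nu>. cm_integral \<nu> f) ` S))"

definition equi_translation_bounded :: "('a::euclidean_space) cmeasure set \<Rightarrow> bool" where
  "equi_translation_bounded S \<longleftrightarrow>
     (\<forall>K. compact K \<longrightarrow> (\<exists>C::real. \<forall>\<nu>\<in>S. \<forall>t. emeasure (cm_var \<nu>) ((+) t ` K) \<le> ennreal C))"

definition product_converges :: "(nat \<Rightarrow> ('a::euclidean_space) cmeasure) \<Rightarrow> 'a cmeasure \<Rightarrow> bool" where
  "product_converges \<nu>s \<nu> \<longleftrightarrow>
     (\<forall>g\<in>Cc. uniform_limit UNIV (\<lambda>n. mconv (\<nu>s n) g) (mconv \<nu> g) sequentially)"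

end

theory Submission
  imports Defs
begin

text \<open>The modulated pairings of the measures \<open>\<mu>s n\<close> with a test function are, by
  \<open>\<mu>s n (f) = \<mu>hats n (inv_fourier f)\<close>, convolutions of the transforms \<open>\<mu>hats n\<close> with a Schwartz
  kernel, and they converge uniformly by assumption. Approximating a function of compact support by
  its convolutions with an integrable kernel, in a weighted supremum norm against which translation
  bounded measures integrate uniformly, shows that the convolutions of \<open>\<mu>hats n\<close> with every function
  in \<open>Cc\<close> are uniformly Cauchy. Their limit is a bounded functional, hence by Riesz representation a
  complex Radon measure \<open>\<nu>\<close>, again translation bounded. On \<open>Cc_inf\<close> the identity
  \<open>\<mu> (f) = \<nu> (inv_fourier f)\<close> passes to the limit, and a mollification extends it to functions
  \<open>f * f~\<close> because the transform of a function in \<open>Cc\<close> is square integrable against any translation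
  bounded measure.\<close>

section \<open>Weights and translation bounded measures\<close>

text \<open>Modulating a test function translates its transform, so uniformity in t is uniformity
  over all translates of one kernel. Such a kernel, being the transform of a nonzero function of
  compact support, is never in \<open>Cc\<close>, and plain uniform approximation is useless because
  the errors are integrated against measures of infinite total mass; hence the weighted norm. Two
  further obstacles shape the proof. The definition of transformability speaks only of f * f~, so
  the identity on general test functions has to be recovered by polarisation and mollification. It
  also demands square integrability of the transform for every f in \<open>Cc\<close>, although a
  merely continuous f gives no pointwise decay rate; this is obtained from a duality argument with
  Schur's test, whose constant sees translation boundedness only. Finally, measures are encoded by
  polar decomposition, so the representation theorem has to produce a total variation together with
  a phase, not merely a functional.\<close>

definition echar :: "real \<Rightarrow> complex" where
  "echar s = exp (2 * of_real pi * \<i> * of_real s)"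

lemma norm_echar [simp]: "norm (echar s) = 1"
  unfolding echar_def by (simp add: norm_exp_eq_Re)

lemma echar_0 [simp]: "echar 0 = 1"
  by (simp add: echar_def)

lemma echar_add: "echar (s + t) = echar s * echar t"
  by (simp add: echar_def exp_add distrib_left)

lemma echar_minus: "echar (- s) = cnj (echar s)"
  by (simp add: echar_def exp_cnj)

lemma echar_diff: "echar (s - t) = echar s * cnj (echar t)"
  using echar_add[of s "- t"] by (simp add: echar_minus)

lemma continuous_echar [continuous_intros]:
  "continuous_on S f \<Longrightarrow> continuous_on S (\<lambda>x. echar (f x))"
  unfolding echar_def by (intro continuous_intros)

lemma inv_fourier_echar: "inv_fourier f y = (LINT x|lborel. f x * echar (x \<bullet> y))"
  by (simp add: inv_fourier_def echar_def)

definition loc_finite :: "'a::euclidean_space measure \<Rightarrow> bool" where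
  "loc_finite M \<longleftrightarrow> sets M = sets borel \<and> (\<forall>K. compact K \<longrightarrow> emeasure M K < \<infinity>)"

lemma loc_finite_sets: "loc_finite M \<Longrightarrow> sets M = sets borel"
  and loc_finite_compact: "loc_finite M \<Longrightarrow> compact K \<Longrightarrow> emeasure M K < \<infinity>"
  by (auto simp: loc_finite_def)

lemma loc_finite_lborel: "loc_finite lborel"
  using emeasure_compact_finite by (auto simp: loc_finite_def)

lemma loc_finite_sigma_finite:
  assumes "loc_finite (M :: 'a::euclidean_space measure)"
  shows "sigma_finite_measure M"
proof
  have s: "space M = UNIV" using loc_finite_sets[OF assms] sets_eq_imp_space_eq[of M borel] by simp
  have "\<Union> (range (\<lambda>n::nat. cball (0::'a) (real n))) = UNIV"
    using real_arch_simple by (fastforce simp: dist_norm)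
  then show "\<exists>A. countable A \<and> A \<subseteq> sets M \<and> \<Union> A = space M \<and> (\<forall>a\<in>A. emeasure M a \<noteq> \<infinity>)"
    using loc_finite_compact[OF assms, of "cball 0 _"] loc_finite_sets[OF assms] s
    by (intro exI[of _ "range (\<lambda>n::nat. cball 0 (real n))"]) (auto simp: less_top)
qed

text \<open>A translation bounded measure gives mass O(k^d) to a ball of radius k. Summing over
  balls instead of annuli is crude but costs one power only, and the exponent d + 2 still leaves the
  convergent series of 1/k^2.\<close>

definition wt :: "'a::euclidean_space \<Rightarrow> real" where
  "wt y = 1 / (1 + norm y) ^ (DIM('a) + 2)"

lemma wt_pos: "0 < wt (y :: 'a::euclidean_space)" and wt_nonneg [simp]: "0 \<le> wt y" and wt_le_1: "wt y \<le> 1"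
proof -
  have "1 \<le> (1 + norm y) ^ (DIM('a) + 2)" for y :: 'a
    by (intro one_le_power) simp
  from this[of y] show "0 < wt y" "0 \<le> wt y" "wt y \<le> 1"
    unfolding wt_def by (auto intro!: divide_nonneg_nonneg divide_pos_pos simp: divide_le_eq_1)
qed

lemma wt_minus [simp]: "wt (- y) = wt y"
  by (simp add: wt_def)

lemma continuous_wt [continuous_intros]: "continuous_on S f \<Longrightarrow> continuous_on S (\<lambda>x. wt (f x))"
  unfolding wt_def
  by (intro continuous_intros ballI power_not_zero) (auto simp: add_nonneg_eq_0_iff)

lemma wt_measurable [measurable]: "wt \<in> borel_measurable borel"
  by (intro borel_measurable_continuous_onI continuous_intros)

text \<open>Translation boundedness with an explicit constant, tested on closed unit balls; other
  compact sets follow by covering. The condition on the sign of C is there because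
  \<open>ennreal\<close> sends negative numbers to 0.\<close>

definition tbound :: "'a::euclidean_space measure \<Rightarrow> real \<Rightarrow> bool" where
  "tbound M C \<longleftrightarrow> sets M = sets borel \<and> 0 \<le> C \<and> (\<forall>t. emeasure M (cball t 1) \<le> ennreal C)"

lemma tbound_loc_finite:
  assumes "tbound (M :: 'a::euclidean_space measure) C" shows "loc_finite M"
  unfolding loc_finite_def
proof (intro conjI allI impI)
  show s: "sets M = sets borel" using assms by (simp add: tbound_def)
  fix K :: "'a set" assume K: "compact K"
  have "K \<subseteq> (\<Union>t\<in>K. ball t 1)" by auto
  then obtain D where D: "D \<subseteq> K" "finite D" "K \<subseteq> (\<Union>t\<in>D. ball t 1)"
    using compactE_image[OF K, of K "\<lambda>t. ball t 1"] by auto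
  have "emeasure M K \<le> emeasure M (\<Union>t\<in>D. cball t 1)"
  proof (rule emeasure_mono)
    show "K \<subseteq> (\<Union>t\<in>D. cball t 1)" using D(3) ball_subset_cball by blast
    show "(\<Union>t\<in>D. cball t 1) \<in> sets M" unfolding s by (rule sets.finite_UN[OF D(2)]) simp
  qed
  also have "\<dots> \<le> (\<Sum>t\<in>D. emeasure M (cball t 1))"
    by (rule emeasure_subadditive_finite[OF D(2)]) (auto simp: s)
  also have "\<dots> \<le> (\<Sum>t\<in>D. ennreal C)"
    using assms by (intro sum_mono) (auto simp: tbound_def)
  also have "\<dots> < \<infinity>" by (simp add: ennreal_mult_less_top of_nat_less_top)
  finally show "emeasure M K < \<infinity>" .
qed

lemma tbound_lborel: "tbound (lborel :: 'a::euclidean_space measure) (unit_ball_vol (real DIM('a)))"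
  by (simp add: tbound_def emeasure_cball)

text \<open>Joint continuity gives Borel measurability on the product space, whose Borel algebra is
  the product algebra by second countability. M and N are arbitrary measures on the Borel sets, so
  the fact serves \<open>lborel\<close> and total variations alike.\<close>

lemma borel_measurable_continuous_pair:
  fixes f :: "'a::euclidean_space \<Rightarrow> 'b::euclidean_space \<Rightarrow> 'c::topological_space"
  assumes "continuous_on UNIV (\<lambda>p. f (fst p) (snd p))" "sets M = sets borel" "sets N = sets borel"
  shows "(\<lambda>p. f (fst p) (snd p)) \<in> borel_measurable (M \<Otimes>\<^sub>M N)" "case_prod f \<in> borel_measurable (M \<Otimes>\<^sub>M N)"
proof -
  have "sets (M \<Otimes>\<^sub>M N) = sets (borel :: ('a \<times> 'b) measure)"
    using assms(2,3) by (metis borel_prod sets_pair_measure_cong)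
  then show "(\<lambda>p. f (fst p) (snd p)) \<in> borel_measurable (M \<Otimes>\<^sub>M N)"
    using borel_measurable_continuous_onI[OF assms(1)] by (simp cong: measurable_cong_sets)
  then show "case_prod f \<in> borel_measurable (M \<Otimes>\<^sub>M N)" by (simp add: case_prod_beta')
qed

lemma closed_sets_pair:
  fixes A :: "('a::euclidean_space \<times> 'b::euclidean_space) set"
  assumes "closed A" "sets M = sets borel" "sets N = sets borel"
  shows "A \<in> sets (M \<Otimes>\<^sub>M N)"
  using assms borel_closed[OF assms(1)] by (metis borel_prod sets_pair_measure_cong)

text \<open>Double counting of the pairs (y, z) with y in the large ball and z within distance 1 of
  y. For fixed y the volume of the z is that of a unit ball; for fixed z, which lies in the ball of
  radius R + 1, the M-mass of the y is at most C. The volume of the unit ball cancels.\<close>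

lemma tbound_cball:
  assumes "tbound (M :: 'a::euclidean_space measure) C" "R \<ge> 0"
  shows "emeasure M (cball t R) \<le> ennreal (C * (R + 1) ^ DIM('a))"
proof -
  let ?v = "unit_ball_vol (real DIM('a))"
  have v: "?v > 0" by simp
  have s[measurable_cong]: "sets M = sets borel" and C: "C \<ge> 0" and b: "\<And>t. emeasure M (cball t 1) \<le> ennreal C"
    using assms by (auto simp: tbound_def)
  interpret M: sigma_finite_measure M
    using assms tbound_loc_finite loc_finite_sigma_finite by blast
  interpret P: pair_sigma_finite M lborel ..
  let ?A = "{p :: 'a \<times> 'a. dist t (fst p) \<le> R \<and> dist (fst p) (snd p) \<le> 1}"
  have A: "?A \<in> sets (M \<Otimes>\<^sub>M lborel)"
    by (intro closed_sets_pair closed_Collect_conj closed_Collect_le continuous_intros s) auto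
  have ind: "\<And>y z. indicator ?A (y, z) = (indicator (cball t R) y * indicator (cball y 1) z :: ennreal)"
    by (auto simp: indicator_def)
  have "ennreal ?v * emeasure M (cball t R) = (\<integral>\<^sup>+y. ennreal ?v * indicator (cball t R) y \<partial>M)"
    by (subst nn_integral_cmult_indicator) auto
  also have "\<dots> = (\<integral>\<^sup>+y. \<integral>\<^sup>+z. indicator ?A (y, z) \<partial>lborel \<partial>M)"
    by (intro nn_integral_cong)
       (simp only: ind, subst nn_integral_cmult, auto simp: emeasure_cball mult.commute intro: borel_measurable_indicator)
  also have "\<dots> = (\<integral>\<^sup>+z. \<integral>\<^sup>+y. indicator ?A (y, z) \<partial>M \<partial>lborel)"
    using A by (intro P.Fubini[symmetric]) simp
  also have "\<dots> \<le> (\<integral>\<^sup>+z. ennreal C * indicator (cball t (R + 1)) z \<partial>lborel)"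
  proof (intro nn_integral_mono)
    fix z :: 'a
    have "(\<integral>\<^sup>+y. indicator ?A (y, z) \<partial>M) \<le> (\<integral>\<^sup>+y. indicator (cball z 1) y * indicator (cball t (R + 1)) z \<partial>M)"
      using dist_triangle_le[of t _ z "R + 1"]
      by (intro nn_integral_mono) (auto simp: indicator_def dist_commute dest: add_mono)
    also have "\<dots> = emeasure M (cball z 1) * indicator (cball t (R + 1)) z"
      by (subst nn_integral_multc) (auto simp: s intro!: borel_measurable_indicator)
    finally show "(\<integral>\<^sup>+y. indicator ?A (y, z) \<partial>M) \<le> ennreal C * indicator (cball t (R + 1)) z"
      using mult_right_mono[OF b[of z], of "indicator (cball t (R + 1)) z"] by (rule order_trans) simp
  qed
  also have "\<dots> = ennreal C * emeasure lborel (cball t (R + 1))"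
    by (subst nn_integral_cmult_indicator) auto
  also have "\<dots> = ennreal ?v * ennreal (C * (R + 1) ^ DIM('a))"
    using assms C by (simp add: emeasure_cball ac_simps flip: ennreal_mult)
  finally show ?thesis
    using v by (simp add: ennreal_mult_le_mult_iff)
qed

text \<open>The bound is C times a factor depending on the dimension only, whatever M and the centre
  t. The 2^d arises from replacing (k + 2)^d by (2 (k + 1))^d, so that the powers of k + 1
  cancel.\<close>

lemma tbound_wt:
  fixes M :: "'a::euclidean_space measure"
  assumes "tbound M C"
  shows "(\<integral>\<^sup>+y. ennreal (wt (y - t)) \<partial>M) \<le> ennreal (C * (2 ^ DIM('a) * (\<Sum>k. 1 / real (Suc k) ^ 2)))"
proof -
  let ?d = "DIM('a)"
  have s[measurable_cong]: "sets M = sets borel" and C: "C \<ge> 0"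
    using assms by (auto simp: tbound_def)
  have le: "g k \<le> (\<Sum>k. g k)" for g :: "nat \<Rightarrow> ennreal" and k
    using sum_le_suminf[of g "{k}"] by simp
  have sm: "summable (\<lambda>k. 1 / real (Suc k) ^ 2)"
    using inverse_power_summable[of 2, where 'a=real] by (subst summable_Suc_iff) (simp add: inverse_eq_divide)
  have "(\<integral>\<^sup>+y. ennreal (wt (y - t)) \<partial>M)
      \<le> (\<integral>\<^sup>+y. (\<Sum>k. ennreal (1 / real (Suc k) ^ (?d + 2)) * indicator (cball t (real (Suc k))) y) \<partial>M)"
  proof (intro nn_integral_mono)
    fix y
    \<comment> \<open>With k the integer part of the distance, y lies in the ball of radius k + 1
      and its weight is at most (k + 1)^-(d+2), so one term of the series already dominates.\<close>
    define k where "k = nat \<lfloor>norm (y - t)\<rfloor>"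
    have k: "real k \<le> norm (y - t)" "norm (y - t) \<le> real (Suc k)"
      unfolding k_def by (simp, linarith)
    have "ennreal (wt (y - t)) \<le> ennreal (1 / real (Suc k) ^ (?d + 2)) * indicator (cball t (real (Suc k))) y"
    proof -
      have "real (Suc k) ^ (?d + 2) \<le> (1 + norm (y - t)) ^ (?d + 2)"
        using k by (intro power_mono) auto
      then have "wt (y - t) \<le> 1 / real (Suc k) ^ (?d + 2)"
        unfolding wt_def by (intro divide_left_mono mult_pos_pos zero_less_power) (auto intro: add_pos_nonneg)
      moreover have "y \<in> cball t (real (Suc k))" using k by (simp add: dist_norm norm_minus_commute)
      ultimately show ?thesis by (simp add: ennreal_leI del: of_nat_Suc)
    qed
    also have "\<dots> \<le> (\<Sum>k. ennreal (1 / real (Suc k) ^ (?d + 2)) * indicator (cball t (real (Suc k))) y)"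
      by (rule le)
    finally show "ennreal (wt (y - t)) \<le> \<dots>" .
  qed
  also have "\<dots> = (\<Sum>k. ennreal (1 / real (Suc k) ^ (?d + 2)) * emeasure M (cball t (real (Suc k))))"
    by (subst nn_integral_suminf) (auto simp: nn_integral_cmult_indicator s intro!: borel_measurable_times_ennreal borel_measurable_indicator)
  also have "\<dots> \<le> (\<Sum>k. ennreal (C * 2 ^ ?d * (1 / real (Suc k) ^ 2)))"
  proof (intro suminf_le allI summableI)
    fix k
    have "ennreal (1 / real (Suc k) ^ (?d + 2)) * emeasure M (cball t (real (Suc k)))
      \<le> ennreal (1 / real (Suc k) ^ (?d + 2)) * ennreal (C * (real (Suc k) + 1) ^ ?d)"
      by (intro mult_left_mono tbound_cball assms) auto
    also have "\<dots> = ennreal (1 / real (Suc k) ^ (?d + 2) * (C * (real (Suc k) + 1) ^ ?d))"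
      using C by (intro ennreal_mult[symmetric]) auto
    also have "\<dots> \<le> ennreal (1 / real (Suc k) ^ (?d + 2) * (C * (2 * real (Suc k)) ^ ?d))"
      using C by (intro ennreal_leI mult_left_mono power_mono) auto
    also have "1 / real (Suc k) ^ (?d + 2) * (C * (2 * real (Suc k)) ^ ?d) = C * 2 ^ ?d * (1 / real (Suc k) ^ 2)"
      by (simp add: power_add power_mult_distrib power2_eq_square field_simps del: of_nat_Suc)
    finally show "ennreal (1 / real (Suc k) ^ (?d + 2)) * emeasure M (cball t (real (Suc k))) \<le> \<dots>" .
  qed
  also have "\<dots> = ennreal (\<Sum>k. C * 2 ^ ?d * (1 / real (Suc k) ^ 2))"
    using C sm by (intro suminf_ennreal2 summable_mult) auto
  also have "(\<Sum>k. C * 2 ^ ?d * (1 / real (Suc k) ^ 2)) = C * (2 ^ ?d * (\<Sum>k. 1 / real (Suc k) ^ 2))"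
    by (subst suminf_mult[OF sm]) (simp add: mult.assoc)
  finally show ?thesis .
qed

section \<open>Compactly supported functions and complex Radon measures\<close>

lemma Cc_iff:
  fixes f :: "'a::euclidean_space \<Rightarrow> complex"
  shows "f \<in> Cc \<longleftrightarrow> continuous_on UNIV f \<and> (\<exists>R>0. \<forall>x. norm x > R \<longrightarrow> f x = 0)"
proof -
  have "has_compact_support f \<longleftrightarrow> (\<exists>R>0. \<forall>x. norm x > R \<longrightarrow> f x = 0)"
  proof
    assume "has_compact_support f"
    then obtain K where K: "compact K" "\<And>x. x \<notin> K \<Longrightarrow> f x = 0"
      by (auto simp: has_compact_support_def)
    obtain R where "R > 0" "\<And>x. x \<in> K \<Longrightarrow> norm x \<le> R"
      using compact_imp_bounded[OF K(1)] by (auto simp: bounded_pos)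
    with K(2) show "\<exists>R>0. \<forall>x. norm x > R \<longrightarrow> f x = 0" by (metis not_less)
  next
    assume "\<exists>R>0. \<forall>x. norm x > R \<longrightarrow> f x = 0"
    then obtain R where "\<And>x. norm x > R \<Longrightarrow> f x = 0" by blast
    then show "has_compact_support f"
      unfolding has_compact_support_def by (intro exI[of _ "cball 0 R"]) auto
  qed
  then show ?thesis by (simp add: Cc_def)
qed

lemma CcI:
  fixes f :: "'a::euclidean_space \<Rightarrow> complex"
  assumes "continuous_on UNIV f" "\<And>x. norm x > R \<Longrightarrow> f x = 0"
  shows "f \<in> Cc"
  unfolding Cc_iff using assms by (intro conjI exI[of _ "max 1 R"]) auto

lemma CcE:
  fixes f :: "'a::euclidean_space \<Rightarrow> complex"
  assumes "f \<in> Cc"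
  obtains R where "R > 0" "\<And>x. norm x > R \<Longrightarrow> f x = 0"
  using assms by (auto simp: Cc_iff)

lemma Cc_continuous: "f \<in> Cc \<Longrightarrow> continuous_on S f"
  by (auto simp: Cc_def intro: continuous_on_subset)

lemma Cc_measurable:
  fixes f :: "'a::euclidean_space \<Rightarrow> complex"
  shows "f \<in> Cc \<Longrightarrow> f \<in> borel_measurable borel"
  by (intro borel_measurable_continuous_onI Cc_continuous)

lemma Cc_mult_left:
  fixes f :: "'a::euclidean_space \<Rightarrow> complex"
  assumes "f \<in> Cc" "continuous_on UNIV g"
  shows "(\<lambda>x. g x * f x) \<in> Cc"
proof -
  obtain R where "\<And>x. norm x > R \<Longrightarrow> f x = 0" using CcE[OF assms(1)] by blast
  then show ?thesis
    using assms Cc_continuous[OF assms(1)] by (intro CcI[of _ R] continuous_intros) auto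
qed

lemma Cc_mult_right:
  fixes f :: "'a::euclidean_space \<Rightarrow> complex"
  assumes "f \<in> Cc" "continuous_on UNIV g"
  shows "(\<lambda>x. f x * g x) \<in> Cc"
  using Cc_mult_left[OF assms] by (simp add: mult.commute)

lemma Cc_cmult: "f \<in> Cc \<Longrightarrow> (\<lambda>x::'a::euclidean_space. c * f x) \<in> Cc"
  by (rule Cc_mult_left) auto

lemma Cc_uminus: "f \<in> Cc \<Longrightarrow> (\<lambda>x::'a::euclidean_space. - f x) \<in> Cc"
  using Cc_cmult[of f "-1"] by simp

lemma Cc_add:
  fixes f :: "'a::euclidean_space \<Rightarrow> complex"
  assumes "f \<in> Cc" "g \<in> Cc"
  shows "(\<lambda>x. f x + g x) \<in> Cc"
proof -
  obtain R R' where "\<And>x. norm x > R \<Longrightarrow> f x = 0" "\<And>x. norm x > R' \<Longrightarrow> g x = 0"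
    using CcE[OF assms(1)] CcE[OF assms(2)] by metis
  then show ?thesis
    using Cc_continuous[OF assms(1)] Cc_continuous[OF assms(2)]
    by (intro CcI[of _ "max R R'"] continuous_intros) auto
qed

lemma Cc_diff:
  fixes f :: "'a::euclidean_space \<Rightarrow> complex"
  shows "f \<in> Cc \<Longrightarrow> g \<in> Cc \<Longrightarrow> (\<lambda>x. f x - g x) \<in> Cc"
  using Cc_add[of f "\<lambda>x. - g x"] Cc_uminus[of g] by simp

lemma Cc_translate:
  fixes f :: "'a::euclidean_space \<Rightarrow> complex"
  assumes "f \<in> Cc"
  shows "(\<lambda>x. f (x - a)) \<in> Cc"
proof -
  obtain R where R: "\<And>x. norm x > R \<Longrightarrow> f x = 0" using CcE[OF assms(1)] by blast
  show ?thesis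
  proof (rule CcI[of _ "R + norm a"])
    show "f (x - a) = 0" if "norm x > R + norm a" for x
      using that norm_triangle_ineq2[of x a] by (intro R) linarith
    show "continuous_on UNIV (\<lambda>x. f (x - a))"
      by (intro continuous_on_compose2[OF Cc_continuous[OF assms, of UNIV]] continuous_intros) auto
  qed
qed

lemma Cc_reflect:
  fixes f :: "'a::euclidean_space \<Rightarrow> complex"
  assumes "f \<in> Cc"
  shows "(\<lambda>x. f (- x)) \<in> Cc"
proof -
  obtain R where R: "\<And>x. norm x > R \<Longrightarrow> f x = 0" using CcE[OF assms(1)] by blast
  show ?thesis
    by (rule CcI[of _ R] continuous_on_compose2[OF Cc_continuous[OF assms, of UNIV]] continuous_intros | simp add: R)+
qed

lemma Cc_cnj:
  fixes f :: "'a::euclidean_space \<Rightarrow> complex"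
  assumes "f \<in> Cc"
  shows "(\<lambda>x. cnj (f x)) \<in> Cc"
proof -
  obtain R where R: "\<And>x. norm x > R \<Longrightarrow> f x = 0" using CcE[OF assms(1)] by blast
  show ?thesis
    by (rule CcI[of _ R]) (auto simp: R intro!: continuous_intros Cc_continuous[OF assms])
qed

lemma Cc_refl_conj: "f \<in> Cc \<Longrightarrow> refl_conj f \<in> Cc" for f :: "'a::euclidean_space \<Rightarrow> complex"
  using Cc_cnj[OF Cc_reflect, of f] by (simp add: refl_conj_def[abs_def])

lemma Cc_bounded:
  fixes f :: "'a::euclidean_space \<Rightarrow> complex"
  assumes "f \<in> Cc"
  obtains B where "B > 0" "\<And>x. norm (f x) \<le> B"
proof -
  obtain R where R: "R > 0" "\<And>x. norm x > R \<Longrightarrow> f x = 0" using CcE[OF assms(1)] by blast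
  have "compact (f ` cball 0 R)"
    by (intro compact_continuous_image Cc_continuous assms) auto
  then obtain B where B: "B > 0" "\<And>x. norm x \<le> R \<Longrightarrow> norm (f x) \<le> B"
    using compact_imp_bounded by (force simp: bounded_pos)
  have "norm (f x) \<le> B" for x
    using B(1) B(2)[of x] R(2)[of x] by (cases "norm x \<le> R") auto
  with B(1) that show thesis by blast
qed

lemma Cc_uniformly_continuous:
  fixes f :: "'a::euclidean_space \<Rightarrow> complex"
  assumes "f \<in> Cc" "e > 0"
  obtains d where "d > 0" "\<And>x y. norm (x - y) < d \<Longrightarrow> norm (f x - f y) < e"
proof -
  obtain R where R: "R > 0" "\<And>x. norm x > R \<Longrightarrow> f x = 0" using CcE[OF assms(1)] by blast
  have "uniformly_continuous_on (cball 0 (R + 1)) f"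
    by (intro compact_uniformly_continuous Cc_continuous assms) auto
  then obtain d where d: "d > 0" "\<And>x y. norm x \<le> R + 1 \<Longrightarrow> norm y \<le> R + 1 \<Longrightarrow> norm (x - y) < d \<Longrightarrow> norm (f x - f y) < e"
    unfolding uniformly_continuous_on_def dist_norm using \<open>e > 0\<close> by (metis mem_cball_0 norm_minus_commute)
  show thesis
  proof (rule that[of "min 1 d"])
    fix x y :: 'a assume "norm (x - y) < min 1 d"
    moreover have "norm x \<le> norm y + norm (x - y)" "norm y \<le> norm x + norm (x - y)"
      using norm_triangle_ineq[of y "x - y"] norm_triangle_ineq[of x "y - x"] by (auto simp: norm_minus_commute)
    ultimately show "norm (f x - f y) < e"
      using d(2)[of x y] R(2)[of x] R(2)[of y] \<open>e > 0\<close>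
      by (cases "norm x \<le> R \<or> norm y \<le> R") auto
  qed (use d in auto)
qed

lemma integrable_compact_support:
  fixes f :: "'a::euclidean_space \<Rightarrow> 'b::{banach, second_countable_topology}"
  assumes M: "loc_finite M" and f: "f \<in> borel_measurable borel"
    and B: "\<And>x. norm (f x) \<le> B" and R: "\<And>x. norm x > R \<Longrightarrow> f x = 0"
  shows "integrable M f"
proof (rule Bochner_Integration.integrable_bound[of _ "\<lambda>x. B * indicator (cball 0 R) x"])
  show "integrable M (\<lambda>x. B * indicator (cball 0 R) x :: real)"
    using loc_finite_compact[OF M, of "cball 0 R"] loc_finite_sets[OF M]
    by (intro integrable_mult_right integrable_real_indicator) auto
  show "f \<in> borel_measurable M"
    using f loc_finite_sets[OF M] by (simp cong: measurable_cong_sets)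
  have "norm (f x) \<le> norm (B * indicator (cball 0 R) x :: real)" for x
    using B[of x] R[of x] norm_ge_zero[of "f x"] by (cases "norm x \<le> R") auto
  then show "AE x in M. norm (f x) \<le> norm (B * indicator (cball 0 R) x :: real)" by simp
qed

lemma Cc_integrable:
  fixes f :: "'a::euclidean_space \<Rightarrow> complex"
  assumes "loc_finite M" "f \<in> Cc"
  shows "integrable M f"
proof -
  obtain R where R: "R > 0" "\<And>x. norm x > R \<Longrightarrow> f x = 0" using CcE[OF assms(2)] by blast
  obtain B where B: "B > 0" "\<And>x. norm (f x) \<le> B" using Cc_bounded[OF assms(2)] by blast
  show ?thesis by (rule integrable_compact_support[OF assms(1) Cc_measurable[OF assms(2)] B(2) R(2)])
qed

lemma radon_loc_finite: "radon_cmeasure \<mu> \<Longrightarrow> loc_finite (fst \<mu>)"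
  by (simp add: radon_cmeasure_def loc_finite_def)

lemma radon_integrable:
  fixes f :: "'a::euclidean_space \<Rightarrow> complex"
  assumes "radon_cmeasure \<mu>" "integrable (fst \<mu>) f"
  shows "integrable (fst \<mu>) (\<lambda>x. f x * snd \<mu> x)"
proof (rule Bochner_Integration.integrable_bound[OF assms(2)])
  show "(\<lambda>x. f x * snd \<mu> x) \<in> borel_measurable (fst \<mu>)"
    using assms by (intro borel_measurable_times) (auto simp: radon_cmeasure_def cong: measurable_cong_sets)
  have "AE x in fst \<mu>. norm (snd \<mu> x) = 1" using assms by (simp add: radon_cmeasure_def)
  then show "AE x in fst \<mu>. norm (f x * snd \<mu> x) \<le> norm (f x)"
    by eventually_elim (simp add: norm_mult)
qed

lemma cm_integral_norm_le:
  fixes f :: "'a::euclidean_space \<Rightarrow> complex"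
  assumes "radon_cmeasure \<mu>" "integrable (fst \<mu>) f"
  shows "norm (cm_integral \<mu> f) \<le> (LINT x|fst \<mu>. norm (f x))"
proof -
  have "AE x in fst \<mu>. norm (snd \<mu> x) = 1" using assms by (simp add: radon_cmeasure_def)
  then have "(LINT x|fst \<mu>. norm (f x * snd \<mu> x)) = (LINT x|fst \<mu>. norm (f x))"
    using radon_integrable[OF assms] assms
    by (intro integral_cong_AE) (auto simp: norm_mult[symmetric] elim!: eventually_mono, simp add: norm_mult)
  then show ?thesis
    unfolding cm_integral_def using integral_norm_bound[of "fst \<mu>" "\<lambda>x. f x * snd \<mu> x"] by simp
qed

lemma cm_integral_add:
  fixes f :: "'a::euclidean_space \<Rightarrow> complex"
  assumes "radon_cmeasure \<mu>" "integrable (fst \<mu>) f" "integrable (fst \<mu>) g"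
  shows "cm_integral \<mu> (\<lambda>x. f x + g x) = cm_integral \<mu> f + cm_integral \<mu> g"
  unfolding cm_integral_def using radon_integrable[OF assms(1)] assms
  by (simp add: distrib_right)

lemma cm_integral_diff:
  fixes f :: "'a::euclidean_space \<Rightarrow> complex"
  assumes "radon_cmeasure \<mu>" "integrable (fst \<mu>) f" "integrable (fst \<mu>) g"
  shows "cm_integral \<mu> (\<lambda>x. f x - g x) = cm_integral \<mu> f - cm_integral \<mu> g"
  unfolding cm_integral_def using radon_integrable[OF assms(1)] assms
  by (simp add: left_diff_distrib)

lemma cm_integral_cmult: "cm_integral \<mu> (\<lambda>x. c * f x) = c * cm_integral \<mu> f"
  unfolding cm_integral_def by (simp add: mult.assoc)

section \<open>Smooth functions\<close>

abbreviation dd :: "'a::real_normed_vector \<Rightarrow> ('a \<Rightarrow> complex) \<Rightarrow> 'a \<Rightarrow> complex" where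
  "dd v f \<equiv> \<lambda>x. frechet_derivative f (at x) v"

lemma dd_eq: "(\<And>x. (f has_derivative f' x) (at x)) \<Longrightarrow> dd v f = (\<lambda>x. f' x v)"
  using frechet_derivative_at by metis

text \<open>Coinduction: a class of differentiable functions that is stable under directional
  derivatives consists of smooth functions. Smoothness is then proved by naming an invariant family,
  without formulas for iterated derivatives.\<close>

lemma smooth_coinduct:
  assumes "P f"
    and "\<And>g x. P g \<Longrightarrow> g differentiable (at x)"
    and "\<And>g v. P g \<Longrightarrow> P (dd v g)"
  shows "smooth_fun f"
proof -
  have "P (dderivs vs f)" for vs
    by (induction vs) (use assms(1,3) in auto)
  with assms(2) show ?thesis unfolding smooth_fun_def by blast
qed

lemma smooth_differentiable: "smooth_fun f \<Longrightarrow> f differentiable (at x)"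
  unfolding smooth_fun_def by (metis dderivs.simps(1))

lemma dderivs_append: "dderivs (us @ vs) f = dderivs us (dderivs vs f)"
  by (induction us) auto

lemma smooth_dderivs: "smooth_fun f \<Longrightarrow> smooth_fun (dderivs vs f)"
  unfolding smooth_fun_def by (metis dderivs_append)

lemma smooth_dd: "smooth_fun f \<Longrightarrow> smooth_fun (dd v f)"
  using smooth_dderivs[of f "[v]"] by simp

lemma smooth_has_derivative: "smooth_fun f \<Longrightarrow> (f has_derivative (\<lambda>v. dd v f x)) (at x)"
  using smooth_differentiable frechet_derivative_works by (metis (no_types, lifting) eta_contract_eq)

lemma smooth_continuous: "smooth_fun f \<Longrightarrow> continuous_on S f"
  by (meson continuous_at_imp_continuous_on differentiable_imp_continuous_within smooth_differentiable)

lemma smooth_funI: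
  assumes "\<And>x. f differentiable (at x)" "\<And>v. smooth_fun (dd v f)"
  shows "smooth_fun f"
proof (rule smooth_coinduct[of "\<lambda>g. g = f \<or> smooth_fun g"])
  show "g differentiable at x" if "g = f \<or> smooth_fun g" for g x
    using that assms(1) smooth_differentiable by blast
  show "dd v g = f \<or> smooth_fun (dd v g)" if "g = f \<or> smooth_fun g" for g v
    using that assms(2) smooth_dd by blast
qed simp

text \<open>The algebra generated by \<open>G\<close> over the smooth functions. Derivatives of
  generators may thus be polynomials in generators with smooth coefficients, which is what the chain
  rule produces for \<open>bump\<close>.\<close>

inductive smooth_algebra :: "('a::real_normed_vector \<Rightarrow> complex) set \<Rightarrow> ('a \<Rightarrow> complex) \<Rightarrow> bool" for G where
  base: "smooth_fun f \<Longrightarrow> smooth_algebra G f"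
| gen: "g \<in> G \<Longrightarrow> smooth_algebra G g"
| add: "smooth_algebra G f \<Longrightarrow> smooth_algebra G g \<Longrightarrow> smooth_algebra G (\<lambda>x. f x + g x)"
| mult: "smooth_algebra G f \<Longrightarrow> smooth_algebra G g \<Longrightarrow> smooth_algebra G (\<lambda>x. f x * g x)"

text \<open>The sum and product rules make the whole algebra stable under differentiation once the
  generators have their derivatives in it, so it is an invariant class for
  \<open>smooth_coinduct\<close>.\<close>

lemma smooth_algebra_smooth:
  assumes G: "\<And>g x. g \<in> G \<Longrightarrow> g differentiable (at x)" "\<And>g v. g \<in> G \<Longrightarrow> smooth_algebra G (dd v g)"
    and f: "smooth_algebra G f"
  shows "smooth_fun f"
proof -
  have "(\<forall>x. g differentiable (at x)) \<and> (\<forall>v. smooth_algebra G (dd v g))" if "smooth_algebra G g" for g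
    using that
  proof (induction rule: smooth_algebra.induct)
    case (base f)
    then show ?case using smooth_differentiable smooth_dd smooth_algebra.base by blast
  next
    case (gen g)
    then show ?case using G by blast
  next
    case (add f g)
    have "((\<lambda>x. f x + g x) has_derivative (\<lambda>v. dd v f x + dd v g x)) (at x)" for x
      using add.IH by (intro has_derivative_add) (auto simp: frechet_derivative_works[symmetric])
    note d = this
    show ?case
    proof (intro conjI allI)
      show "(\<lambda>x. f x + g x) differentiable at x" for x using d by (auto simp: differentiable_def)
      show "smooth_algebra G (dd v (\<lambda>x. f x + g x))" for v
        unfolding dd_eq[OF d] using add.IH by (intro smooth_algebra.add) auto
    qed
  next
    case (mult f g)
    have "((\<lambda>x. f x * g x) has_derivative (\<lambda>v. f x * dd v g x + dd v f x * g x)) (at x)" for x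
      using mult.IH by (intro has_derivative_mult) (auto simp: frechet_derivative_works[symmetric])
    note d = this
    show ?case
    proof (intro conjI allI)
      show "(\<lambda>x. f x * g x) differentiable at x" for x using d by (auto simp: differentiable_def)
      show "smooth_algebra G (dd v (\<lambda>x. f x * g x))" for v
        unfolding dd_eq[OF d] using mult by (intro smooth_algebra.add smooth_algebra.mult) auto
    qed
  qed
  then show ?thesis using f by (intro smooth_coinduct[of "smooth_algebra G"]) auto
qed

lemma smooth_add: "smooth_fun f \<Longrightarrow> smooth_fun g \<Longrightarrow> smooth_fun (\<lambda>x. f x + g x)"
  and smooth_mult: "smooth_fun f \<Longrightarrow> smooth_fun g \<Longrightarrow> smooth_fun (\<lambda>x. f x * g x)"
  by (rule smooth_algebra_smooth[of "{}"]; auto intro: smooth_algebra.intros)+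

lemma smooth_const [simp]: "smooth_fun (\<lambda>x::'a::real_normed_vector. c)"
  by (rule smooth_coinduct[of "\<lambda>f. \<exists>c. f = (\<lambda>x. c)"]) (auto simp: frechet_derivative_const)

lemma smooth_cmult: "smooth_fun f \<Longrightarrow> smooth_fun (\<lambda>x. c * f x)"
  by (intro smooth_mult smooth_const)

lemma smooth_diff: "smooth_fun f \<Longrightarrow> smooth_fun g \<Longrightarrow> smooth_fun (\<lambda>x. f x - g x)"
  using smooth_add[of f "\<lambda>x. (-1) * g x"] smooth_cmult[of g "-1"] by simp

lemma smooth_echar_inner: "smooth_fun (\<lambda>x. echar (x \<bullet> t))" for t :: "'a::euclidean_space"
proof (rule smooth_coinduct[of "\<lambda>f. \<exists>c. f = (\<lambda>x. c * echar (x \<bullet> t))"])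
  have der: "((\<lambda>x. c * echar (x \<bullet> t)) has_derivative
      (\<lambda>v. c * (2 * of_real pi * \<i> * of_real (v \<bullet> t)) * echar (x \<bullet> t))) (at x)" for c x
  proof -
    have "((\<lambda>x. 2 * of_real pi * \<i> * complex_of_real (x \<bullet> t)) has_derivative
        (\<lambda>v. 2 * of_real pi * \<i> * of_real (v \<bullet> t))) (at x)"
      by (intro has_derivative_mult_right has_derivative_of_real has_derivative_inner_left has_derivative_ident)
    from has_derivative_compose[OF this DERIV_exp[unfolded has_field_derivative_def]]
    have "((\<lambda>x. exp (2 * of_real pi * \<i> * complex_of_real (x \<bullet> t))) has_derivative
        (\<lambda>v. exp (2 * of_real pi * \<i> * complex_of_real (x \<bullet> t)) * (2 * of_real pi * \<i> * of_real (v \<bullet> t)))) (at x)" .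
    from has_derivative_mult_right[OF this, of c] show ?thesis
      unfolding echar_def by (rule has_derivative_eq_rhs) (simp add: mult_ac)
  qed
  show "g differentiable at x" if "\<exists>c. g = (\<lambda>x. c * echar (x \<bullet> t))" for g x
    using that der by (auto simp: differentiable_def)
  show "\<exists>c. dd v g = (\<lambda>x. c * echar (x \<bullet> t))" if "\<exists>c. g = (\<lambda>x. c * echar (x \<bullet> t))" for g v
    using that dd_eq[OF der] by auto
qed (auto intro: exI[of _ 1])

lemma smooth_scale:
  fixes f :: "'a::real_normed_vector \<Rightarrow> complex"
  assumes "smooth_fun f"
  shows "smooth_fun (\<lambda>x. f (r *\<^sub>R x))"
proof (rule smooth_coinduct[of "\<lambda>g. \<exists>c f. smooth_fun f \<and> g = (\<lambda>x. c * f (r *\<^sub>R x))"])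
  have der: "((\<lambda>x. c * f (r *\<^sub>R x)) has_derivative (\<lambda>v. (c * of_real r) * dd v f (r *\<^sub>R x))) (at x)"
    if f: "smooth_fun f" for c x and f :: "'a \<Rightarrow> complex"
  proof -
    have "((\<lambda>x. c * f (r *\<^sub>R x)) has_derivative (\<lambda>v. c * dd (r *\<^sub>R v) f (r *\<^sub>R x))) (at x)"
      by (intro has_derivative_mult_right has_derivative_compose[OF _ smooth_has_derivative[OF f]]
          has_derivative_scaleR_right has_derivative_ident)
    moreover have "dd (r *\<^sub>R v) f z = of_real r * dd v f z" for v z
      using linear_cmul[OF linear_frechet_derivative[OF smooth_differentiable[OF f]]]
      by (simp add: scaleR_conv_of_real)
    ultimately show ?thesis by (simp add: mult.assoc)
  qed
  show "g differentiable at x" if "\<exists>c f. smooth_fun f \<and> g = (\<lambda>x. c * f (r *\<^sub>R x))" for g :: "'a \<Rightarrow> complex" and x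
  proof -
    from that obtain c f where g: "smooth_fun f" "g = (\<lambda>x. c * f (r *\<^sub>R x))" by blast
    show ?thesis unfolding g(2) using der[OF g(1)] by (auto simp: differentiable_def)
  qed
  show "\<exists>c f. smooth_fun f \<and> dd v g = (\<lambda>x. c * f (r *\<^sub>R x))" if "\<exists>c f. smooth_fun f \<and> g = (\<lambda>x. c * f (r *\<^sub>R x))" for g :: "'a \<Rightarrow> complex" and v
  proof -
    from that obtain c f where g: "smooth_fun f" "g = (\<lambda>x. c * f (r *\<^sub>R x))" by blast
    show ?thesis
      using smooth_dd[OF g(1), of v] dd_eq[OF der[OF g(1), of c], of v]
      by (intro exI[of _ "c * of_real r"] exI[of _ "dd v f"]) (simp add: g(2))
  qed
  show "\<exists>c fa. smooth_fun fa \<and> (\<lambda>x. f (r *\<^sub>R x)) = (\<lambda>x. c * fa (r *\<^sub>R x))"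
    using assms by (intro exI[of _ 1] exI[of _ f]) simp
qed

section \<open>Flat functions and smooth bumps\<close>

definition flat_exp :: "nat \<Rightarrow> real \<Rightarrow> real" where
  "flat_exp k t = (if t > 0 then (1 / t) ^ k / exp (1 / t) else 0)"

text \<open>The powers of 1/t are built into the family so that it is closed under differentiation:
  away from 0 this is the product rule, and at 0 the exponential kills every power.\<close>

lemma flat_exp_has_derivative:
  "(flat_exp k has_real_derivative (flat_exp (k + 2) t - real k * flat_exp (k + 1) t)) (at t)"
proof -
  consider "t < 0" | "t = 0" | "t > 0" by linarith
  then show ?thesis
  proof cases
    case 1
    have "((\<lambda>t. 0) has_real_derivative 0) (at t)" by simp
    then have "(flat_exp k has_real_derivative 0) (at t)"
      by (rule has_field_derivative_transform_within_open[of _ _ _ "{..<0}"]) (use 1 in \<open>auto simp: flat_exp_def\<close>)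
    with 1 show ?thesis by (simp add: flat_exp_def)
  next
    case 3
    have eq: "flat_exp k t = inverse t ^ k * exp (- inverse t)" if "t > 0" for k t
      using that by (simp add: flat_exp_def exp_minus divide_inverse)
    have "((\<lambda>t. inverse t ^ k * exp (- inverse t)) has_real_derivative
        (flat_exp (k + 2) t - real k * flat_exp (k + 1) t)) (at t)"
    proof (cases k)
      case (Suc n)
      with 3 show ?thesis
        by (auto intro!: derivative_eq_intros simp: eq algebra_simps) (cases n; simp)
    qed (use 3 in \<open>auto intro!: derivative_eq_intros simp: eq power2_eq_square field_simps\<close>)
    then show ?thesis
      by (rule has_field_derivative_transform_within_open[of _ _ _ "{0<..}"]) (use 3 in \<open>auto simp: eq\<close>)
  next
    case 2
    have "((\<lambda>t. (flat_exp k (0 + t) - flat_exp k 0) / t) \<longlongrightarrow> 0) (at 0)"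
    proof (rule filterlim_split_at)
      show "((\<lambda>t. (flat_exp k (0 + t) - flat_exp k 0) / t) \<longlongrightarrow> 0) (at_left 0)"
        by (rule Lim_transform_eventually[OF tendsto_const])
           (auto simp: flat_exp_def eventually_at_filter)
      \<comment> \<open>The right difference quotient at 0 is (1/t)^(k+1) / exp (1/t), which is the
        standard limit at infinity in the variable 1/t.\<close>
      have "((\<lambda>t. inverse t ^ Suc k / exp (inverse t)) \<longlongrightarrow> (0::real)) (at_right 0)"
        using filterlim_compose[OF tendsto_power_div_exp_0 filterlim_inverse_at_top_right] .
      then show "((\<lambda>t. (flat_exp k (0 + t) - flat_exp k 0) / t) \<longlongrightarrow> 0) (at_right 0)"
        by (rule Lim_transform_eventually)
           (auto simp: flat_exp_def eventually_at_filter field_simps)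
    qed
    then have "(flat_exp k has_real_derivative 0) (at 0)"
      by (simp add: DERIV_def)
    with 2 show ?thesis by (simp add: flat_exp_def)
  qed
qed

text \<open>The parameter is the square of the support radius. Using x \<bullet> x instead of the
  norm keeps the inner function smooth at the origin.\<close>

definition bump :: "real \<Rightarrow> 'a::euclidean_space \<Rightarrow> complex" where
  "bump c x = of_real (flat_exp 0 (c - x \<bullet> x))"

lemma smooth_bump: "smooth_fun (bump c :: 'a::euclidean_space \<Rightarrow> complex)"
proof -
  \<comment> \<open>Differentiating the member of index k yields members of index k + 1 and k + 2
    times the linear function x \<bullet> v, so all k are taken together as generators.\<close>
  define G where "G = range (\<lambda>k (x::'a). complex_of_real (flat_exp k (c - x \<bullet> x)))"
  have lin: "smooth_fun (\<lambda>x::'a. complex_of_real (x \<bullet> v))" for v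
  proof -
    have der: "((\<lambda>x::'a. complex_of_real (x \<bullet> v)) has_derivative (\<lambda>h. of_real (h \<bullet> v))) (at x)" for x
      by (intro has_derivative_of_real has_derivative_inner_left has_derivative_ident)
    show ?thesis
    proof (rule smooth_funI)
      show "(\<lambda>x. complex_of_real (x \<bullet> v)) differentiable (at x)" for x
        using der by (auto simp: differentiable_def)
      show "smooth_fun (dd h (\<lambda>x. complex_of_real (x \<bullet> v)))" for h
        unfolding dd_eq[OF der] by (rule smooth_const)
    qed
  qed
  have der: "((\<lambda>x::'a. complex_of_real (flat_exp k (c - x \<bullet> x))) has_derivative
     (\<lambda>v. (of_real (flat_exp (k + 2) (c - x \<bullet> x)) + of_real (- real k) * of_real (flat_exp (k + 1) (c - x \<bullet> x)))
        * (of_real (- 2) * of_real (x \<bullet> v)))) (at x)" for k x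
  proof -
    have "((\<lambda>x::'a. c - x \<bullet> x) has_derivative (\<lambda>v. - 2 * (x \<bullet> v))) (at x)"
      by (auto intro!: derivative_eq_intros simp: inner_commute)
    from has_derivative_compose[OF this flat_exp_has_derivative[of k, unfolded has_field_derivative_def]]
    have "((\<lambda>x::'a. flat_exp k (c - x \<bullet> x)) has_derivative
      (\<lambda>v. (flat_exp (k + 2) (c - x \<bullet> x) - real k * flat_exp (k + 1) (c - x \<bullet> x)) * (- 2 * (x \<bullet> v)))) (at x)" .
    from has_derivative_of_real[OF this] show ?thesis
      by (rule has_derivative_eq_rhs) simp
  qed
  have alg: "smooth_algebra G (\<lambda>x::'a. of_real (flat_exp k (c - x \<bullet> x)))" for k
    by (rule smooth_algebra.gen) (auto simp: G_def)
  have "smooth_fun (\<lambda>x::'a. complex_of_real (flat_exp 0 (c - x \<bullet> x)))"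
  proof (rule smooth_algebra_smooth[OF _ _ alg])
    show "g differentiable at x" if "g \<in> G" for g x
      using that der unfolding G_def differentiable_def by auto
    show "smooth_algebra G (dd v g)" if "g \<in> G" for g v
    proof -
      from that obtain k where g: "g = (\<lambda>x. of_real (flat_exp k (c - x \<bullet> x)))" unfolding G_def by auto
      show ?thesis
        unfolding g dd_eq[OF der]
        by (intro smooth_algebra.add smooth_algebra.mult alg)
           (rule smooth_algebra.base smooth_const lin)+
    qed
  qed
  then show ?thesis unfolding bump_def[abs_def] .
qed

lemma Cc_inf_iff: "f \<in> Cc_inf \<longleftrightarrow> smooth_fun f \<and> f \<in> Cc"
  by (auto simp: Cc_inf_def Cc_def smooth_continuous)

lemma bump_Cc_inf: "bump c \<in> Cc_inf"
proof -
  have "c - x \<bullet> x \<le> 0" if "norm x > sqrt c" for x :: 'a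
    using that real_sqrt_less_mono[of "x \<bullet> x" c] unfolding norm_eq_sqrt_inner by linarith
  then have "bump c x = 0" if "norm x > sqrt c" for x :: 'a
    using that by (fastforce simp: bump_def flat_exp_def)
  then show ?thesis
    unfolding Cc_inf_iff using smooth_bump[of c] CcI smooth_continuous by blast
qed

lemma dd_Cc_inf:
  fixes f :: "'a::euclidean_space \<Rightarrow> complex"
  assumes "f \<in> Cc_inf" shows "dd v f \<in> Cc_inf"
proof -
  from assms have f: "smooth_fun f" "f \<in> Cc" by (auto simp: Cc_inf_iff)
  obtain R where R: "R > 0" "\<And>x. norm x > R \<Longrightarrow> f x = 0" using CcE[OF f(2)] by blast
  have "dd v f x = 0" if x: "norm x > R" for x
  proof -
    have "((\<lambda>x. 0) has_derivative (\<lambda>h. 0)) (at x)" by simp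
    then have "(f has_derivative (\<lambda>h. 0)) (at x)"
      by (rule has_derivative_transform_within_open[of _ _ _ _ "- cball 0 R"]) (use x R(2) in auto)
    then show ?thesis using frechet_derivative_at by metis
  qed
  then show ?thesis
    unfolding Cc_inf_iff using smooth_dd[OF f(1), of v] by (auto intro!: CcI[of _ R] smooth_continuous)
qed

lemma dderivs_Cc_inf: "f \<in> Cc_inf \<Longrightarrow> dderivs vs f \<in> Cc_inf" for f :: "'a::euclidean_space \<Rightarrow> complex"
  by (induction vs) (auto simp: dd_Cc_inf)

lemma Cc_inf_Cc: "f \<in> Cc_inf \<Longrightarrow> f \<in> Cc"
  by (simp add: Cc_inf_iff)

lemma Cc_inf_diff: "f \<in> Cc_inf \<Longrightarrow> g \<in> Cc_inf \<Longrightarrow> (\<lambda>x::'a::euclidean_space. f x - g x) \<in> Cc_inf"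
  by (simp add: Cc_inf_iff smooth_diff Cc_diff)

lemma Cc_inf_mult: "f \<in> Cc_inf \<Longrightarrow> smooth_fun g \<Longrightarrow> (\<lambda>x::'a::euclidean_space. g x * f x) \<in> Cc_inf"
  by (simp add: Cc_inf_iff smooth_mult smooth_continuous Cc_mult_left)

section \<open>Convolution and Fourier integrals\<close>

text \<open>One substitution covers translations, dilations and, since c may be negative, the
  reflections needed for convolutions and for \<open>refl_conj\<close>.\<close>

lemma lborel_affine_integral:
  fixes f :: "'a::euclidean_space \<Rightarrow> 'b::{banach, second_countable_topology}"
  assumes f: "f \<in> borel_measurable borel" and c: "c \<noteq> 0"
  shows "(LINT x|lborel. f x) = (\<bar>c\<bar> ^ DIM('a)) *\<^sub>R (LINT x|lborel. f (t + c *\<^sub>R x))"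
    and "integrable lborel f \<longleftrightarrow> integrable lborel (\<lambda>x. f (t + c *\<^sub>R x))"
proof -
  have m: "(\<lambda>x::'a. t + c *\<^sub>R x) \<in> lborel \<rightarrow>\<^sub>M borel" by simp
  have "(LINT x|lborel. f x) = (LINT x|density (distr lborel borel (\<lambda>x. t + c *\<^sub>R x)) (\<lambda>_. ennreal (\<bar>c\<bar> ^ DIM('a))). f x)"
    using lborel_affine[OF c, of t] by simp
  also have "\<dots> = (LINT x|distr lborel borel (\<lambda>x. t + c *\<^sub>R x). (\<bar>c\<bar> ^ DIM('a)) *\<^sub>R f x)"
    using f by (intro integral_density) auto
  also have "\<dots> = (\<bar>c\<bar> ^ DIM('a)) *\<^sub>R (LINT x|lborel. f (t + c *\<^sub>R x))"
    using f m by (subst integral_distr) auto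
  finally show "(LINT x|lborel. f x) = (\<bar>c\<bar> ^ DIM('a)) *\<^sub>R (LINT x|lborel. f (t + c *\<^sub>R x))" .
  have "integrable lborel f \<longleftrightarrow> integrable (density (distr lborel borel (\<lambda>x. t + c *\<^sub>R x)) (\<lambda>_. ennreal (\<bar>c\<bar> ^ DIM('a)))) f"
    using lborel_affine[OF c, of t] by simp
  also have "\<dots> \<longleftrightarrow> integrable (distr lborel borel (\<lambda>x. t + c *\<^sub>R x)) (\<lambda>x. (\<bar>c\<bar> ^ DIM('a)) *\<^sub>R f x)"
    using f by (intro integrable_density) auto
  also have "\<dots> \<longleftrightarrow> integrable (distr lborel borel (\<lambda>x. t + c *\<^sub>R x)) f"
    using c integrable_scaleR_right[of "inverse (\<bar>c\<bar> ^ DIM('a))" _ "\<lambda>x. (\<bar>c\<bar> ^ DIM('a)) *\<^sub>R f x"]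
    by (auto simp: field_simps)
  also have "\<dots> \<longleftrightarrow> integrable lborel (\<lambda>x. f (t + c *\<^sub>R x))"
    using f m by (intro integrable_distr_eq)
  finally show "integrable lborel f \<longleftrightarrow> integrable lborel (\<lambda>x. f (t + c *\<^sub>R x))" .
qed

lemma lborel_translate_integral:
  fixes f :: "'a::euclidean_space \<Rightarrow> 'b::{banach, second_countable_topology}"
  assumes f: "f \<in> borel_measurable borel"
  shows "(LINT x|lborel. f (x - a)) = (LINT x|lborel. f x)"
    and "(LINT x|lborel. f (a - x)) = (LINT x|lborel. f x)"
    and "(LINT x|lborel. f (- x)) = (LINT x|lborel. f x)"
  using lborel_affine_integral(1)[OF f, of 1 "- a"] lborel_affine_integral(1)[OF f, of "-1" a]
    lborel_affine_integral(1)[OF f, of "-1" 0] by simp_all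

lemma integrable_prod_mult:
  fixes u :: "'a \<Rightarrow> real" and v :: "'b \<Rightarrow> real"
  assumes "sigma_finite_measure M" "sigma_finite_measure N" "integrable M u" "integrable N v"
  shows "integrable (M \<Otimes>\<^sub>M N) (\<lambda>p. u (fst p) * v (snd p))"
proof -
  interpret M: sigma_finite_measure M by fact
  interpret N: sigma_finite_measure N by fact
  interpret pair_sigma_finite M N ..
  note [measurable] = borel_measurable_integrable[OF assms(3)] borel_measurable_integrable[OF assms(4)]
  show ?thesis
  proof (rule Fubini_integrable)
    show "integrable M (\<lambda>x. LINT y|N. norm (u (fst (x, y)) * v (snd (x, y))))"
      using assms(3) by (simp add: abs_mult)
    show "AE x in M. integrable N (\<lambda>y. u (fst (x, y)) * v (snd (x, y)))"
      using assms(4) by simp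
  qed measurable
qed

lemma Fubini_dominated:
  fixes F :: "'a \<Rightarrow> 'b \<Rightarrow> 'c::{banach, second_countable_topology}"
  assumes MN: "sigma_finite_measure M" "sigma_finite_measure N"
    and F: "case_prod F \<in> borel_measurable (M \<Otimes>\<^sub>M N)"
    and uv: "integrable M u" "integrable N v"
    and b: "\<And>x y. norm (F x y) \<le> u x * v y"
  shows "(LINT x|M. LINT y|N. F x y) = (LINT y|N. LINT x|M. F x y)"
    and "integrable M (\<lambda>x. LINT y|N. F x y)" "integrable N (\<lambda>y. LINT x|M. F x y)"
proof -
  interpret M: sigma_finite_measure M by fact
  interpret N: sigma_finite_measure N by fact
  interpret pair_sigma_finite M N ..
  have "norm (case_prod F p) \<le> norm (u (fst p) * v (snd p))" for p
    using b[of "fst p" "snd p"] by (simp add: case_prod_beta')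
  then have i: "integrable (M \<Otimes>\<^sub>M N) (case_prod F)"
    using Bochner_Integration.integrable_bound[OF integrable_prod_mult[OF MN uv] F] by blast
  from Fubini_integral[OF i] integrable_fst[OF i] integrable_snd[OF i]
  show "(LINT x|M. LINT y|N. F x y) = (LINT y|N. LINT x|M. F x y)"
    "integrable M (\<lambda>x. LINT y|N. F x y)" "integrable N (\<lambda>y. LINT x|M. F x y)"
    by simp_all
qed

lemma cm_integral_Fubini:
  fixes F :: "'a::euclidean_space \<Rightarrow> 'b::euclidean_space \<Rightarrow> complex"
  assumes \<mu>: "radon_cmeasure \<mu>" and N: "loc_finite N"
    and F: "continuous_on UNIV (\<lambda>p. F (fst p) (snd p))"
    and uv: "integrable (fst \<mu>) u" "integrable N v"
    and b: "\<And>x y. norm (F x y) \<le> u x * v y" and u0: "\<And>x. u x \<ge> 0"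
  shows "cm_integral \<mu> (\<lambda>x. LINT y|N. F x y) = (LINT y|N. cm_integral \<mu> (\<lambda>x. F x y))"
    and "integrable N (\<lambda>y. cm_integral \<mu> (\<lambda>x. F x y))"
proof -
  note M = radon_loc_finite[OF \<mu>]
  have s: "sets (fst \<mu>) = sets borel" "sets N = sets borel" using M N by (auto simp: loc_finite_sets)
  \<comment> \<open>The phase has modulus 1 only almost everywhere, while
    \<open>Fubini_dominated\<close> wants a pointwise bound; its modulus is therefore kept as a
    factor of the dominating function.\<close>
  have "integrable (fst \<mu>) (\<lambda>x. norm (complex_of_real (u x) * snd \<mu> x))"
    using uv(1) by (intro integrable_norm radon_integrable[OF \<mu>]) auto
  then have u': "integrable (fst \<mu>) (\<lambda>x. u x * norm (snd \<mu> x))"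
    using u0 by (simp add: norm_mult)
  have h: "snd \<mu> \<in> borel_measurable (fst \<mu>)"
    using \<mu> by (auto simp: radon_cmeasure_def cong: measurable_cong_sets)
  have m: "(\<lambda>(x, y). F x y * snd \<mu> x) \<in> borel_measurable (fst \<mu> \<Otimes>\<^sub>M N)"
    unfolding case_prod_beta' by (intro borel_measurable_times borel_measurable_continuous_pair[OF F s]) (use h in measurable)
  have b': "norm (F x y * snd \<mu> x) \<le> (u x * norm (snd \<mu> x)) * v y" for x y
    using mult_right_mono[OF b[of x y], of "norm (snd \<mu> x)"] by (simp add: norm_mult mult_ac)
  note * = Fubini_dominated[OF loc_finite_sigma_finite[OF M] loc_finite_sigma_finite[OF N] m u' uv(2) b']
  show "cm_integral \<mu> (\<lambda>x. LINT y|N. F x y) = (LINT y|N. cm_integral \<mu> (\<lambda>x. F x y))"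
    using *(1) by (simp add: cm_integral_def)
  show "integrable N (\<lambda>y. cm_integral \<mu> (\<lambda>x. F x y))"
    using *(3) by (simp add: cm_integral_def)
qed

lemma Cc_compose_continuous:
  assumes "f \<in> Cc" "continuous_on UNIV g"
  shows "continuous_on UNIV (\<lambda>p. f (g p))"
  by (rule continuous_on_compose2[OF Cc_continuous[OF assms(1), of UNIV] assms(2)]) auto

lemma inv_fourier_bound:
  fixes f :: "'a::euclidean_space \<Rightarrow> complex"
  shows "norm (inv_fourier f y) \<le> (LINT x|lborel. norm (f x))"
  unfolding inv_fourier_echar
  using integral_norm_bound[of lborel "\<lambda>x. f x * echar (x \<bullet> y)"] by (simp add: norm_mult)

lemma Cc_echar_integrable:
  fixes f :: "'a::euclidean_space \<Rightarrow> complex"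
  assumes "f \<in> Cc"
  shows "integrable lborel (\<lambda>x. f x * echar (x \<bullet> y))"
  by (intro Cc_integrable loc_finite_lborel Cc_mult_right assms continuous_intros)

lemma inv_fourier_continuous:
  fixes f :: "'a::euclidean_space \<Rightarrow> complex"
  assumes "f \<in> Cc"
  shows "continuous_on S (inv_fourier f)"
proof -
  have "continuous_on UNIV (inv_fourier f)"
    unfolding continuous_on_sequentially
  proof (intro allI ballI impI)
    fix y :: "nat \<Rightarrow> 'a" and a assume "(\<forall>n. y n \<in> UNIV) \<and> y \<longlonglongrightarrow> a"
    then have y: "y \<longlonglongrightarrow> a" by simp
    have e: "(\<lambda>n. echar (x \<bullet> y n)) \<longlonglongrightarrow> echar (x \<bullet> a)" for x
      using continuous_on_tendsto_compose[OF continuous_echar[OF continuous_on_id, of UNIV] tendsto_inner[OF tendsto_const y, of x]]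
      by simp
    show "(inv_fourier f \<circ> y) \<longlonglongrightarrow> inv_fourier f a"
      unfolding inv_fourier_echar o_def
    proof (rule integral_dominated_convergence[where w="\<lambda>x. norm (f x)"])
      show "integrable lborel (\<lambda>x. norm (f x))" by (intro integrable_norm Cc_integrable loc_finite_lborel assms)
      show "(\<lambda>x. f x * echar (x \<bullet> a)) \<in> borel_measurable lborel" "(\<lambda>x. f x * echar (x \<bullet> y n)) \<in> borel_measurable lborel" for n
        using borel_measurable_integrable[OF Cc_echar_integrable[OF assms]] by blast+
      show "AE x in lborel. (\<lambda>n. f x * echar (x \<bullet> y n)) \<longlonglongrightarrow> f x * echar (x \<bullet> a)"
        by (intro AE_I2 tendsto_mult tendsto_const e)
    qed (simp add: norm_mult)
  qed
  then show ?thesis by (rule continuous_on_subset) simp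
qed

lemma inv_fourier_add:
  fixes f :: "'a::euclidean_space \<Rightarrow> complex"
  assumes "f \<in> Cc" "g \<in> Cc"
  shows "inv_fourier (\<lambda>x. f x + g x) y = inv_fourier f y + inv_fourier g y"
  unfolding inv_fourier_echar using Cc_echar_integrable[OF assms(1)] Cc_echar_integrable[OF assms(2)]
  by (simp add: distrib_right)

lemma inv_fourier_cmult: "inv_fourier (\<lambda>x. c * f x) y = c * inv_fourier f y"
  unfolding inv_fourier_echar by (simp add: mult.assoc)

lemma inv_fourier_modulate: "inv_fourier (\<lambda>x. cnj (echar (t \<bullet> x)) * f x) y = inv_fourier f (y - t)"
  unfolding inv_fourier_echar inner_diff_right echar_diff
  by (intro Bochner_Integration.integral_cong) (simp_all add: inner_commute mult_ac)

lemma inv_fourier_refl_conj: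
  fixes f :: "'a::euclidean_space \<Rightarrow> complex"
  assumes "f \<in> Cc"
  shows "inv_fourier (refl_conj f) y = cnj (inv_fourier f y)"
proof -
  have "inv_fourier (refl_conj f) y = (LINT x|lborel. cnj (f (- x) * echar (- x \<bullet> y)))"
    unfolding inv_fourier_echar refl_conj_def by (simp add: echar_minus)
  also have "\<dots> = (LINT x|lborel. cnj (f x * echar (x \<bullet> y)))"
    by (intro lborel_translate_integral(3)[of "\<lambda>x. cnj (f x * echar (x \<bullet> y))"]
        borel_measurable_continuous_onI continuous_intros Cc_continuous assms)
  finally show ?thesis unfolding inv_fourier_echar by (simp del: complex_cnj_mult)
qed

lemma inv_fourier_scale:
  fixes f :: "'a::euclidean_space \<Rightarrow> complex"
  assumes "f \<in> Cc" "r > 0"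
  shows "inv_fourier (\<lambda>x. f (x /\<^sub>R r)) y = of_real (r ^ DIM('a)) * inv_fourier f (r *\<^sub>R y)"
proof -
  have m: "(\<lambda>x. f (x /\<^sub>R r) * echar (x \<bullet> y)) \<in> borel_measurable borel"
    by (intro borel_measurable_continuous_onI Cc_compose_continuous[OF assms(1)] continuous_intros)
  have "inv_fourier (\<lambda>x. f (x /\<^sub>R r)) y = (r ^ DIM('a)) *\<^sub>R (LINT x|lborel. f ((0 + r *\<^sub>R x) /\<^sub>R r) * echar ((0 + r *\<^sub>R x) \<bullet> y))"
    unfolding inv_fourier_echar using assms(2) lborel_affine_integral(1)[OF m, of r 0] by simp
  then show ?thesis using assms(2) by (simp add: inv_fourier_echar scaleR_conv_of_real)
qed

lemma fconv_altdef:
  fixes f :: "'a::euclidean_space \<Rightarrow> complex"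
  assumes "f \<in> Cc" "g \<in> Cc"
  shows "fconv f g x = (LINT y|lborel. f (x - y) * g y)"
proof -
  have "fconv f g x = (LINT y|lborel. (\<lambda>z. f (x - z) * g z) (x - y))"
    by (simp add: fconv_def)
  also have "\<dots> = (LINT y|lborel. f (x - y) * g y)"
    by (intro lborel_translate_integral(2) borel_measurable_continuous_onI continuous_intros
        Cc_compose_continuous[OF assms(1)] Cc_continuous assms)
  finally show ?thesis .
qed

lemma fconv_integrable:
  fixes f :: "'a::euclidean_space \<Rightarrow> complex"
  assumes "f \<in> Cc" "continuous_on UNIV g"
  shows "integrable lborel (\<lambda>y. f y * g (x - y))"
  by (intro Cc_integrable loc_finite_lborel Cc_mult_right assms continuous_on_compose2[OF assms(2)] continuous_intros) auto

text \<open>The second conclusion keeps the radii explicit, so that supports of convolutions with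
  mollifiers can be bounded uniformly in the mollifier.\<close>

lemma fconv_Cc:
  fixes f :: "'a::euclidean_space \<Rightarrow> complex"
  assumes "f \<in> Cc" "g \<in> Cc"
  shows "fconv f g \<in> Cc"
    and "\<And>R R' x. (\<And>x. norm x > R \<Longrightarrow> f x = 0) \<Longrightarrow> (\<And>x. norm x > R' \<Longrightarrow> g x = 0) \<Longrightarrow> norm x > R + R' \<Longrightarrow> fconv f g x = 0"
proof -
  show supp: "fconv f g x = 0" if R: "\<And>x. norm x > R \<Longrightarrow> f x = 0" "\<And>x. norm x > R' \<Longrightarrow> g x = 0" and x: "norm x > R + R'" for R R' x
  proof -
    have *: "f y * g (x - y) = 0" for y
    proof (cases "norm y > R")
      case False
      then have "norm (x - y) > R'" using x norm_triangle_ineq2[of x y] by linarith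
      then show ?thesis by (simp add: R)
    qed (simp add: R)
    show ?thesis unfolding fconv_def * by simp
  qed
  obtain R R' where R: "\<And>x. norm x > R \<Longrightarrow> f x = 0" "\<And>x. norm x > R' \<Longrightarrow> g x = 0"
    using CcE[OF assms(1)] CcE[OF assms(2)] by metis
  show "fconv f g \<in> Cc"
  proof (rule CcI[OF _ supp[OF R]])
    show "continuous_on UNIV (fconv f g)"
      unfolding continuous_on_sequentially
    proof (intro allI ballI impI)
      fix u :: "nat \<Rightarrow> 'a" and a assume "(\<forall>n. u n \<in> UNIV) \<and> u \<longlonglongrightarrow> a"
      then have u: "u \<longlonglongrightarrow> a" by simp
      obtain B where B: "B > 0" "\<And>x. norm (g x) \<le> B" using Cc_bounded[OF assms(2)] by blast
      have t: "(\<lambda>n. g (u n - y)) \<longlonglongrightarrow> g (a - y)" for y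
        by (rule continuous_on_tendsto_compose[OF Cc_continuous[OF assms(2), of UNIV]]) (auto intro!: tendsto_intros u)
      show "(fconv f g \<circ> u) \<longlonglongrightarrow> fconv f g a"
        unfolding fconv_def o_def
      proof (rule integral_dominated_convergence[where w="\<lambda>x. norm (f x) * B"])
        show "integrable lborel (\<lambda>x. norm (f x) * B)"
          by (intro integrable_mult_left integrable_norm Cc_integrable loc_finite_lborel assms)
        show "(\<lambda>y. f y * g (a - y)) \<in> borel_measurable lborel" "(\<lambda>y. f y * g (u n - y)) \<in> borel_measurable lborel" for n
          using borel_measurable_integrable[OF fconv_integrable[OF assms(1) Cc_continuous[OF assms(2)]]] by blast+
        show "AE y in lborel. (\<lambda>n. f y * g (u n - y)) \<longlonglongrightarrow> f y * g (a - y)"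
          by (intro AE_I2 tendsto_mult tendsto_const t)
      qed (use B in \<open>auto simp: norm_mult intro!: mult_left_mono\<close>)
    qed
  qed
qed

lemma inv_fourier_fconv:
  fixes f :: "'a::euclidean_space \<Rightarrow> complex"
  assumes "f \<in> Cc" "g \<in> Cc"
  shows "inv_fourier (fconv f g) y = inv_fourier f y * inv_fourier g y"
proof -
  have i: "integrable lborel (\<lambda>x. norm (f x))" "integrable lborel (\<lambda>x. norm (g x))"
    by (intro integrable_norm Cc_integrable loc_finite_lborel assms)+
  have sf: "sigma_finite_measure (lborel :: 'a measure)" by (rule lborel.sigma_finite_measure_axioms)
  obtain R R' where R: "\<And>x. norm x > R \<Longrightarrow> f x = 0" "\<And>x. norm x > R' \<Longrightarrow> g x = 0"
    using CcE[OF assms(1)] CcE[OF assms(2)] by metis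
  obtain B where B: "B > 0" "\<And>x. norm (g x) \<le> B" using Cc_bounded[OF assms(2)] by blast
  have c: "continuous_on UNIV (\<lambda>p. f (snd p) * g (fst p - snd p) * echar (fst p \<bullet> y))"
    by (intro continuous_intros Cc_compose_continuous[OF assms(1)] Cc_compose_continuous[OF assms(2)])
  have bd: "norm (f z * g (x - z) * echar (x \<bullet> y)) \<le> (B * indicator (cball 0 (R + R')) x) * norm (f z)" for x z
  proof (cases "norm x \<le> R + R'")
    case True
    then show ?thesis using B mult_right_mono[OF B(2)[of "x - z"], of "norm (f z)"] by (simp add: norm_mult mult_ac)
  next
    case False
    have "f z * g (x - z) = 0"
    proof (cases "norm z > R")
      case F: False
      then have "norm (x - z) > R'" using False norm_triangle_ineq2[of x z] by linarith
      then show ?thesis by (simp add: R)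
    qed (simp add: R)
    then show ?thesis using B(1) by (auto simp: norm_mult)
  qed
  have ib: "integrable lborel (\<lambda>x::'a. B * indicator (cball 0 (R + R')) x)"
    using emeasure_compact_finite[of "cball (0::'a) (R + R')"]
    by (intro integrable_mult_right integrable_real_indicator) auto
  have "inv_fourier (fconv f g) y = (LINT x|lborel. LINT z|lborel. f z * g (x - z) * echar (x \<bullet> y))"
    unfolding inv_fourier_echar fconv_def by simp
  also have "\<dots> = (LINT z|lborel. LINT x|lborel. f z * g (x - z) * echar (x \<bullet> y))"
    by (rule Fubini_dominated(1)[OF sf sf borel_measurable_continuous_pair(2)[OF c] ib i(1) bd]) auto
  also have "\<dots> = (LINT z|lborel. f z * echar (z \<bullet> y) * inv_fourier g y)"
  proof (intro Bochner_Integration.integral_cong refl)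
    fix z
    have "(LINT x|lborel. g (x - z) * echar ((x - z) \<bullet> y)) = inv_fourier g y"
      unfolding inv_fourier_echar
      by (intro lborel_translate_integral(1)[of "\<lambda>x. g x * echar (x \<bullet> y)"] borel_measurable_continuous_onI
          continuous_intros Cc_continuous assms)
    moreover have *: "f z * g (x - z) * echar (x \<bullet> y) = f z * echar (z \<bullet> y) * (g (x - z) * echar ((x - z) \<bullet> y))" for x
      using echar_add[of "z \<bullet> y" "(x - z) \<bullet> y"] by (simp flip: inner_add_left)
    ultimately show "(LINT x|lborel. f z * g (x - z) * echar (x \<bullet> y)) = f z * echar (z \<bullet> y) * inv_fourier g y"
      unfolding * by simp
  qed
  also have "\<dots> = inv_fourier f y * inv_fourier g y"
    unfolding inv_fourier_echar by simp
  finally show ?thesis .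
qed

lemma linear_dd: "smooth_fun f \<Longrightarrow> linear (\<lambda>v. dd v f x)"
  by (rule linear_frechet_derivative[OF smooth_differentiable])

text \<open>The first-order remainder is controlled with one modulus for all base points, which is
  what differentiation under the convolution integral needs. The finitely many partial derivatives
  have compact support, hence are uniformly continuous; dividing e by d pays for summing over the
  basis.\<close>

lemma Cc_inf_uniformly_differentiable:
  fixes f :: "'a::euclidean_space \<Rightarrow> complex"
  assumes "f \<in> Cc_inf" "e > 0"
  obtains d where "d > 0" "\<And>x h. norm h < d \<Longrightarrow> norm (f (x + h) - f x - dd h f x) \<le> e * norm h"
proof -
  have sm: "smooth_fun f" using assms by (simp add: Cc_inf_iff)
  define e' where "e' = e / DIM('a)"
  have e': "e' > 0" using assms(2) by (simp add: e'_def)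
  have "\<exists>d>0. \<forall>x y. norm (x - y) < d \<longrightarrow> norm (dd b f x - dd b f y) < e'" for b
    using Cc_uniformly_continuous[OF Cc_inf_Cc[OF dd_Cc_inf[OF assms(1)]] e'] by metis
  then obtain d where d: "\<And>b. d b > 0" "\<And>b x y. norm (x - y) < d b \<Longrightarrow> norm (dd b f x - dd b f y) < e'"
    by metis
  define d0 where "d0 = Min (d ` Basis)"
  have d0: "d0 > 0" "\<And>b. b \<in> Basis \<Longrightarrow> d0 \<le> d b" using d(1) by (auto simp: d0_def)
  show thesis
  proof (rule that[OF d0(1)])
    fix x h :: 'a assume h: "norm h < d0"
    have "norm (f (x + h) - f x - dd (x + h - x) f x) \<le> norm (x + h - x) * e"
    proof (rule differentiable_bound_linearization[of x "x + h" "ball x d0" f "\<lambda>z v. dd v f z"])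
      show "x + t *\<^sub>R (x + h - x) \<in> ball x d0" if "t \<in> {0..1}" for t
      proof -
        have "\<bar>t\<bar> * norm h \<le> 1 * norm h" using that by (intro mult_right_mono) auto
        then show ?thesis using h by (simp add: dist_norm)
      qed
      show "(f has_derivative (\<lambda>v. dd v f z)) (at z within ball x d0)" for z
        using smooth_has_derivative[OF sm] has_derivative_at_withinI by blast
      show "onorm ((\<lambda>v. dd v f z) - (\<lambda>v. dd v f x)) \<le> e" if "z \<in> ball x d0" for z
      proof (rule onorm_le)
        fix v :: 'a
        let ?D = "\<lambda>v. dd v f z - dd v f x"
        have lin: "linear ?D" by (intro linear_compose_sub linear_dd sm)
        have "?D v = ?D (\<Sum>b\<in>Basis. (v \<bullet> b) *\<^sub>R b)" by (simp add: euclidean_representation)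
        also have "\<dots> = (\<Sum>b\<in>Basis. (v \<bullet> b) *\<^sub>R ?D b)"
          by (simp only: linear_sum[OF lin] linear_cmul[OF lin])
        also have "norm \<dots> \<le> (\<Sum>b\<in>(Basis::'a set). norm v * e')"
        proof (rule sum_norm_le)
          fix b :: 'a assume b: "b \<in> Basis"
          have "norm (?D b) \<le> e'"
            using d(2)[of z x b] d0(2)[OF b] that by (simp add: dist_norm norm_minus_commute)
          then show "norm ((v \<bullet> b) *\<^sub>R ?D b) \<le> norm v * e'"
            using Basis_le_norm[OF b, of v] by (simp, intro mult_mono) auto
        qed
        also have "\<dots> = e * norm v" by (simp add: e'_def)
        finally show "norm (((\<lambda>v. dd v f z) - (\<lambda>v. dd v f x)) v) \<le> e * norm v" by simp
      qed
    qed (use d0 in auto)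
    then show "norm (f (x + h) - f x - dd h f x) \<le> e * norm h" by (simp add: mult.commute)
  qed
qed

text \<open>The remainder of \<rho> is small uniformly in the point x - z, so integrating it against
  the modulus of f costs only the factor I. The denominator I + 1 covers the case I = 0.\<close>

lemma fconv_has_derivative:
  fixes f \<rho> :: "'a::euclidean_space \<Rightarrow> complex"
  assumes f: "f \<in> Cc" and \<rho>: "\<rho> \<in> Cc_inf"
  shows "(fconv f \<rho> has_derivative (\<lambda>v. fconv f (dd v \<rho>) x)) (at x)"
  unfolding has_derivative_at_alt
proof (intro conjI allI impI)
  have sm: "smooth_fun \<rho>" and c: "\<And>S. continuous_on S \<rho>" using \<rho> by (auto simp: Cc_inf_iff Cc_continuous)
  have i: "integrable lborel (\<lambda>y. f y * \<rho> (z - y))" "integrable lborel (\<lambda>y. f y * dd v \<rho> (z - y))" for z v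
    by (intro fconv_integrable f c Cc_continuous Cc_inf_Cc dd_Cc_inf \<rho>)+
  have "linear (\<lambda>v. fconv f (dd v \<rho>) x)"
  proof (rule linearI)
    note lin = linear_add[OF linear_dd[OF sm]] linear_cmul[OF linear_dd[OF sm]]
    show "fconv f (dd (v + w) \<rho>) x = fconv f (dd v \<rho>) x + fconv f (dd w \<rho>) x" for v w
      unfolding fconv_def lin using i by (simp add: distrib_left)
    show "fconv f (dd (r *\<^sub>R v) \<rho>) x = r *\<^sub>R fconv f (dd v \<rho>) x" for v r
      unfolding fconv_def lin by simp
  qed
  then show "bounded_linear (\<lambda>v. fconv f (dd v \<rho>) x)" by (simp add: linear_conv_bounded_linear)
  fix e :: real assume e: "e > 0"
  define I where "I = (LINT y|lborel. norm (f y))"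
  have I: "I \<ge> 0" by (simp add: I_def)
  then obtain d where d: "d > 0" "\<And>x h. norm h < d \<Longrightarrow> norm (\<rho> (x + h) - \<rho> x - dd h \<rho> x) \<le> e / (I + 1) * norm h"
    using Cc_inf_uniformly_differentiable[OF \<rho>, of "e / (I + 1)"] e by auto
  show "\<exists>d>0. \<forall>y. norm (y - x) < d \<longrightarrow> norm (fconv f \<rho> y - fconv f \<rho> x - fconv f (dd (y - x) \<rho>) x) \<le> e * norm (y - x)"
  proof (intro exI[of _ d] conjI allI impI d(1))
    fix y assume y: "norm (y - x) < d"
    let ?E = "\<lambda>z. f z * \<rho> (y - z) - f z * \<rho> (x - z) - f z * dd (y - x) \<rho> (x - z)"
    have "norm (fconv f \<rho> y - fconv f \<rho> x - fconv f (dd (y - x) \<rho>) x) = norm (LINT z|lborel. ?E z)"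
      unfolding fconv_def using i by simp
    also have "\<dots> \<le> (LINT z|lborel. norm (?E z))" by (rule integral_norm_bound)
    also have "\<dots> \<le> (LINT z|lborel. norm (f z) * (e / (I + 1) * norm (y - x)))"
    proof (rule integral_mono)
      show "integrable lborel (\<lambda>z. norm (?E z))" using i by simp
      show "integrable lborel (\<lambda>z. norm (f z) * (e / (I + 1) * norm (y - x)))"
        by (intro integrable_mult_left integrable_norm Cc_integrable loc_finite_lborel f)
      fix z
      have "?E z = f z * (\<rho> (x - z + (y - x)) - \<rho> (x - z) - dd (y - x) \<rho> (x - z))"
        by (simp add: algebra_simps)
      then show "norm (?E z) \<le> norm (f z) * (e / (I + 1) * norm (y - x))"
        using d(2)[OF y, of "x - z"] by (simp only: norm_mult) (intro mult_left_mono norm_ge_zero)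
    qed
    also have "\<dots> = I * (e / (I + 1) * norm (y - x))" by (simp add: I_def)
    also have "\<dots> \<le> e * norm (y - x)"
    proof -
      have "I * (e / (I + 1)) \<le> e" using I e by (simp add: field_simps)
      from mult_right_mono[OF this, of "norm (y - x)"] show ?thesis by (simp add: mult.assoc)
    qed
    finally show "norm (fconv f \<rho> y - fconv f \<rho> x - fconv f (dd (y - x) \<rho>) x) \<le> e * norm (y - x)" .
  qed
qed

text \<open>All derivatives fall on the smooth factor, so the convolutions of the fixed f with
  arbitrary test functions form an invariant class for \<open>smooth_coinduct\<close>.\<close>

lemma fconv_Cc_inf:
  fixes f \<rho> :: "'a::euclidean_space \<Rightarrow> complex"
  assumes f: "f \<in> Cc" and \<rho>: "\<rho> \<in> Cc_inf"
  shows "fconv f \<rho> \<in> Cc_inf"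
proof -
  have "smooth_fun (fconv f \<rho>)"
  proof (rule smooth_coinduct[of "\<lambda>g. \<exists>\<rho>\<in>Cc_inf. g = fconv f \<rho>"])
    show "g differentiable at x" if "\<exists>\<rho>\<in>Cc_inf. g = fconv f \<rho>" for g x
      using that fconv_has_derivative[OF f] by (auto simp: differentiable_def)
    show "\<exists>\<rho>\<in>Cc_inf. dd v g = fconv f \<rho>" if "\<exists>\<rho>\<in>Cc_inf. g = fconv f \<rho>" for g v
    proof -
      from that obtain \<rho> where g: "\<rho> \<in> Cc_inf" "g = fconv f \<rho>" by blast
      have "dd v g = fconv f (dd v \<rho>)"
        unfolding g(2) dd_eq[OF fconv_has_derivative[OF f g(1)]] by simp
      then show ?thesis using dd_Cc_inf[OF g(1)] by blast
    qed
  qed (use \<rho> in blast)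
  then show ?thesis using fconv_Cc[OF f Cc_inf_Cc[OF \<rho>]] by (simp add: Cc_inf_iff)
qed

section \<open>Schwartz seminorms and decay of Fourier transforms\<close>

text \<open>K is obtained before M, C and t. This order of quantifiers is the source of the
  uniformity in n and in translations in all later estimates.\<close>

lemma tbound_wt_integral:
  obtains K :: real where "K \<ge> 0"
    "\<And>(M :: 'a::euclidean_space measure) C t. tbound M C \<Longrightarrow> integrable M (\<lambda>y. wt (y - t))"
    "\<And>(M :: 'a::euclidean_space measure) C t. tbound M C \<Longrightarrow> (LINT y|M. wt (y - t)) \<le> C * K"
proof -
  define K where "K = (2::real) ^ DIM('a) * (\<Sum>k. 1 / real (Suc k) ^ 2)"
  have sm: "summable (\<lambda>k. 1 / real (Suc k) ^ 2)"
    using inverse_power_summable[of 2, where 'a=real] by (subst summable_Suc_iff) (simp add: inverse_eq_divide)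
  have K: "K \<ge> 0" unfolding K_def using suminf_nonneg[OF sm] by simp
  have n: "(\<integral>\<^sup>+y. ennreal (wt (y - t)) \<partial>M) \<le> ennreal (C * K)" if "tbound M C" for M :: "'a measure" and C t
    using tbound_wt[OF that] by (simp add: K_def)
  have m: "(\<lambda>y. wt (y - t)) \<in> borel_measurable M" if "tbound M C" for M :: "'a measure" and C t
  proof -
    have "(\<lambda>y::'a. wt (y - t)) \<in> borel_measurable borel" by measurable
    then show ?thesis using that by (simp add: tbound_def cong: measurable_cong_sets)
  qed
  show thesis
  proof (rule that[OF K])
    fix M :: "'a measure" and C t assume M: "tbound M C"
    show i: "integrable M (\<lambda>y. wt (y - t))"
      using n[OF M, of t] by (intro integrableI_bounded m[OF M]) (simp add: le_less_trans[OF _ ennreal_less_top])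
    have "ennreal (LINT y|M. wt (y - t)) \<le> ennreal (C * K)"
      using n[OF M, of t] nn_integral_eq_integral[OF i] by simp
    then show "(LINT y|M. wt (y - t)) \<le> C * K"
      using K M by (subst (asm) ennreal_le_iff) (auto simp: tbound_def)
  qed
qed

lemma integrable_wt_lborel: "integrable lborel (wt :: 'a::euclidean_space \<Rightarrow> real)"
proof -
  obtain K :: real where K: "\<And>(M :: 'a measure) C t. tbound M C \<Longrightarrow> integrable M (\<lambda>y. wt (y - t))"
    using tbound_wt_integral by metis
  show ?thesis using K[OF tbound_lborel, of 0] by simp
qed

section \<open>Finiteness of the Schwartz seminorms on test functions\<close>

definition basis_lists :: "nat \<Rightarrow> 'a::euclidean_space list set" where
  "basis_lists n = {bs. set bs \<subseteq> Basis \<and> length bs = n}"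

lemma basis_lists_Suc:
  "basis_lists (Suc n) = (\<lambda>(b, bs). b # bs) ` (Basis \<times> basis_lists n)"
  unfolding basis_lists_def by (auto simp: length_Suc_conv image_iff)

text \<open>Iterated directional derivatives are multilinear in the directions, and the coefficients
  are products of coordinates of vectors in the unit ball. The supremum over all directions in
  \<open>schwartz_seminorm\<close> is thereby reduced to finitely many basis lists.\<close>

lemma dderivs_basis_expansion:
  fixes f :: "'a::euclidean_space \<Rightarrow> complex"
  assumes f: "smooth_fun f" and vs: "\<forall>v\<in>set vs. norm v \<le> 1"
  shows "\<exists>c. (\<forall>bs\<in>basis_lists (length vs). \<bar>c bs\<bar> \<le> 1) \<and>
    (\<forall>x. dderivs vs f x = (\<Sum>bs\<in>basis_lists (length vs). c bs *\<^sub>R dderivs bs f x))"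
  using vs
proof (induction vs)
  case Nil
  have "basis_lists 0 = {[] :: 'a list}" by (auto simp: basis_lists_def)
  then show ?case by (intro exI[of _ "\<lambda>_. 1"]) simp
next
  case (Cons v vs)
  let ?B = "basis_lists (length vs) :: 'a list set"
  from Cons obtain c where c: "\<And>bs. bs \<in> ?B \<Longrightarrow> \<bar>c bs\<bar> \<le> 1"
    "dderivs vs f = (\<lambda>x. \<Sum>bs\<in>?B. c bs *\<^sub>R dderivs bs f x)" by force
  define c' where "c' bs = (v \<bullet> hd bs) * c (tl bs)" for bs
  have "\<bar>c' bs\<bar> \<le> 1" if "bs \<in> basis_lists (length (v # vs))" for bs
  proof -
    from that obtain b bs' where bs: "b \<in> Basis" "bs' \<in> ?B" "bs = b # bs'"
      by (auto simp: basis_lists_Suc)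
    have "\<bar>v \<bullet> b\<bar> \<le> 1" using Basis_le_norm[OF bs(1), of v] Cons.prems by auto
    then have "\<bar>v \<bullet> b\<bar> * \<bar>c bs'\<bar> \<le> 1" using c(1)[OF bs(2)] by (intro mult_le_one) auto
    then show ?thesis by (simp add: c'_def bs(3) abs_mult)
  qed
  moreover have "dderivs (v # vs) f x = (\<Sum>bs\<in>basis_lists (length (v # vs)). c' bs *\<^sub>R dderivs bs f x)" for x
  proof -
    have sm: "smooth_fun (dderivs bs f)" for bs using f by (rule smooth_dderivs)
    have "((\<lambda>x. \<Sum>bs\<in>?B. c bs *\<^sub>R dderivs bs f x) has_derivative
       (\<lambda>v. \<Sum>bs\<in>?B. c bs *\<^sub>R dd v (dderivs bs f) x)) (at x)" for x
      by (intro has_derivative_sum has_derivative_scaleR_right smooth_has_derivative sm)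
    from dd_eq[OF this, of v]
    have "dderivs (v # vs) f x = (\<Sum>bs\<in>?B. c bs *\<^sub>R dd v (dderivs bs f) x)"
      by (simp add: c(2))
    also have "\<dots> = (\<Sum>bs\<in>?B. c bs *\<^sub>R (\<Sum>b\<in>Basis. (v \<bullet> b) *\<^sub>R dd b (dderivs bs f) x))"
    proof (intro sum.cong refl arg_cong2[where f=scaleR])
      fix bs
      have "dd v (dderivs bs f) x = dd (\<Sum>b\<in>Basis. (v \<bullet> b) *\<^sub>R b) (dderivs bs f) x"
        by (simp add: euclidean_representation)
      also have "\<dots> = (\<Sum>b\<in>Basis. (v \<bullet> b) *\<^sub>R dd b (dderivs bs f) x)"
        by (simp only: linear_sum[OF linear_dd[OF sm]] linear_cmul[OF linear_dd[OF sm]])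
      finally show "dd v (dderivs bs f) x = (\<Sum>b\<in>Basis. (v \<bullet> b) *\<^sub>R dd b (dderivs bs f) x)" .
    qed
    also have "\<dots> = (\<Sum>bs\<in>?B. \<Sum>b\<in>Basis. c' (b # bs) *\<^sub>R dderivs (b # bs) f x)"
      by (simp add: scaleR_sum_right c'_def mult.commute)
    also have "\<dots> = (\<Sum>b\<in>Basis. \<Sum>bs\<in>?B. c' (b # bs) *\<^sub>R dderivs (b # bs) f x)"
      by (rule sum.swap)
    also have "\<dots> = (\<Sum>(b, bs)\<in>Basis \<times> ?B. c' (b # bs) *\<^sub>R dderivs (b # bs) f x)"
      by (rule sum.cartesian_product)
    also have "\<dots> = (\<Sum>bs\<in>basis_lists (length (v # vs)). c' bs *\<^sub>R dderivs bs f x)"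
      unfolding length_Cons basis_lists_Suc
      by (subst sum.reindex) (auto simp: inj_on_def case_prod_beta' simp del: dderivs.simps)
    finally show ?thesis .
  qed
  ultimately show ?case by blast
qed

lemma Cc_inf_weighted_bounded:
  fixes f :: "'a::euclidean_space \<Rightarrow> complex"
  assumes "f \<in> Cc_inf"
  obtains B where "B \<ge> 0" "\<And>x. (1 + norm x) ^ N * norm (dderivs vs f x) \<le> B"
proof -
  have "(\<lambda>x. of_real ((1 + norm x) ^ N) * dderivs vs f x) \<in> Cc"
    by (intro Cc_mult_left Cc_inf_Cc dderivs_Cc_inf assms continuous_intros)
  then obtain B where "B > 0" "\<And>x. norm (of_real ((1 + norm x) ^ N) * dderivs vs f x) \<le> B"
    by (rule Cc_bounded) blast
  then show thesis
    by (intro that[of B]) (auto simp: norm_mult norm_power simp del: of_real_power of_real_add)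
qed

lemma Cc_inf_schwartz:
  fixes f :: "'a::euclidean_space \<Rightarrow> complex"
  assumes f: "f \<in> Cc_inf"
  shows "f \<in> schwartz"
proof -
  have "bounded (range (\<lambda>x. (1 + norm x) ^ N * norm (dderivs vs f x)))" for N vs
  proof -
    obtain B where "\<And>x. (1 + norm x) ^ N * norm (dderivs vs f x) \<le> B"
      using Cc_inf_weighted_bounded[OF f] by metis
    then show ?thesis by (auto simp: bounded_iff intro!: exI[of _ B])
  qed
  with f show ?thesis by (auto simp: schwartz_def Cc_inf_iff)
qed

text \<open>A real \<open>SUP\<close> bounds its members only if the set is bounded above. The upper
  bound used is the sum, over all basis lists of length at most N, of the bounds that compact
  support provides.\<close>

lemma schwartz_seminorm_upper:
  fixes f :: "'a::euclidean_space \<Rightarrow> complex"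
  assumes f: "f \<in> Cc_inf" and vs: "length vs \<le> N" "\<forall>v\<in>set vs. norm v \<le> 1"
  shows "(1 + norm x) ^ N * norm (dderivs vs f x) \<le> schwartz_seminorm N f"
proof -
  have "\<exists>B\<ge>0. \<forall>x. (1 + norm x) ^ N * norm (dderivs bs f x) \<le> B" for bs
    using Cc_inf_weighted_bounded[OF f] by metis
  then obtain B where B: "\<And>bs. B bs \<ge> 0" "\<And>bs x. (1 + norm x) ^ N * norm (dderivs bs f x) \<le> B bs"
    by metis
  have b: "(1 + norm x) ^ N * norm (dderivs vs f x) \<le> (\<Sum>n\<le>N. \<Sum>bs\<in>basis_lists n. B bs)"
    if vs: "length vs \<le> N" "\<forall>v\<in>set vs. norm v \<le> 1" for x vs
  proof -
    obtain c where c: "\<forall>bs\<in>basis_lists (length vs). \<bar>c bs\<bar> \<le> 1"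
       "dderivs vs f x = (\<Sum>bs\<in>basis_lists (length vs). c bs *\<^sub>R dderivs bs f x)"
      using dderivs_basis_expansion[OF _ vs(2)] f by (metis Cc_inf_iff)
    have "norm (dderivs vs f x) \<le> (\<Sum>bs\<in>basis_lists (length vs). norm (dderivs bs f x))"
      unfolding c(2)
    proof (rule sum_norm_le)
      show "norm (c bs *\<^sub>R dderivs bs f x) \<le> norm (dderivs bs f x)" if "bs \<in> basis_lists (length vs)" for bs
        using c(1) that by (auto intro!: mult_left_le_one_le)
    qed
    then have "(1 + norm x) ^ N * norm (dderivs vs f x)
      \<le> (1 + norm x) ^ N * (\<Sum>bs\<in>basis_lists (length vs). norm (dderivs bs f x))"
      by (intro mult_left_mono) auto
    also have "\<dots> \<le> (\<Sum>bs\<in>basis_lists (length vs). B bs)"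
      unfolding sum_distrib_left by (intro sum_mono B)
    also have "\<dots> \<le> (\<Sum>n\<le>N. \<Sum>bs\<in>basis_lists n. B bs)"
      using member_le_sum[of "length vs" "{..N}" "\<lambda>n. \<Sum>bs\<in>basis_lists n. B bs"] vs B(1)
      by (auto intro!: sum_nonneg)
    finally show ?thesis .
  qed
  let ?S = "{(x :: 'a, vs :: 'a list). length vs \<le> N \<and> (\<forall>v\<in>set vs. norm v \<le> 1)}"
  have "bdd_above ((\<lambda>p. (1 + norm (fst p)) ^ N * norm (dderivs (snd p) f (fst p))) ` ?S)"
    using b by (intro bdd_aboveI2[of _ _ "\<Sum>n\<le>N. \<Sum>bs\<in>basis_lists n. B bs"]) auto
  from cSUP_upper[OF _ this, of "(x, vs)"] show ?thesis
    using vs unfolding schwartz_seminorm_def by simp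
qed

lemma Cc_inf_L1_bound:
  fixes f :: "'a::euclidean_space \<Rightarrow> complex"
  assumes f: "f \<in> Cc_inf" and vs: "length vs \<le> N" "\<forall>v\<in>set vs. norm v \<le> 1" and N: "N \<ge> DIM('a) + 2"
  shows "(LINT x|lborel. norm (dderivs vs f x)) \<le> schwartz_seminorm N f * (LINT x|lborel. wt (x :: 'a))"
proof -
  have "(LINT x|lborel. norm (dderivs vs f x)) \<le> (LINT x|lborel. schwartz_seminorm N f * wt (x :: 'a))"
  proof (rule integral_mono)
    show "integrable lborel (\<lambda>x. norm (dderivs vs f x))"
      by (intro integrable_norm Cc_integrable loc_finite_lborel Cc_inf_Cc dderivs_Cc_inf f)
    show "integrable lborel (\<lambda>x. schwartz_seminorm N f * wt (x :: 'a))"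
      by (intro integrable_mult_right integrable_wt_lborel)
    fix x :: 'a
    have "(1 + norm x) ^ (DIM('a) + 2) * norm (dderivs vs f x) \<le> (1 + norm x) ^ N * norm (dderivs vs f x)"
      using N by (intro mult_right_mono power_increasing) auto
    also have "\<dots> \<le> schwartz_seminorm N f" by (rule schwartz_seminorm_upper[OF f vs])
    finally have *: "(1 + norm x) ^ (DIM('a) + 2) * norm (dderivs vs f x) \<le> schwartz_seminorm N f" .
    have "0 < (1 + norm x) ^ (DIM('a) + 2)" by (intro zero_less_power add_pos_nonneg) auto
    with * show "norm (dderivs vs f x) \<le> schwartz_seminorm N f * wt x"
      unfolding wt_def by (simp only: le_divide_eq times_divide_eq_right mult_1_right mult.commute if_True)
  qed
  then show ?thesis by simp
qed

section \<open>Transforms of derivatives and their decay\<close>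

definition cutoff :: "real \<Rightarrow> 'a::euclidean_space \<Rightarrow> complex" where
  "cutoff R x = of_real (max 0 (min 1 (R + 1 - norm x)))"

lemma cutoff_Cc: "cutoff R \<in> Cc"
  by (rule CcI[of _ "R + 1"]) (auto simp: cutoff_def[abs_def] intro!: continuous_intros)

lemma cutoff_1: "norm x \<le> R \<Longrightarrow> cutoff R x = 1"
  by (simp add: cutoff_def)

text \<open>Near 0 this convolution is a multiple of a character, so its derivative at 0 gives the transform
  of a derivative without integrating by parts.\<close>

lemma fconv_cutoff_echar:
  fixes f :: "'a::euclidean_space \<Rightarrow> complex"
  assumes f: "f \<in> Cc" and R: "\<And>x. norm x > R \<Longrightarrow> f x = 0" and z: "norm z \<le> 1"
  shows "fconv (\<lambda>x. cutoff (R + 1) x * echar (x \<bullet> - y)) f z = echar (z \<bullet> - y) * inv_fourier f y"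
proof -
  have *: "cutoff (R + 1) (z - u) * echar ((z - u) \<bullet> - y) * f u = echar (z \<bullet> - y) * (f u * echar (u \<bullet> y))" for u
  proof (cases "norm u > R")
    case False
    then have "norm (z - u) \<le> R + 1" using z norm_triangle_ineq4[of z u] by linarith
    moreover have "echar ((z - u) \<bullet> - y) = echar (z \<bullet> - y) * echar (u \<bullet> y)"
      using echar_add[of "z \<bullet> - y" "u \<bullet> y"] by (simp add: inner_diff_left)
    ultimately show ?thesis by (simp add: cutoff_1)
  qed (simp add: R)
  have "(\<lambda>x. cutoff (R + 1) x * echar (x \<bullet> - y)) \<in> Cc"
    by (intro Cc_mult_right cutoff_Cc continuous_intros)
  from fconv_altdef[OF this f, of z] show ?thesis
    unfolding * by (simp only: inv_fourier_echar integral_mult_right_zero)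
qed

lemma inv_fourier_dd:
  fixes f :: "'a::euclidean_space \<Rightarrow> complex"
  assumes f: "f \<in> Cc_inf"
  shows "inv_fourier (dd b f) y = - (2 * of_real pi * \<i> * of_real (b \<bullet> y)) * inv_fourier f y"
proof -
  obtain R1 R2 where "\<And>x. norm x > R1 \<Longrightarrow> f x = 0" "\<And>x. norm x > R2 \<Longrightarrow> dd b f x = 0"
    using CcE[OF Cc_inf_Cc[OF f]] CcE[OF Cc_inf_Cc[OF dd_Cc_inf[OF f]]] by metis
  then obtain R where R: "\<And>x. norm x > R \<Longrightarrow> f x = 0" "\<And>x. norm x > R \<Longrightarrow> dd b f x = 0"
    by (metis max_less_iff_conj)
  let ?g = "\<lambda>x. cutoff (R + 1) x * echar (x \<bullet> - y)"
  have g: "?g \<in> Cc" by (intro Cc_mult_right cutoff_Cc continuous_intros)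
  have "((\<lambda>z. 2 * of_real pi * \<i> * complex_of_real (z \<bullet> - y)) has_derivative
        (\<lambda>v. 2 * of_real pi * \<i> * of_real (v \<bullet> - y))) (at 0)"
    by (intro has_derivative_mult_right has_derivative_of_real has_derivative_inner_left has_derivative_ident)
  from has_derivative_compose[OF this DERIV_exp[unfolded has_field_derivative_def]]
  have "((\<lambda>z. echar (z \<bullet> - y)) has_derivative (\<lambda>v. 2 * of_real pi * \<i> * of_real (v \<bullet> - y))) (at 0)"
    by (simp add: echar_def)
  from has_derivative_mult_left[OF this, of "inv_fourier f y"]
  have "(fconv ?g f has_derivative (\<lambda>v. 2 * of_real pi * \<i> * of_real (v \<bullet> - y) * inv_fourier f y)) (at 0)"
    by (rule has_derivative_transform_within_open[of _ _ _ _ "ball 0 1"])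
       (use fconv_cutoff_echar[OF Cc_inf_Cc[OF f] R(1)] in \<open>auto simp del: inner_minus_right\<close>)
  \<comment> \<open>The convolution has been differentiated at 0 as a multiple of a character;
    moving the derivative onto f instead gives a second expression, and uniqueness of the derivative
    equates them.\<close>
  from fun_cong[OF has_derivative_unique[OF this fconv_has_derivative[OF g f]], of b]
  have "fconv ?g (dd b f) 0 = 2 * of_real pi * \<i> * of_real (b \<bullet> - y) * inv_fourier f y" by simp
  moreover have "fconv ?g (dd b f) 0 = inv_fourier (dd b f) y"
    using fconv_cutoff_echar[where z=0, OF Cc_inf_Cc[OF dd_Cc_inf[OF f]] R(2)] by simp
  ultimately show ?thesis by simp
qed

lemma inv_fourier_dderivs_replicate:
  fixes f :: "'a::euclidean_space \<Rightarrow> complex"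
  assumes f: "f \<in> Cc_inf"
  shows "inv_fourier (dderivs (replicate k b) f) y = (- (2 * of_real pi * \<i> * of_real (b \<bullet> y))) ^ k * inv_fourier f y"
  by (induction k) (simp_all add: inv_fourier_dd[OF dderivs_Cc_inf[OF f]])

text \<open>C and N are chosen before f and y, so that the estimate yields temperedness and not just
  decay of each single transform. Only the direction of differentiation depends on y.\<close>

lemma inv_fourier_decay:
  obtains C N where "C \<ge> 0"
    "\<And>(f :: 'a::euclidean_space \<Rightarrow> complex) y. f \<in> Cc_inf \<Longrightarrow> (1 + norm y) ^ k * norm (inv_fourier f y) \<le> C * schwartz_seminorm N f"
proof -
  define N where "N = max k (DIM('a) + 2)"
  define W where "W = (LINT x|lborel. wt (x :: 'a))"
  define C where "C = 2 ^ k * (1 + real DIM('a) ^ k) * W"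
  have W: "W \<ge> 0" by (simp add: W_def)
  show thesis
  proof (rule that[of C N])
    show "C \<ge> 0" using W by (simp add: C_def)
    fix f :: "'a \<Rightarrow> complex" and y :: 'a assume f: "f \<in> Cc_inf"
    let ?F = "norm (inv_fourier f y)" and ?S = "schwartz_seminorm N f * W" and ?d = "real DIM('a)"
    \<comment> \<open>Some coordinate carries at least the fraction 1/d of the norm, because the sum
      of the moduli of the coordinates dominates the norm. Derivatives in that direction then
      control powers of norm y.\<close>
    have "\<exists>b\<in>Basis. norm y \<le> ?d * \<bar>y \<bullet> b\<bar>"
    proof (rule ccontr)
      assume "\<not> (\<exists>b\<in>Basis. norm y \<le> ?d * \<bar>y \<bullet> b\<bar>)"
      then have "(\<Sum>b\<in>Basis. \<bar>y \<bullet> b\<bar>) < (\<Sum>b\<in>(Basis :: 'a set). norm y / ?d)"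
        by (intro sum_strict_mono) (auto simp: field_simps not_le)
      also have "\<dots> = norm y" by simp
      finally show False using norm_le_l1[of y] by simp
    qed
    then obtain b where b: "b \<in> Basis" "norm y \<le> ?d * \<bar>y \<bullet> b\<bar>" by blast
    have "?F \<le> (LINT x|lborel. norm (f x))" by (rule inv_fourier_bound)
    also have "\<dots> \<le> ?S" using Cc_inf_L1_bound[OF f, of "[]" N] by (simp add: N_def W_def)
    finally have 1: "?F \<le> ?S" .
    have "\<bar>y \<bullet> b\<bar> ^ k * ?F \<le> norm (inv_fourier (dderivs (replicate k b) f) y)"
    proof -
      have "\<bar>y \<bullet> b\<bar> * 1 \<le> \<bar>y \<bullet> b\<bar> * (2 * pi)" using pi_gt3 by (intro mult_left_mono) auto
      then have "\<bar>y \<bullet> b\<bar> ^ k \<le> (2 * pi * \<bar>b \<bullet> y\<bar>) ^ k" by (intro power_mono) (auto simp: inner_commute mult_ac)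
      then show ?thesis
        unfolding inv_fourier_dderivs_replicate[OF f] norm_mult norm_power norm_minus_cancel
        by (intro mult_right_mono) auto
    qed
    also have "\<dots> \<le> (LINT x|lborel. norm (dderivs (replicate k b) f x))" by (rule inv_fourier_bound)
    also have "\<dots> \<le> ?S" using Cc_inf_L1_bound[OF f, of "replicate k b" N] b(1) by (simp add: N_def W_def)
    finally have 2: "\<bar>y \<bullet> b\<bar> ^ k * ?F \<le> ?S" .
    \<comment> \<open>For norm y at most 1 the factor 2^k suffices; beyond that, 1 + norm y is at
      most twice norm y and the chosen coordinate takes over.\<close>
    have "(1 + norm y) ^ k \<le> 2 ^ k * (1 + (?d * \<bar>y \<bullet> b\<bar>) ^ k)"
    proof (cases "norm y \<le> 1")
      case True
      then have "(1 + norm y) ^ k \<le> 2 ^ k" by (intro power_mono) auto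
      also have "\<dots> \<le> 2 ^ k * (1 + (?d * \<bar>y \<bullet> b\<bar>) ^ k)" by simp
      finally show ?thesis .
    next
      case False
      then have "(1 + norm y) ^ k \<le> (2 * (?d * \<bar>y \<bullet> b\<bar>)) ^ k" using b(2) by (intro power_mono) auto
      also have "\<dots> \<le> 2 ^ k * (1 + (?d * \<bar>y \<bullet> b\<bar>) ^ k)" by (simp add: power_mult_distrib)
      finally show ?thesis .
    qed
    then have "(1 + norm y) ^ k * ?F \<le> 2 ^ k * (1 + (?d * \<bar>y \<bullet> b\<bar>) ^ k) * ?F" by (intro mult_right_mono) auto
    also have "\<dots> = 2 ^ k * (?F + ?d ^ k * (\<bar>y \<bullet> b\<bar> ^ k * ?F))" by (simp add: algebra_simps power_mult_distrib)
    also have "\<dots> \<le> 2 ^ k * (?S + ?d ^ k * ?S)" using 1 2 by (intro mult_left_mono add_mono) auto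
    also have "\<dots> = C * schwartz_seminorm N f" by (simp add: C_def algebra_simps)
    finally show "(1 + norm y) ^ k * ?F \<le> C * schwartz_seminorm N f" .
  qed
qed

section \<open>Mollification and Fourier transformable measures\<close>

lemma integral_pos_continuous:
  fixes g :: "'a::euclidean_space \<Rightarrow> real"
  assumes g: "continuous_on UNIV g" "\<And>x. g x \<ge> 0" "integrable lborel g" and a: "g a > 0"
  shows "(LINT x|lborel. g x) > 0"
proof -
  have "open {x. g x > g a / 2}"
    using g(1) by (intro open_Collect_less continuous_intros)
  then obtain d where d: "d > 0" "ball a d \<subseteq> {x. g x > g a / 2}"
    by (rule openE[of _ a]) (use a in auto)
  have "0 < g a / 2 * measure lborel (ball a d)"
    using a d(1) by (intro mult_pos_pos content_ball_pos) auto
  also have "\<dots> = (LINT x|lborel. g a / 2 * indicator (ball a d) x)"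
    by simp
  also have "\<dots> \<le> (LINT x|lborel. g x)"
  proof (rule integral_mono[OF _ g(3)])
    show "integrable lborel (\<lambda>x. g a / 2 * indicator (ball a d) x)"
      using emeasure_bounded_finite[of "ball a d"]
      by (intro integrable_mult_right integrable_real_indicator) auto
    show "g a / 2 * indicator (ball a d) x \<le> g x" for x
      using d(2) g(2)[of x] by (auto simp: indicator_def)
  qed
  finally show ?thesis .
qed

lemma flat_exp_nonneg: "flat_exp k t \<ge> 0"
  by (simp add: flat_exp_def)

lemma bump_support: "norm x > r \<Longrightarrow> r \<ge> 0 \<Longrightarrow> bump (r\<^sup>2) x = 0"
  using power_mono[of r "norm x" 2] by (simp add: bump_def flat_exp_def power2_norm_eq_inner)

lemma bump_integral_pos:
  assumes "c > 0"
  shows "(LINT x|lborel. flat_exp 0 (c - x \<bullet> (x :: 'a::euclidean_space))) > 0"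
proof (rule integral_pos_continuous[where a=0])
  have b: "bump c \<in> Cc" using bump_Cc_inf Cc_inf_Cc by blast
  have eq: "(\<lambda>x::'a. flat_exp 0 (c - x \<bullet> x)) = (\<lambda>x. Re (bump c x))" by (simp add: bump_def)
  show "continuous_on UNIV (\<lambda>x::'a. flat_exp 0 (c - x \<bullet> x))"
    unfolding eq by (intro continuous_intros Cc_continuous b)
  show "integrable lborel (\<lambda>x::'a. flat_exp 0 (c - x \<bullet> x))"
    unfolding eq by (intro integrable_Re Cc_integrable loc_finite_lborel b)
qed (use assms in \<open>auto simp: flat_exp_def\<close>)

section \<open>The approximate identity\<close>

definition mol_real :: "nat \<Rightarrow> 'a::euclidean_space \<Rightarrow> real" where
  "mol_real n x = flat_exp 0 ((1 / real (Suc n))\<^sup>2 - x \<bullet> x)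
     / (LINT x|lborel. flat_exp 0 ((1 / real (Suc n))\<^sup>2 - x \<bullet> (x :: 'a)))"

definition mol :: "nat \<Rightarrow> 'a::euclidean_space \<Rightarrow> complex" where
  "mol n x = of_real (mol_real n x)"

lemma mol_eq_bump:
  "mol n = (\<lambda>x. of_real (inverse (LINT x|lborel. flat_exp 0 ((1 / real (Suc n))\<^sup>2 - x \<bullet> (x :: 'a)))) * bump ((1 / real (Suc n))\<^sup>2) (x :: 'a::euclidean_space))"
  by (auto simp: mol_def mol_real_def bump_def divide_inverse mult.commute simp del: of_nat_Suc)

lemma mol_Cc_inf: "mol n \<in> Cc_inf"
  unfolding mol_eq_bump by (intro Cc_inf_mult bump_Cc_inf smooth_const)

lemma mol_Cc: "mol n \<in> Cc"
  using mol_Cc_inf by (rule Cc_inf_Cc)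

lemma mol_real_nonneg: "mol_real n x \<ge> 0"
  unfolding mol_real_def by (intro divide_nonneg_nonneg flat_exp_nonneg Bochner_Integration.integral_nonneg)

lemma norm_mol: "norm (mol n x) = mol_real n x"
  by (simp add: mol_def mol_real_nonneg)

lemma mol_real_integrable: "integrable lborel (mol_real n)"
  using integrable_norm[OF Cc_integrable[OF loc_finite_lborel mol_Cc[of n]]] by (simp add: norm_mol)

lemma mol_real_integral: "(LINT x|lborel. mol_real n (x :: 'a::euclidean_space)) = 1"
  using bump_integral_pos[of "(1 / real (Suc n))\<^sup>2", where 'a='a]
  unfolding mol_real_def by simp

lemma mol_integral: "(LINT x|lborel. mol n (x :: 'a::euclidean_space)) = 1"
  unfolding mol_def by (simp add: mol_real_integral)

lemma mol_support: "norm x > 1 / real (Suc n) \<Longrightarrow> mol n x = 0"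
  unfolding mol_eq_bump by (subst bump_support) auto

text \<open>Being real and even, the mollifier can stand as the conjugated factor of the polarised
  Fourier identity while the other side remains an ordinary convolution.\<close>

lemma refl_conj_mol: "refl_conj (mol n) = mol n"
  by (auto simp: refl_conj_def mol_def mol_real_def)

text \<open>No growth condition on u enters, since the mass of \<open>mol n\<close> sits in the ball
  of radius 1/(n+1). Hence characters are covered as well as translates of functions in
  \<open>Cc\<close>.\<close>

lemma mol_tendsto:
  fixes u :: "'a::euclidean_space \<Rightarrow> complex"
  assumes u: "continuous_on UNIV u"
  shows "(\<lambda>n. LINT y|lborel. u y * mol n y) \<longlonglongrightarrow> u 0"
proof (rule LIMSEQ_I)
  fix e :: real assume e: "e > 0"
  have "open {y. norm (u y - u 0) < e / 2}"
    by (intro open_Collect_less continuous_intros u)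
  then obtain d where d: "d > 0" "ball 0 d \<subseteq> {y. norm (u y - u 0) < e / 2}"
    by (rule openE[of _ 0]) (use e in auto)
  obtain N where N: "1 / real (Suc N) < d" using d(1) nat_approx_posE by metis
  show "\<exists>N. \<forall>n\<ge>N. norm ((LINT y|lborel. u y * mol n y) - u 0) < e"
  proof (intro exI[of _ N] allI impI)
    fix n assume n: "n \<ge> N"
    have i: "integrable lborel (\<lambda>y. u y * mol n y)" "integrable lborel (\<lambda>y. u 0 * mol n y)"
      "integrable lborel (\<lambda>y. (u y - u 0) * mol n y)"
      by (intro Cc_integrable loc_finite_lborel Cc_mult_left mol_Cc continuous_intros u)+
    have "(LINT y|lborel. u y * mol n y) - u 0 = (LINT y|lborel. u y * mol n y) - (LINT y|lborel. u 0 * mol n (y :: 'a))"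
      by (simp add: mol_integral)
    also have "\<dots> = (LINT y|lborel. (u y - u 0) * mol n y)"
      unfolding left_diff_distrib using i by (intro Bochner_Integration.integral_diff[symmetric])
    also have "norm \<dots> \<le> (LINT y|lborel. norm ((u y - u 0) * mol n y))"
      by (rule integral_norm_bound)
    also have "\<dots> \<le> (LINT y|lborel. e / 2 * mol_real n (y :: 'a))"
    proof (rule integral_mono)
      show "integrable lborel (\<lambda>y. norm ((u y - u 0) * mol n y))" using i(3) by (rule integrable_norm)
      show "integrable lborel (\<lambda>y::'a. e / 2 * mol_real n y)" by (intro integrable_mult_right mol_real_integrable)
      fix y :: 'a
      have "1 / real (Suc n) \<le> 1 / real (Suc N)" using n by (simp add: frac_le)
      then have "norm y < d \<or> mol n y = 0" using N mol_support[of n y] by linarith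
      then show "norm ((u y - u 0) * mol n y) \<le> e / 2 * mol_real n y"
      proof
        assume "norm y < d"
        then have "norm (u y - u 0) \<le> e / 2" using d(2) by (auto simp: subset_iff)
        then show ?thesis unfolding norm_mult norm_mol using mol_real_nonneg by (rule mult_right_mono)
      qed (use norm_mol[of n y] in auto)
    qed
    also have "\<dots> = e / 2" by (simp add: mol_real_integral)
    finally show "norm ((LINT y|lborel. u y * mol n y) - u 0) < e" using e by linarith
  qed
qed

lemma inv_fourier_mol_tendsto: "(\<lambda>n. inv_fourier (mol n) y) \<longlonglongrightarrow> 1"
  using mol_tendsto[of "\<lambda>x. echar (x \<bullet> y)"] by (simp add: inv_fourier_echar mult.commute continuous_intros)

lemma norm_inv_fourier_mol: "norm (inv_fourier (mol n) y) \<le> 1"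
  using inv_fourier_bound[of "mol n" y] by (simp add: norm_mol mol_real_integral)

lemma fconv_mol_tendsto:
  fixes f :: "'a::euclidean_space \<Rightarrow> complex"
  assumes "f \<in> Cc"
  shows "(\<lambda>n. fconv f (mol n) x) \<longlonglongrightarrow> f x"
  using mol_tendsto[OF Cc_compose_continuous[OF assms, of "\<lambda>y. x - y"]]
  by (simp add: fconv_altdef[OF assms mol_Cc] continuous_intros)

lemma norm_fconv_mol:
  fixes f :: "'a::euclidean_space \<Rightarrow> complex"
  assumes "f \<in> Cc" "\<And>x. norm (f x) \<le> B"
  shows "norm (fconv f (mol n) x) \<le> B"
proof -
  have "norm (fconv f (mol n) x) \<le> (LINT y|lborel. norm (f (x - y) * mol n y))"
    unfolding fconv_altdef[OF assms(1) mol_Cc] by (rule integral_norm_bound)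
  also have "\<dots> \<le> (LINT y|lborel. B * mol_real n (y :: 'a))"
  proof (rule integral_mono)
    show "integrable lborel (\<lambda>y. norm (f (x - y) * mol n y))"
      by (intro integrable_norm Cc_integrable loc_finite_lborel Cc_mult_left mol_Cc Cc_compose_continuous[OF assms(1)] continuous_intros)
    show "integrable lborel (\<lambda>y::'a. B * mol_real n y)" by (intro integrable_mult_right mol_real_integrable)
    show "norm (f (x - y) * mol n y) \<le> B * mol_real n y" for y
      using assms(2)[of "x - y"] mol_real_nonneg[of n y] by (auto simp: norm_mult norm_mol intro!: mult_right_mono)
  qed
  also have "\<dots> = B" by (simp add: mol_real_integral)
  finally show ?thesis .
qed

lemma cm_integral_dominated_convergence:
  fixes f :: "'a::euclidean_space \<Rightarrow> complex"
  assumes \<mu>: "radon_cmeasure \<mu>" and m: "f \<in> borel_measurable borel" "\<And>n. g n \<in> borel_measurable borel"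
    and w: "integrable (fst \<mu>) w" and l: "\<And>x. (\<lambda>n. g n x) \<longlonglongrightarrow> f x"
    and b: "\<And>n x. norm (g n x) \<le> w x"
  shows "(\<lambda>n. cm_integral \<mu> (g n)) \<longlonglongrightarrow> cm_integral \<mu> f"
  unfolding cm_integral_def
proof (rule integral_dominated_convergence[where w=w])
  have s: "sets (fst \<mu>) = sets borel" "snd \<mu> \<in> borel_measurable borel" using \<mu> by (auto simp: radon_cmeasure_def)
  show "(\<lambda>x. f x * snd \<mu> x) \<in> borel_measurable (fst \<mu>)" "(\<lambda>x. g n x * snd \<mu> x) \<in> borel_measurable (fst \<mu>)" for n
    using s m by (auto intro!: borel_measurable_times cong: measurable_cong_sets)
  show "AE x in fst \<mu>. (\<lambda>n. g n x * snd \<mu> x) \<longlonglongrightarrow> f x * snd \<mu> x"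
    by (intro AE_I2 tendsto_mult tendsto_const l)
  have "AE x in fst \<mu>. norm (snd \<mu> x) = 1" using \<mu> by (simp add: radon_cmeasure_def)
  then show "AE x in fst \<mu>. norm (g n x * snd \<mu> x) \<le> w x" for n
    by eventually_elim (simp add: norm_mult b)
qed (rule w)

text \<open>Every mollifier lives in the unit ball, so all convolutions vanish outside the ball of
  radius R + 1 and share the bound of f; a multiple of one indicator dominates them.\<close>

lemma cm_integral_mol:
  fixes f :: "'a::euclidean_space \<Rightarrow> complex"
  assumes \<mu>: "radon_cmeasure \<mu>" and f: "f \<in> Cc"
  shows "(\<lambda>n. cm_integral \<mu> (fconv f (mol n))) \<longlonglongrightarrow> cm_integral \<mu> f"
proof -
  obtain R where R: "\<And>x. norm x > R \<Longrightarrow> f x = 0" using CcE[OF f] by blast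
  obtain B where B: "B > 0" "\<And>x. norm (f x) \<le> B" using Cc_bounded[OF f] by blast
  show ?thesis
  proof (rule cm_integral_dominated_convergence[OF \<mu>, where w="\<lambda>x. B * indicator (cball 0 (R + 1)) x"])
    show "integrable (fst \<mu>) (\<lambda>x. B * indicator (cball 0 (R + 1)) x)"
      by (rule integrable_compact_support[OF radon_loc_finite[OF \<mu>], of _ B "R + 1"])
         (use B in \<open>auto simp: indicator_def\<close>)
    show "norm (fconv f (mol n) x) \<le> B * indicator (cball 0 (R + 1)) x" for n x
    proof (cases "norm x \<le> R + 1")
      case False
      have "1 / real (Suc n) \<le> 1" by simp
      then have "mol n z = 0" if "norm z > 1" for z :: 'a using mol_support[of n z] that by linarith
      then have "fconv f (mol n) x = 0"
        using False by (intro fconv_Cc(2)[where R=R and R'=1] f mol_Cc R) auto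
      then show ?thesis using B(1) by auto
    qed (use norm_fconv_mol[OF f B(2)] in auto)
  qed (auto intro!: Cc_measurable f fconv_Cc mol_Cc fconv_mol_tendsto)
qed

section \<open>Identities for Fourier transformable measures\<close>

lemma is_fourier_transform_integrable:
  assumes "is_fourier_transform \<mu> \<nu>" "f \<in> Cc" "g \<in> Cc"
  shows "integrable (fst \<nu>) (\<lambda>y. inv_fourier f y * cnj (inv_fourier g y))"
proof (rule Bochner_Integration.integrable_bound[where f="\<lambda>y. (norm (inv_fourier f y))\<^sup>2 + (norm (inv_fourier g y))\<^sup>2"])
  have s: "sets (fst \<nu>) = sets borel" using assms by (simp add: is_fourier_transform_def radon_cmeasure_def)
  show "integrable (fst \<nu>) (\<lambda>y. (norm (inv_fourier f y))\<^sup>2 + (norm (inv_fourier g y))\<^sup>2)"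
    using assms by (auto simp: is_fourier_transform_def cm_var_def)
  have "(\<lambda>y. inv_fourier f y * cnj (inv_fourier g y)) \<in> borel_measurable borel"
    by (intro borel_measurable_continuous_onI continuous_intros inv_fourier_continuous assms)
  then show "(\<lambda>y. inv_fourier f y * cnj (inv_fourier g y)) \<in> borel_measurable (fst \<nu>)"
    using s by (simp cong: measurable_cong_sets)
  have "a * b \<le> a\<^sup>2 + b\<^sup>2" for a b :: real
    using sum_squares_bound[of a b] zero_le_power2[of a] zero_le_power2[of b] by linarith
  then show "AE y in fst \<nu>. norm (inv_fourier f y * cnj (inv_fourier g y)) \<le> norm ((norm (inv_fourier f y))\<^sup>2 + (norm (inv_fourier g y))\<^sup>2)"
    by (intro AE_I2) (simp add: norm_mult)
qed

text \<open>The definition gives only the diagonal f = g. Both sides are sesquilinear, so inserting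
  f + c g and cancelling the diagonal terms leaves the mixed ones; c = 1 yields their sum and c =
  \<i> their difference.\<close>

lemma fourier_transform_polarized:
  fixes f g :: "'a::euclidean_space \<Rightarrow> complex"
  assumes \<mu>: "radon_cmeasure \<mu>" and ft: "is_fourier_transform \<mu> \<nu>" and f: "f \<in> Cc" and g: "g \<in> Cc"
  shows "cm_integral \<mu> (fconv f (refl_conj g)) = cm_integral \<nu> (\<lambda>y. inv_fourier f y * cnj (inv_fourier g y))"
proof -
  define A where "A f g = cm_integral \<mu> (fconv f (refl_conj g))" for f g :: "'a \<Rightarrow> complex"
  define B where "B f g = cm_integral \<nu> (\<lambda>y. inv_fourier f y * cnj (inv_fourier g y))" for f g :: "'a \<Rightarrow> complex"
  have \<nu>: "radon_cmeasure \<nu>" using ft by (simp add: is_fourier_transform_def)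
  have diag: "A f f = B f f" if "f \<in> Cc" for f
    using ft that by (simp add: A_def B_def is_fourier_transform_def complex_norm_square[symmetric])
  have exA: "A (\<lambda>x. f x + c * g x) (\<lambda>x. f x + c * g x) = A f f + cnj c * A f g + c * A g f + (c * cnj c) * A g g" for c
  proof -
    have Cc: "fconv u (refl_conj v) \<in> Cc" if "u \<in> Cc" "v \<in> Cc" for u v :: "'a \<Rightarrow> complex"
      by (intro fconv_Cc that Cc_refl_conj)
    have i: "integrable lborel (\<lambda>y. u y * refl_conj v (x - y))" if "u \<in> Cc" "v \<in> Cc" for u v x
      by (intro fconv_integrable that Cc_continuous Cc_refl_conj)
    have "fconv (\<lambda>x. f x + c * g x) (refl_conj (\<lambda>x. f x + c * g x)) =
      (\<lambda>x. (fconv f (refl_conj f) x + cnj c * fconv f (refl_conj g) x) + (c * fconv g (refl_conj f) x + (c * cnj c) * fconv g (refl_conj g) x))"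
    proof
      fix x
      have "fconv (\<lambda>x. f x + c * g x) (refl_conj (\<lambda>x. f x + c * g x)) x =
        (LINT y|lborel. (f y * refl_conj f (x - y) + cnj c * (f y * refl_conj g (x - y))) + (c * (g y * refl_conj f (x - y)) + (c * cnj c) * (g y * refl_conj g (x - y))))"
        unfolding fconv_def refl_conj_def by (simp add: algebra_simps)
      also have "\<dots> = (fconv f (refl_conj f) x + cnj c * fconv f (refl_conj g) x) + (c * fconv g (refl_conj f) x + (c * cnj c) * fconv g (refl_conj g) x)"
        unfolding fconv_def using i[OF f f, of x] i[OF f g, of x] i[OF g f, of x] i[OF g g, of x] by simp
      finally show "fconv (\<lambda>x. f x + c * g x) (refl_conj (\<lambda>x. f x + c * g x)) x = \<dots>" .
    qed
    then show ?thesis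
      unfolding A_def
      by (simp add: cm_integral_add[OF \<mu>] cm_integral_cmult Cc_integrable[OF radon_loc_finite[OF \<mu>]] Cc f g Cc_add Cc_cmult add.assoc)
  qed
  have exB: "B (\<lambda>x. f x + c * g x) (\<lambda>x. f x + c * g x) = B f f + cnj c * B f g + c * B g f + (c * cnj c) * B g g" for c
  proof -
    have i: "integrable (fst \<nu>) (\<lambda>y. inv_fourier u y * cnj (inv_fourier v y))" if "u \<in> Cc" "v \<in> Cc" for u v
      by (rule is_fourier_transform_integrable[OF ft that])
    have F: "inv_fourier (\<lambda>x. f x + c * g x) y = inv_fourier f y + c * inv_fourier g y" for y
      by (simp add: inv_fourier_add[OF f Cc_cmult[OF g]] inv_fourier_cmult)
    have "(\<lambda>y. inv_fourier (\<lambda>x. f x + c * g x) y * cnj (inv_fourier (\<lambda>x. f x + c * g x) y)) =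
      (\<lambda>y. (inv_fourier f y * cnj (inv_fourier f y) + cnj c * (inv_fourier f y * cnj (inv_fourier g y)))
         + (c * (inv_fourier g y * cnj (inv_fourier f y)) + (c * cnj c) * (inv_fourier g y * cnj (inv_fourier g y))))"
      unfolding F by (simp add: algebra_simps)
    then show ?thesis
      unfolding B_def using i[OF f f] i[OF f g] i[OF g f] i[OF g g]
      by (simp add: cm_integral_add[OF \<nu>] cm_integral_cmult add.assoc)
  qed
  have "cnj c * A f g + c * A g f = cnj c * B f g + c * B g f" for c
    using exA[of c] exB[of c] diag[OF f] diag[OF g] diag[OF Cc_add[OF f Cc_cmult[OF g]], of c] by simp
  note * = this
  have 1: "A f g + A g f = B f g + B g f" using *[of 1] by simp
  have "\<i> * (A g f - A f g) = \<i> * (B g f - B f g)" using *[of \<i>] by (simp add: algebra_simps)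
  then have "A g f - A f g = B g f - B f g" by simp
  with 1 have "2 * A f g = 2 * B f g" by algebra
  then show ?thesis by (simp add: A_def B_def)
qed

text \<open>The spare power k serves several ends: k = 0 gives integrability against translation
  bounded measures, k = 1 makes tails uniformly small, and larger k gives the moments of the
  approximation kernel.\<close>

lemma inv_fourier_wt_bound:
  fixes f :: "'a::euclidean_space \<Rightarrow> complex"
  assumes "f \<in> Cc_inf"
  obtains B where "B \<ge> 0" "\<And>y. (1 + norm y) ^ k * norm (inv_fourier f y) \<le> B * wt y"
proof -
  obtain C N where C: "\<And>y. (1 + norm y) ^ (k + (DIM('a) + 2)) * norm (inv_fourier f y) \<le> C * schwartz_seminorm N f"
    using inv_fourier_decay[of "k + (DIM('a) + 2)", where 'a='a] assms by metis
  define B where "B = \<bar>C * schwartz_seminorm N f\<bar>"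
  show thesis
  proof (rule that[of B])
    fix y :: 'a
    have "0 < (1 + norm y) ^ (DIM('a) + 2)" by (intro zero_less_power add_pos_nonneg) auto
    moreover have "(1 + norm y) ^ k * norm (inv_fourier f y) * (1 + norm y) ^ (DIM('a) + 2) \<le> B"
      using C[of y] unfolding B_def power_add[of _ k] by (simp only: mult_ac)
    ultimately show "(1 + norm y) ^ k * norm (inv_fourier f y) \<le> B * wt y"
      unfolding wt_def by (simp only: le_divide_eq times_divide_eq_right mult_1_right if_True)
  qed (simp add: B_def)
qed

lemma tbound_inv_fourier_integrable:
  fixes f :: "'a::euclidean_space \<Rightarrow> complex"
  assumes M: "tbound M C" and f: "f \<in> Cc_inf"
  shows "integrable M (inv_fourier f)"
proof -
  obtain B where B: "\<And>y. norm (inv_fourier f y) \<le> B * wt y"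
    using inv_fourier_wt_bound[OF f, of 0] by auto
  have "integrable M wt" using tbound_wt_integral[where 'a='a] M by (metis (no_types, lifting) Bochner_Integration.integrable_cong diff_zero)
  then show ?thesis
  proof (rule Bochner_Integration.integrable_bound[OF integrable_mult_right[of B]])
    have "inv_fourier f \<in> borel_measurable borel"
      by (intro borel_measurable_continuous_onI inv_fourier_continuous Cc_inf_Cc f)
    then show "inv_fourier f \<in> borel_measurable M" using M by (simp add: tbound_def cong: measurable_cong_sets)
    show "AE y in M. norm (inv_fourier f y) \<le> norm (B * wt y)"
      using B by (intro AE_I2) (metis abs_ge_self order_trans real_norm_def)
  qed
qed

text \<open>The polarised identity applies to f * \<open>mol n\<close>. In the limit the left side
  converges by mollification and the right side by domination with the modulus of
  \<open>inv_fourier f\<close>, integrable because \<nu> is translation bounded.\<close>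

lemma fourier_transform_Cc_inf:
  fixes f :: "'a::euclidean_space \<Rightarrow> complex"
  assumes \<mu>: "radon_cmeasure \<mu>" and ft: "is_fourier_transform \<mu> \<nu>" and tb: "tbound (fst \<nu>) C" and f: "f \<in> Cc_inf"
  shows "cm_integral \<mu> f = cm_integral \<nu> (inv_fourier f)"
proof -
  have \<nu>: "radon_cmeasure \<nu>" using ft by (simp add: is_fourier_transform_def)
  have "(\<lambda>n. cm_integral \<nu> (\<lambda>y. inv_fourier f y * cnj (inv_fourier (mol n) y))) \<longlonglongrightarrow> cm_integral \<nu> (inv_fourier f)"
  proof (rule cm_integral_dominated_convergence[OF \<nu>, where w="\<lambda>y. norm (inv_fourier f y)"])
    show "(\<lambda>n. inv_fourier f y * cnj (inv_fourier (mol n) y)) \<longlonglongrightarrow> inv_fourier f y" for y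
      using tendsto_mult[OF tendsto_const tendsto_cnj[OF inv_fourier_mol_tendsto[of y]], of "inv_fourier f y"] by simp
    show "norm (inv_fourier f y * cnj (inv_fourier (mol n) y)) \<le> norm (inv_fourier f y)" for n y
      using mult_left_mono[OF norm_inv_fourier_mol[of n y], of "norm (inv_fourier f y)"] by (simp add: norm_mult)
  qed (auto intro!: borel_measurable_continuous_onI continuous_intros inv_fourier_continuous Cc_inf_Cc[OF f] mol_Cc
      integrable_norm tbound_inv_fourier_integrable[OF tb f])
  then have "(\<lambda>n. cm_integral \<mu> (fconv f (mol n))) \<longlonglongrightarrow> cm_integral \<nu> (inv_fourier f)"
    using fourier_transform_polarized[OF \<mu> ft Cc_inf_Cc[OF f] mol_Cc] by (simp add: refl_conj_mol)
  with cm_integral_mol[OF \<mu> Cc_inf_Cc[OF f]] show ?thesis using LIMSEQ_unique by blast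
qed

text \<open>This gives \<open>tempered_action\<close> a meaning for the approximating measures. The
  decay estimate, uniform in the test function, is integrated against \<nu>.\<close>

lemma fourier_transform_tempered:
  fixes \<mu> \<nu> :: "'a::euclidean_space cmeasure"
  assumes \<mu>: "radon_cmeasure \<mu>" and ft: "is_fourier_transform \<mu> \<nu>" and tb: "tbound (fst \<nu>) C"
  shows "tempered \<mu>"
proof -
  have \<nu>: "radon_cmeasure \<nu>" using ft by (simp add: is_fourier_transform_def)
  obtain C' N where C': "C' \<ge> 0"
    "\<And>(f :: 'a \<Rightarrow> complex) y. f \<in> Cc_inf \<Longrightarrow> (1 + norm y) ^ (DIM('a) + 2) * norm (inv_fourier f y) \<le> C' * schwartz_seminorm N f"
    using inv_fourier_decay[of "DIM('a) + 2", where 'a='a] by metis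
  have wt: "integrable (fst \<nu>) (wt :: 'a \<Rightarrow> real)"
    using tbound_wt_integral[where 'a='a] tb by (metis (no_types, lifting) Bochner_Integration.integrable_cong diff_zero)
  show ?thesis
    unfolding tempered_def
  proof (intro exI[of _ "C' * (LINT y|fst \<nu>. wt y)"] exI[of _ N] ballI)
    fix f :: "'a \<Rightarrow> complex" assume f: "f \<in> Cc_inf"
    have "norm (cm_integral \<mu> f) \<le> (LINT y|fst \<nu>. norm (inv_fourier f y))"
      unfolding fourier_transform_Cc_inf[OF \<mu> ft tb f]
      by (rule cm_integral_norm_le[OF \<nu> tbound_inv_fourier_integrable[OF tb f]])
    also have "\<dots> \<le> (LINT y|fst \<nu>. C' * schwartz_seminorm N f * wt y)"
    proof (rule integral_mono)
      fix y :: 'a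
      have "0 < (1 + norm y) ^ (DIM('a) + 2)" by (intro zero_less_power add_pos_nonneg) auto
      then show "norm (inv_fourier f y) \<le> C' * schwartz_seminorm N f * wt y"
        using C'(2)[OF f, of y] unfolding wt_def
        by (simp only: le_divide_eq times_divide_eq_right mult_1_right mult.commute if_True)
    qed (intro integrable_norm tbound_inv_fourier_integrable[OF tb f] integrable_mult_right wt)+
    finally show "norm (cm_integral \<mu> f) \<le> C' * (LINT y|fst \<nu>. wt y) * schwartz_seminorm N f"
      by (simp add: mult_ac)
  qed
qed

section \<open>The tempered action on test functions\<close>

lemma dderivs_zero: "dderivs vs (\<lambda>x. 0) = (\<lambda>x. 0)"
  by (induction vs) (auto simp: frechet_derivative_const)

lemma schwartz_seminorm_zero: "schwartz_seminorm N (\<lambda>x. 0) = 0"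
proof -
  have "{(x::'a, vs::'a list). length vs \<le> N \<and> (\<forall>v\<in>set vs. norm v \<le> 1)} \<noteq> {}"
    by (auto intro!: exI[of _ "[]"])
  then show ?thesis by (simp add: schwartz_seminorm_def dderivs_zero)
qed

text \<open>\<open>tempered_action\<close> is a definite description over approximating sequences.
  The seminorm estimate shows that the integral qualifies as its value, and the constant sequence f
  shows that nothing else does.\<close>

lemma tempered_action_Cc_inf:
  fixes f :: "'a::euclidean_space \<Rightarrow> complex"
  assumes \<mu>: "radon_cmeasure \<mu>" and t: "tempered \<mu>" and f: "f \<in> Cc_inf"
  shows "tempered_action \<mu> f = cm_integral \<mu> f"
  unfolding tempered_action_def
proof (rule the_equality)
  obtain C N where C: "\<And>g. g \<in> Cc_inf \<Longrightarrow> norm (cm_integral \<mu> g) \<le> C * schwartz_seminorm N g"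
    using t unfolding tempered_def by blast
  show "\<forall>g. (\<forall>k. g k \<in> Cc_inf) \<and> (\<forall>N. (\<lambda>k. schwartz_seminorm N (\<lambda>x. g k x - f x)) \<longlonglongrightarrow> 0)
      \<longrightarrow> (\<lambda>k. cm_integral \<mu> (g k)) \<longlonglongrightarrow> cm_integral \<mu> f"
  proof (intro allI impI, elim conjE)
    fix g :: "nat \<Rightarrow> 'a \<Rightarrow> complex"
    assume g: "\<forall>k. g k \<in> Cc_inf" "\<forall>N. (\<lambda>k. schwartz_seminorm N (\<lambda>x. g k x - f x)) \<longlonglongrightarrow> 0"
    have "norm (cm_integral \<mu> (g k) - cm_integral \<mu> f) \<le> C * schwartz_seminorm N (\<lambda>x. g k x - f x)" for k
      using C[OF Cc_inf_diff[OF g(1)[rule_format] f], of k]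
      by (simp add: cm_integral_diff[OF \<mu>] Cc_integrable[OF radon_loc_finite[OF \<mu>]] Cc_inf_Cc f g(1))
    moreover have "(\<lambda>k. C * schwartz_seminorm N (\<lambda>x. g k x - f x)) \<longlonglongrightarrow> 0"
      using tendsto_mult_left[OF g(2)[rule_format], of C N] by simp
    ultimately have "(\<lambda>k. cm_integral \<mu> (g k) - cm_integral \<mu> f) \<longlonglongrightarrow> 0"
      by (intro Lim_null_comparison[of "\<lambda>k. cm_integral \<mu> (g k) - cm_integral \<mu> f"]) auto
    then show "(\<lambda>k. cm_integral \<mu> (g k)) \<longlonglongrightarrow> cm_integral \<mu> f" by (simp add: LIM_zero_iff)
  qed
  fix L assume "\<forall>g. (\<forall>k. g k \<in> Cc_inf) \<and> (\<forall>N. (\<lambda>k. schwartz_seminorm N (\<lambda>x. g k x - f x)) \<longlonglongrightarrow> 0)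
      \<longrightarrow> (\<lambda>k. cm_integral \<mu> (g k)) \<longlonglongrightarrow> L"
  from this[rule_format, of "\<lambda>_. f"] f show "L = cm_integral \<mu> f"
    by (simp add: schwartz_seminorm_zero LIMSEQ_const_iff)
qed

lemma equi_translation_bounded_tbound:
  fixes \<nu>s :: "nat \<Rightarrow> 'a::euclidean_space cmeasure"
  assumes "equi_translation_bounded (range \<nu>s)" "\<And>n. radon_cmeasure (\<nu>s n)"
  obtains C where "\<And>n. tbound (fst (\<nu>s n)) C"
proof -
  obtain C :: real where C: "\<And>n t. emeasure (fst (\<nu>s n)) ((+) t ` cball 0 1) \<le> ennreal C"
    using assms(1) unfolding equi_translation_bounded_def cm_var_def by (metis compact_cball rangeI)
  have "(+) t ` cball 0 1 = cball t 1" for t :: 'a by (simp add: cball_translation)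
  with C have "emeasure (fst (\<nu>s n)) (cball t 1) \<le> ennreal (max 0 C)" for n t
    by (metis ennreal_leI max.cobounded2 order_trans)
  then show thesis
    using assms(2) by (intro that[of "max 0 C"]) (auto simp: tbound_def radon_cmeasure_def)
qed

section \<open>Riesz representation of positive functionals\<close>

text \<open>The positive cone is kept real valued so that order and the lattice operations are
  available; \<open>of_real\<close> leads back to \<open>Cc\<close>.\<close>

definition Cpos :: "('a::euclidean_space \<Rightarrow> real) set" where
  "Cpos = {f. (\<lambda>x. complex_of_real (f x)) \<in> Cc \<and> (\<forall>x. 0 \<le> f x)}"

lemma CposI:
  assumes "continuous_on UNIV f" "\<And>x. 0 \<le> f x" "\<And>x. norm x > R \<Longrightarrow> f x = 0"
  shows "f \<in> Cpos"
  using assms by (auto simp: Cpos_def intro!: CcI[of _ R] continuous_intros)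

lemma CposD:
  assumes "f \<in> Cpos"
  shows "continuous_on S f" "0 \<le> f x" "(\<lambda>x. complex_of_real (f x)) \<in> Cc"
proof -
  show c: "(\<lambda>x. complex_of_real (f x)) \<in> Cc" "0 \<le> f x" using assms by (simp_all add: Cpos_def)
  have "continuous_on S (\<lambda>x. Re (complex_of_real (f x)))"
    by (rule continuous_on_Re[OF Cc_continuous[OF c(1)]])
  then show "continuous_on S f" by (simp only: Re_complex_of_real)
qed

lemma CposE:
  assumes "f \<in> Cpos"
  obtains R where "R > 0" "\<And>x. norm x > R \<Longrightarrow> f x = 0"
proof (rule CcE[OF CposD(3)[OF assms]])
  fix R assume "R > 0" and R: "\<And>x. norm x > R \<Longrightarrow> complex_of_real (f x) = 0"
  have "f x = 0" if "norm x > R" for x using R[OF that] by simp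
  with \<open>R > 0\<close> show thesis by (rule that)
qed

lemma Cpos_le:
  assumes "f \<in> Cpos" "continuous_on UNIV g" "\<And>x. 0 \<le> g x" "\<And>x. g x \<le> f x"
  shows "g \<in> Cpos"
proof -
  obtain R where R: "\<And>x. norm x > R \<Longrightarrow> f x = 0" using CposE[OF assms(1)] by blast
  show ?thesis
  proof (rule CposI[of _ R])
    show "g x = 0" if "norm x > R" for x using assms(3)[of x] assms(4)[of x] R[OF that] by simp
  qed (rule assms)+
qed

lemma Cpos_zero [simp]: "(\<lambda>x. 0) \<in> Cpos"
  by (rule CposI[of _ 0]) auto

lemma Cpos_add: "f \<in> Cpos \<Longrightarrow> g \<in> Cpos \<Longrightarrow> (\<lambda>x. f x + g x) \<in> Cpos"
  by (auto simp: Cpos_def intro: Cc_add)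

lemma Cpos_max:
  assumes "f \<in> Cpos" "g \<in> Cpos"
  shows "(\<lambda>x. max (f x) (g x)) \<in> Cpos"
  by (rule Cpos_le[OF Cpos_add[OF assms]])
     (simp_all add: continuous_on_max CposD(1)[OF assms(1)] CposD(1)[OF assms(2)] CposD(2)[OF assms(1)]
        CposD(2)[OF assms(2)] le_max_iff_disj)

lemma Cpos_min:
  assumes "f \<in> Cpos" "g \<in> Cpos"
  shows "(\<lambda>x. min (f x) (g x)) \<in> Cpos"
  by (rule Cpos_le[OF assms(1)])
     (simp_all add: continuous_on_min CposD(1)[OF assms(1)] CposD(1)[OF assms(2)] CposD(2)[OF assms(1)]
        CposD(2)[OF assms(2)])

lemma Cpos_diff:
  assumes "f \<in> Cpos" "g \<in> Cpos" "\<And>x. g x \<le> f x"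
  shows "(\<lambda>x. f x - g x) \<in> Cpos"
  by (rule Cpos_le[OF assms(1)])
     (simp_all add: continuous_on_diff CposD(1)[OF assms(1)] CposD(1)[OF assms(2)] CposD(2)[OF assms(2)] assms(3))

lemma Cpos_cmult: "f \<in> Cpos \<Longrightarrow> 0 \<le> c \<Longrightarrow> (\<lambda>x. c * f x) \<in> Cpos"
  using Cc_cmult[of "\<lambda>x. of_real (f x)" "of_real c"] by (auto simp: Cpos_def)

lemma Cpos_sum: "finite I \<Longrightarrow> (\<And>i. i \<in> I \<Longrightarrow> f i \<in> Cpos) \<Longrightarrow> (\<lambda>x. \<Sum>i\<in>I. f i x) \<in> Cpos"
  by (induction I rule: finite_induct) (auto intro: Cpos_add)

lemma Cpos_integrable: "loc_finite M \<Longrightarrow> f \<in> Cpos \<Longrightarrow> integrable M f"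
  using integrable_Re[OF Cc_integrable[OF _ CposD(3)], of M f] by simp

definition plateau :: "real \<Rightarrow> 'a::euclidean_space \<Rightarrow> real" where
  "plateau R x = max 0 (min 1 (R + 1 - norm x))"

lemma plateau_Cpos: "plateau R \<in> Cpos"
  by (rule CposI[of _ "R + 1"]) (auto simp: plateau_def[abs_def] intro!: continuous_intros)

lemma plateau_1: "norm x \<le> R \<Longrightarrow> plateau R x = 1"
  by (simp add: plateau_def)

section \<open>Positive functionals and their representing measures\<close>

locale positive_functional =
  fixes L :: "('a::euclidean_space \<Rightarrow> real) \<Rightarrow> real"
  assumes nonneg: "f \<in> Cpos \<Longrightarrow> 0 \<le> L f"
    and add: "f \<in> Cpos \<Longrightarrow> g \<in> Cpos \<Longrightarrow> L (\<lambda>x. f x + g x) = L f + L g"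
begin

lemma diff: "f \<in> Cpos \<Longrightarrow> g \<in> Cpos \<Longrightarrow> (\<And>x. g x \<le> f x) \<Longrightarrow> L (\<lambda>x. f x - g x) = L f - L g"
  using add[OF Cpos_diff, of f g g] by simp

lemma mono: "f \<in> Cpos \<Longrightarrow> g \<in> Cpos \<Longrightarrow> (\<And>x. g x \<le> f x) \<Longrightarrow> L g \<le> L f"
  using diff[of f g] nonneg[OF Cpos_diff, of f g] by simp

lemma zero: "L (\<lambda>x. 0) = 0"
  using add[of "\<lambda>x. 0" "\<lambda>x. 0"] by simp

lemma sum: "finite I \<Longrightarrow> (\<And>i. i \<in> I \<Longrightarrow> f i \<in> Cpos) \<Longrightarrow> L (\<lambda>x. \<Sum>i\<in>I. f i x) = (\<Sum>i\<in>I. L (f i))"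
  by (induction I rule: finite_induct) (auto simp: zero add Cpos_sum)

text \<open>The locale asks for additivity on the cone. Adding n + 1 equal summands recovers scaling
  by positive integers and their reciprocals, which suffices for the representation.\<close>

lemma divide_nat:
  assumes "f \<in> Cpos"
  shows "L (\<lambda>x. f x / real (Suc n)) = L f / real (Suc n)"
proof -
  have g: "(\<lambda>x. f x / real (Suc n)) \<in> Cpos"
    using Cpos_cmult[OF assms, of "inverse (real (Suc n))"] by (simp add: divide_inverse mult.commute)
  have "L (\<lambda>x. \<Sum>i<Suc n. f x / real (Suc n)) = (\<Sum>i<Suc n. L (\<lambda>x. f x / real (Suc n)))"
    using g by (intro sum) auto
  moreover have "(\<lambda>x. \<Sum>i<Suc n. f x / real (Suc n)) = f"
    by (simp del: sum.lessThan_Suc of_nat_Suc)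
  ultimately show ?thesis by (simp add: field_simps del: sum.lessThan_Suc)
qed

text \<open>Dini's theorem makes the functional countably additive.\<close>

lemma sums_Cpos:
  assumes u: "\<And>i. u i \<in> Cpos" and f: "f \<in> Cpos" and s: "\<And>x. (\<lambda>i. u i x) sums f x"
  shows "(\<lambda>i. L (u i)) sums L f"
proof -
  obtain R where R: "R > 0" "\<And>x. norm x > R \<Longrightarrow> f x = 0" using CposE[OF f] by blast
  have le: "(\<Sum>i<n. u i x) \<le> f x" for n x
    using sum_le_suminf[OF sums_summable[OF s], of "{..<n}" x] sums_unique[OF s, of x] CposD(2)[OF u]
    by auto
  have sn: "(\<lambda>x. \<Sum>i<n. u i x) \<in> Cpos" for n by (intro Cpos_sum u) auto
  have Lk: "L (plateau R) \<ge> 0" by (intro nonneg plateau_Cpos)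
  show ?thesis
    unfolding sums_def
  proof (rule LIMSEQ_I)
    fix e :: real assume e: "e > 0"
    \<comment> \<open>The plateau is 1 on the support ball, so an error below 1/(m+1) there costs at
      most L (plateau R) / (m+1), which this m pushes below e.\<close>
    define m where "m = nat \<lceil>L (plateau R) / e\<rceil>"
    have "L (plateau R) / e < real (Suc m)" unfolding m_def using Lk e by (simp add: le_nat_iff) linarith
    then have m: "L (plateau R) / real (Suc m) < e" using e by (simp add: field_simps)
    let ?U = "\<lambda>n. {x. f x - (\<Sum>i<n. u i x) < 1 / real (Suc m)}"
    have op: "open (?U n)" for n
      by (intro open_Collect_less continuous_intros CposD f sn)
    have cov: "cball 0 R \<subseteq> (\<Union>n. ?U n)"
    proof
      fix x
      have "(\<lambda>n. f x - (\<Sum>i<n. u i x)) \<longlonglongrightarrow> f x - f x"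
        using s[of x] unfolding sums_def by (intro tendsto_intros)
      then have "\<forall>\<^sub>F n in sequentially. f x - (\<Sum>i<n. u i x) < 1 / real (Suc m)"
        by (rule order_tendstoD) simp
      then obtain n where "f x - (\<Sum>i<n. u i x) < 1 / real (Suc m)"
        by (meson eventually_sequentially order_refl)
      then show "x \<in> (\<Union>n. ?U n)" by blast
    qed
    obtain T where T: "finite T" "cball 0 R \<subseteq> (\<Union>n\<in>T. ?U n)"
      by (rule compactE_image[OF compact_cball op cov])
    define N where "N = Max (insert 0 T)"
    show "\<exists>N. \<forall>n\<ge>N. norm ((\<Sum>i<n. L (u i)) - L f) < e"
    proof (intro exI[of _ N] allI impI)
      fix n assume n: "n \<ge> N"
      \<comment> \<open>On the ball the finite subcover applies, with monotonicity of the partial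
        sums to reach n. Off the ball f vanishes, and so do the partial sums, which lie between 0
        and f.\<close>
      have *: "f x - (\<Sum>i<n. u i x) \<le> plateau R x / real (Suc m)" for x
      proof (cases "norm x \<le> R")
        case True
        then obtain k where k: "k \<in> T" "f x - (\<Sum>i<k. u i x) < 1 / real (Suc m)" using T(2) by auto
        have "k \<le> n" using k(1) T(1) n by (auto simp: N_def)
        then have "(\<Sum>i<k. u i x) \<le> (\<Sum>i<n. u i x)"
          using CposD(2)[OF u] by (intro sum_mono2) auto
        with k(2) True show ?thesis by (simp add: plateau_1)
      next
        case False
        then have "(\<Sum>i<n. u i x) = 0" using R(2) le[of x n] CposD(2)[OF sn[of n], of x] by simp
        with False R(2) show ?thesis using CposD(2)[OF plateau_Cpos, of R x] by simp
      qed
      have p: "(\<lambda>x. plateau R x / real (Suc m)) \<in> Cpos"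
        using Cpos_cmult[OF plateau_Cpos, of "inverse (real (Suc m))" R] by (simp add: divide_inverse mult.commute)
      have "L f - (\<Sum>i<n. L (u i)) = L (\<lambda>x. f x - (\<Sum>i<n. u i x))"
        using diff[OF f sn le] sum[of "{..<n}" u] u by simp
      moreover have "\<dots> \<ge> 0" by (intro nonneg Cpos_diff f sn le)
      moreover have "L (\<lambda>x. f x - (\<Sum>i<n. u i x)) \<le> L (plateau R) / real (Suc m)"
        using mono[OF p Cpos_diff[OF f sn le] *] divide_nat[OF plateau_Cpos] by simp
      ultimately show "norm ((\<Sum>i<n. L (u i)) - L f) < e" using m by simp
    qed
  qed
qed

text \<open>Half-open slabs between graphs form a semiring on which \<open>L (g - f)\<close> is a premeasure; the
  representing measure of \<open>A\<close> is the extended measure of \<open>A \<times> {0..<1}\<close>.\<close>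

definition slab :: "('a \<Rightarrow> real) \<Rightarrow> ('a \<Rightarrow> real) \<Rightarrow> ('a \<times> real) set" where
  "slab f g = {p. f (fst p) \<le> snd p \<and> snd p < g (fst p)}"

definition slabs :: "('a \<times> real) set set" where
  "slabs = {slab f g |f g. f \<in> Cpos \<and> g \<in> Cpos \<and> (\<forall>x. f x \<le> g x)}"

text \<open>Given through the lengths of vertical slices, hence a function of the set alone:
  independence of the choice of the two graphs never has to be proved.\<close>

definition premeasure :: "('a \<times> real) set \<Rightarrow> ennreal" where
  "premeasure A = ennreal (L (\<lambda>x. measure lborel {t. (x, t) \<in> A}))"

lemma slab_slice: "{t. (x, t) \<in> slab f g} = {f x..<g x}"
  by (auto simp: slab_def)

lemma premeasure_slab: "(\<And>x. f x \<le> g x) \<Longrightarrow> premeasure (slab f g) = ennreal (L (\<lambda>x. g x - f x))"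
  by (simp add: premeasure_def slab_slice)

lemma semiring_slabs: "semiring_of_sets UNIV slabs"
proof
  show "{} \<in> slabs"
    unfolding slabs_def by (auto simp: slab_def intro!: exI[of _ "\<lambda>x. 0"])
  fix a b assume "a \<in> slabs" "b \<in> slabs"
  then obtain f1 g1 f2 g2 where a: "a = slab f1 g1" "f1 \<in> Cpos" "g1 \<in> Cpos" "\<And>x. f1 x \<le> g1 x"
    and b: "b = slab f2 g2" "f2 \<in> Cpos" "g2 \<in> Cpos" "\<And>x. f2 x \<le> g2 x"
    unfolding slabs_def by blast
  let ?f = "\<lambda>x. max (f1 x) (f2 x)"
  \<comment> \<open>The outer maximum with the lower graph keeps the graphs ordered at points where
    the two slices are disjoint; the slice of the resulting slab is empty there.\<close>
  let ?g = "\<lambda>x. max (min (g1 x) (g2 x)) (?f x)"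
  have "a \<inter> b = slab ?f ?g" unfolding a b slab_def by auto
  moreover have "?f \<in> Cpos" "?g \<in> Cpos" "\<forall>x. ?f x \<le> ?g x"
    using a b by (auto intro!: Cpos_max Cpos_min)
  ultimately show "a \<inter> b \<in> slabs" unfolding slabs_def by blast
  \<comment> \<open>The graphs \<open>f2\<close> and \<open>g2\<close>, each clamped to the interval
    from \<open>f1\<close> to \<open>g1\<close>: what remains of the first slab lies below the one
    and above the other.\<close>
  let ?h = "\<lambda>x. max (f1 x) (min (g1 x) (f2 x))" and ?k = "\<lambda>x. min (g1 x) (max (f1 x) (g2 x))"
  have "slab f1 ?h \<in> slabs" "slab ?k g1 \<in> slabs"
    unfolding slabs_def using a b by (auto intro!: exI Cpos_max Cpos_min)
  moreover have "a - b = slab f1 ?h \<union> slab ?k g1"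
  proof (rule set_eqI)
    show "p \<in> a - b \<longleftrightarrow> p \<in> slab f1 ?h \<union> slab ?k g1" for p
      using b(4)[of "fst p"] a(4)[of "fst p"] unfolding a b slab_def by (auto simp: min_le_iff_disj less_max_iff_disj)
  qed
  moreover have "slab f1 ?h \<inter> slab ?k g1 = {}"
  proof (rule set_eqI)
    show "p \<in> slab f1 ?h \<inter> slab ?k g1 \<longleftrightarrow> p \<in> {}" for p
      using b(4)[of "fst p"] a(4)[of "fst p"] unfolding slab_def by (auto simp: min_le_iff_disj less_max_iff_disj)
  qed
  ultimately show "\<exists>C\<subseteq>slabs. finite C \<and> disjoint C \<and> a - b = \<Union> C"
    by (intro exI[of _ "{slab f1 ?h, slab ?k g1}"]) (auto simp: disjoint_def)
qed auto

text \<open>Each vertical slice is a bounded half-open interval cut into countably many disjoint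
  ones, so the lengths form a pointwise convergent series in \<open>Cpos\<close> with sum in
  \<open>Cpos\<close>, and \<open>sums_Cpos\<close> carries it through L.\<close>

lemma premeasure_countably_additive: "countably_additive slabs premeasure"
  unfolding countably_additive_def
proof (intro allI impI)
  fix A :: "nat \<Rightarrow> ('a \<times> real) set"
  assume A: "range A \<subseteq> slabs" "disjoint_family A" "\<Union> (range A) \<in> slabs"
  from A(1) have "\<forall>i. \<exists>f g. A i = slab f g \<and> f \<in> Cpos \<and> g \<in> Cpos \<and> (\<forall>x. f x \<le> g x)"
    unfolding slabs_def by blast
  then obtain f g where fg: "\<And>i. A i = slab (f i) (g i)" "\<And>i. f i \<in> Cpos" "\<And>i. g i \<in> Cpos" "\<And>i x. f i x \<le> g i x"
    by metis
  from A(3) obtain f0 g0 where fg0: "\<Union> (range A) = slab f0 g0" "f0 \<in> Cpos" "g0 \<in> Cpos" "\<And>x. f0 x \<le> g0 x"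
    unfolding slabs_def by blast
  have "(\<lambda>i. g i x - f i x) sums (g0 x - f0 x)" for x
  proof -
    have "(\<lambda>i. measure lborel {t. (x, t) \<in> A i}) sums measure lborel (\<Union>i. {t. (x, t) \<in> A i})"
    proof (rule measure_UNION)
      show "range (\<lambda>i. {t. (x, t) \<in> A i}) \<subseteq> sets lborel" by (auto simp: fg(1) slab_slice)
      show "disjoint_family (\<lambda>i. {t. (x, t) \<in> A i})"
        using A(2) by (fastforce simp: disjoint_family_on_def)
      have eq: "(\<Union>i. {t. (x, t) \<in> A i}) = {f0 x..<g0 x}"
        using fg0(1) slab_slice[of x f0 g0] by auto
      show "emeasure lborel (\<Union>i. {t. (x, t) \<in> A i}) \<noteq> \<infinity>"
        unfolding eq using fg0(4)[of x] by simp
    qed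
    moreover have "(\<Union>i. {t. (x, t) \<in> A i}) = {f0 x..<g0 x}"
      using fg0(1) slab_slice[of x f0 g0] by auto
    ultimately show ?thesis using fg(4) fg0(4) by (simp add: fg(1) slab_slice)
  qed
  then have "(\<lambda>i. L (\<lambda>x. g i x - f i x)) sums L (\<lambda>x. g0 x - f0 x)"
    by (intro sums_Cpos Cpos_diff fg fg0)
  then have "(\<Sum>i. ennreal (L (\<lambda>x. g i x - f i x))) = ennreal (L (\<lambda>x. g0 x - f0 x))"
    by (intro suminf_ennreal_eq nonneg Cpos_diff fg)
  then show "(\<Sum>i. premeasure (A i)) = premeasure (\<Union> (range A))"
    unfolding fg0(1) by (simp add: fg(1) premeasure_slab fg(4) fg0(4))
qed

text \<open>That g lies below the indicator of A means that the slab under g is contained in A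
  \<times> {0..<1}, and the opposite comparison gives the opposite inclusion. Only these one-sided
  estimates are extracted; the integral formula is derived from them afterwards.\<close>

lemma representing_measure:
  obtains P where "sets P = sets borel"
    "\<And>A g. A \<in> sets borel \<Longrightarrow> g \<in> Cpos \<Longrightarrow> (\<And>x. g x \<le> indicator A x) \<Longrightarrow> ennreal (L g) \<le> emeasure P A"
    "\<And>A g. A \<in> sets borel \<Longrightarrow> g \<in> Cpos \<Longrightarrow> (\<And>x. indicator A x \<le> g x) \<Longrightarrow> emeasure P A \<le> ennreal (L g)"
proof -
  interpret semiring_of_sets UNIV slabs by (rule semiring_slabs)
  have "positive slabs premeasure" by (simp add: positive_def premeasure_def zero)
  from caratheodory[OF this premeasure_countably_additive]
  obtain m where m: "\<And>A. A \<in> slabs \<Longrightarrow> m A = premeasure A" "measure_space UNIV (sigma_sets UNIV slabs) m"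
    by blast
  define N where "N = measure_of UNIV slabs m"
  have sN: "sets N = sigma_sets UNIV slabs" "space N = UNIV" by (simp_all add: N_def)
  have eN: "emeasure N A = m A" if "A \<in> sets N" for A
    by (rule emeasure_measure_of[OF N_def]) (use m(2) that sN in \<open>auto simp: measure_space_def\<close>)
  have slab0: "slab (\<lambda>x. 0) g \<in> sets N" "emeasure N (slab (\<lambda>x. 0) g) = ennreal (L g)" if "g \<in> Cpos" for g
  proof -
    have s: "slab (\<lambda>x. 0) g \<in> slabs" using that CposD(2)[OF that] unfolding slabs_def by (auto intro!: exI)
    then show "slab (\<lambda>x. 0) g \<in> sets N" by (simp add: sN)
    then show "emeasure N (slab (\<lambda>x. 0) g) = ennreal (L g)"
      using eN m(1)[OF s] premeasure_slab[of "\<lambda>x. 0" g] CposD(2)[OF that] by simp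
  qed
  let ?J = "{0..<1::real}"
  have "UNIV \<times> ?J = (\<Union>n. slab (\<lambda>x. 0) (plateau (real n)))"
  proof (intro equalityI subsetI)
    fix p :: "'a \<times> real" assume p: "p \<in> UNIV \<times> ?J"
    obtain n :: nat where "norm (fst p) \<le> real n" using real_arch_simple by blast
    then show "p \<in> (\<Union>n. slab (\<lambda>x. 0) (plateau (real n)))"
      using p plateau_1[of "fst p" "real n"] by (auto simp: slab_def intro!: exI[of _ n])
  qed (auto simp: slab_def plateau_def)
  then have J: "UNIV \<times> ?J \<in> sets N" by (auto intro!: sets.countable_UN slab0 plateau_Cpos)
  \<comment> \<open>Open boxes generate the Borel sets. Truncated multiples of the distance to the
    complement vanish off the box and reach 1 eventually at each of its points, so the slabs under
    them exhaust the product set.\<close>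
  have box: "box a b \<times> ?J \<in> sets N" for a b :: 'a
  proof -
    let ?U = "box a b" and ?f = "\<lambda>n x. min 1 (real n * infdist x (- box a b))"
    obtain R where R: "\<And>x. x \<in> ?U \<Longrightarrow> norm x \<le> R"
      using bounded_box[of a b] by (auto simp: bounded_iff)
    have ne: "- ?U \<noteq> {}" using bounded_box[of a b] not_bounded_UNIV by (metis compl_bot_eq double_complement)
    have C: "?f n \<in> Cpos" for n
    proof (rule CposI[of _ R])
      show "?f n x = 0" if "norm x > R" for x
      proof -
        have "x \<in> - ?U" using R[of x] that by auto
        then show ?thesis by (simp add: infdist_zero)
      qed
    qed (auto intro!: continuous_intros simp: infdist_nonneg)
    have "?U \<times> ?J = (\<Union>n. slab (\<lambda>x. 0) (?f n))"
    proof (intro equalityI subsetI)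
      fix p :: "'a \<times> real" assume p: "p \<in> ?U \<times> ?J"
      then have "infdist (fst p) (- ?U) > 0"
        using ne by (intro infdist_pos_not_in_closed) (auto simp: open_closed[symmetric] open_box)
      then obtain n :: nat where "1 / infdist (fst p) (- ?U) \<le> real n" using real_arch_simple by blast
      then have "?f n (fst p) = 1"
        using \<open>infdist (fst p) (- ?U) > 0\<close> by (auto simp: field_simps min_def)
      then show "p \<in> (\<Union>n. slab (\<lambda>x. 0) (?f n))" using p by (auto simp: slab_def intro!: exI[of _ n])
    next
      fix p assume "p \<in> (\<Union>n. slab (\<lambda>x. 0) (?f n))"
      then obtain n where n: "0 \<le> snd p" "snd p < ?f n (fst p)" by (auto simp: slab_def)
      then have "fst p \<in> ?U" by (metis ComplI infdist_zero min.strict_boundedE mult_zero_right not_less)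
      with n show "p \<in> ?U \<times> ?J" by (cases p) auto
    qed
    then show ?thesis by (auto intro!: sets.countable_UN slab0 C)
  qed
  define P where "P = distr (restrict_space N (UNIV \<times> ?J)) borel fst"
  have "fst \<in> measurable (restrict_space N (UNIV \<times> ?J)) (borel :: 'a measure)"
  proof (rule measurable_sigma_sets)
    show "sets (borel :: 'a measure) = sigma_sets UNIV (range (\<lambda>(a, b). box a b))"
      by (subst borel_eq_box) simp
    fix y :: "'a set" assume "y \<in> range (\<lambda>(a, b). box a b)"
    then obtain a b where y: "y = box a b" by auto
    have "fst -` y \<inter> space (restrict_space N (UNIV \<times> ?J)) = y \<times> ?J"
      by (auto simp: space_restrict_space sN)
    then show "fst -` y \<inter> space (restrict_space N (UNIV \<times> ?J)) \<in> sets (restrict_space N (UNIV \<times> ?J))"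
      using box[of a b] J by (auto simp: sets_restrict_space_iff sN y)
  qed auto
  note mf = this
  have eP: "emeasure P A = emeasure N (A \<times> ?J)" "A \<times> ?J \<in> sets N" if A: "A \<in> sets borel" for A
  proof -
    have eq: "fst -` A \<inter> space (restrict_space N (UNIV \<times> ?J)) = A \<times> ?J"
      by (auto simp: space_restrict_space sN)
    then show "A \<times> ?J \<in> sets N"
      using measurable_sets[OF mf A] J by (auto simp: sets_restrict_space_iff sN)
    show "emeasure P A = emeasure N (A \<times> ?J)"
      unfolding P_def using emeasure_distr[OF mf A] eq J by (subst (asm) emeasure_restrict_space) (auto simp: sN)
  qed
  show thesis
  proof (rule that[of P])
    show "sets P = sets borel" by (simp add: P_def)
    fix A :: "'a set" and g :: "'a \<Rightarrow> real" assume A: "A \<in> sets borel" and g: "g \<in> Cpos"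
    show "ennreal (L g) \<le> emeasure P A" if le: "\<And>x. g x \<le> indicator A x"
    proof -
      have "slab (\<lambda>x. 0) g \<subseteq> A \<times> ?J"
      proof
        fix p assume "p \<in> slab (\<lambda>x. 0) g"
        then have "0 \<le> snd p" "snd p < g (fst p)" by (auto simp: slab_def)
        with le[of "fst p"] show "p \<in> A \<times> ?J"
          by (cases p; cases "fst p \<in> A") auto
      qed
      from emeasure_mono[OF this eP(2)[OF A]] show ?thesis using slab0(2)[OF g] eP(1)[OF A] by simp
    qed
    show "emeasure P A \<le> ennreal (L g)" if le: "\<And>x. indicator A x \<le> g x"
    proof -
      have "A \<times> ?J \<subseteq> slab (\<lambda>x. 0) g"
      proof
        fix p assume "p \<in> A \<times> ?J"
        with le[of "fst p"] show "p \<in> slab (\<lambda>x. 0) g" by (cases p) (auto simp: slab_def)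
      qed
      from emeasure_mono[OF this slab0(1)[OF g]] show ?thesis using slab0(2)[OF g] eP(1)[OF A] by simp
    qed
  qed
qed

end

lemma emeasure_plateau_finite:
  assumes "\<And>A g. A \<in> sets borel \<Longrightarrow> g \<in> Cpos \<Longrightarrow> (\<And>x. indicator A x \<le> g x) \<Longrightarrow> emeasure P A \<le> ennreal (L g)"
    and "compact (K :: 'a::euclidean_space set)"
  shows "emeasure P K < \<infinity>"
proof -
  obtain R where R: "\<And>x. x \<in> K \<Longrightarrow> norm x \<le> R"
    using compact_imp_bounded[OF assms(2)] by (auto simp: bounded_iff)
  have "emeasure P K \<le> ennreal (L (plateau R))"
    using assms(2) R CposD(2)[OF plateau_Cpos, of R]
    by (intro assms(1) plateau_Cpos) (auto simp: indicator_def plateau_1 borel_compact)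
  then show ?thesis by (rule le_less_trans) simp
qed

text \<open>Layer-cake decomposition into slices of unit height: the lower slices are full, at most
  one is partly filled, the remaining ones are empty.\<close>

lemma clamp_layers:
  fixes y :: real
  assumes "0 \<le> y" "y \<le> real J"
  shows "(\<Sum>j<J. max 0 (min 1 (y - real j))) = y"
  using assms
proof (induction J arbitrary: y)
  case (Suc J)
  show ?case
  proof (cases "y \<le> real J")
    case True
    then show ?thesis using Suc.IH[of y] Suc.prems by simp
  next
    case False
    have "max 0 (min 1 (y - real j)) = max 0 (min 1 (real J - real j))" if "j < J" for j
    proof -
      have "real j + 1 \<le> real J" using that by linarith
      then show ?thesis using False by simp
    qed
    then have "(\<Sum>j<J. max 0 (min 1 (y - real j))) = (\<Sum>j<J. max 0 (min 1 (real J - real j)))"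
      by (intro sum.cong) auto
    also have "\<dots> = real J" using Suc.IH[of "real J"] by simp
    finally show ?thesis using False Suc.prems by simp
  qed
qed simp

context positive_functional
begin

text \<open>A multiple N f is cut into unit layers. The layer \<open>g j\<close> lies between the
  indicators of the superlevel sets \<open>A (Suc j)\<close> and \<open>A j\<close>, so its value
  under L and its integral are both trapped between the measures of these sets.\<close>

lemma integral_eq:
  assumes s: "sets P = sets borel"
    and lo: "\<And>A g. A \<in> sets borel \<Longrightarrow> g \<in> Cpos \<Longrightarrow> (\<And>x. g x \<le> indicator A x) \<Longrightarrow> ennreal (L g) \<le> emeasure P A"
    and up: "\<And>A g. A \<in> sets borel \<Longrightarrow> g \<in> Cpos \<Longrightarrow> (\<And>x. indicator A x \<le> g x) \<Longrightarrow> emeasure P A \<le> ennreal (L g)"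
    and f: "f \<in> Cpos"
  shows "(LINT x|P. f x) = L f"
proof -
  have P: "loc_finite P" unfolding loc_finite_def using s emeasure_plateau_finite[of P L, OF up] by blast
  obtain R where R: "R > 0" "\<And>x. norm x > R \<Longrightarrow> f x = 0" using CposE[OF f] by blast
  obtain B where B: "\<And>x. f x \<le> B" using Cc_bounded[OF CposD(3)[OF f]] by (metis norm_of_real abs_le_D1)
  have fm: "f \<in> borel_measurable borel" by (intro borel_measurable_continuous_onI CposD f)
  define V where "V = measure P (cball 0 R)"
  have fin: "emeasure P A \<noteq> \<infinity>" "emeasure P A = ennreal (measure P A)" if "A \<subseteq> cball 0 R" "A \<in> sets borel" for A
  proof -
    have "emeasure P A \<le> emeasure P (cball 0 R)" using that s by (intro emeasure_mono) auto
    also have "\<dots> < \<infinity>" by (rule loc_finite_compact[OF P]) simp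
    finally show "emeasure P A \<noteq> \<infinity>" by simp
    then show "emeasure P A = ennreal (measure P A)" by (intro emeasure_eq_ennreal_measure) simp
  qed
  have est: "\<bar>L f - (LINT x|P. f x)\<bar> \<le> V / real (Suc n)" for n
  proof -
    define N where "N = real (Suc n)"
    have N: "N > 0" by (simp add: N_def)
    obtain J :: nat where J: "N * B \<le> real J" using real_arch_simple by blast
    define g where "g j x = max 0 (min 1 (N * f x - real j))" for j x
    define A where "A j = {x. N * f x > real j}" for j :: nat
    have Am: "A j \<in> sets borel" for j unfolding A_def using fm by measurable
    have Asub: "A j \<subseteq> cball 0 R" for j
    proof
      fix x assume "x \<in> A j"
      then have "f x \<noteq> 0" by (auto simp: A_def)
      then show "x \<in> cball 0 R" using R(2)[of x] by (auto simp: not_less[symmetric])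
    qed
    have g: "g j \<in> Cpos" for j
    proof (rule Cpos_le[OF Cpos_cmult[OF f, of N]])
      show "continuous_on UNIV (g j)" unfolding g_def[abs_def] by (intro continuous_intros CposD f)
      show "g j x \<le> N * f x" for x using CposD(2)[OF f, of x] N by (auto simp: g_def min_le_iff_disj)
    qed (use N in \<open>auto simp: g_def\<close>)
    have gA: "g j x \<le> indicator (A j) x" "indicator (A (Suc j)) x \<le> g j x" for j x
      by (auto simp: g_def A_def indicator_def)
    have "measure P (A (Suc j)) \<le> L (g j) \<and> L (g j) \<le> measure P (A j)" for j
      using lo[OF Am g gA(1), of j] up[OF Am g gA(2), of j] fin(2)[OF Asub Am] nonneg[OF g, of j] by simp
    moreover have "measure P (A (Suc j)) \<le> (LINT x|P. g j x) \<and> (LINT x|P. g j x) \<le> measure P (A j)" for j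
    proof -
      have i: "integrable P (\<lambda>x. indicator (A j) x :: real)" for j
        using fin(1)[OF Asub Am, of j] Am s by (intro integrable_real_indicator) (auto simp: less_top)
      have ig: "integrable P (g j)" by (rule Cpos_integrable[OF P g])
      have e: "(LINT x|P. indicator (A j) x) = measure P (A j)" for j using Am s by simp
      show ?thesis
        using integral_mono[OF i[of "Suc j"] ig gA(2)] integral_mono[OF ig i[of j] gA(1)] unfolding e by blast
    qed
    ultimately have d: "\<bar>L (g j) - (LINT x|P. g j x)\<bar> \<le> measure P (A j) - measure P (A (Suc j))" for j
      by (smt (verit))
    have Nf: "(\<lambda>x. \<Sum>j<J. g j x) = (\<lambda>x. N * f x)"
    proof
      fix x
      have "N * f x \<le> real J" using J B[of x] N by (meson mult_left_mono less_imp_le order_trans)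
      then show "(\<Sum>j<J. g j x) = N * f x"
        unfolding g_def using CposD(2)[OF f, of x] N by (intro clamp_layers) auto
    qed
    have "N * L f = L (\<lambda>x. N * f x)"
      using divide_nat[OF Cpos_cmult[OF f, of N], of n] N unfolding N_def[symmetric] by (simp add: field_simps)
    also have "\<dots> = (\<Sum>j<J. L (g j))" unfolding Nf[symmetric] using g by (intro sum) auto
    finally have 1: "N * L f = (\<Sum>j<J. L (g j))" .
    have "N * (LINT x|P. f x) = (LINT x|P. (\<Sum>j<J. g j x))" unfolding Nf by simp
    also have "\<dots> = (\<Sum>j<J. LINT x|P. g j x)" by (intro Bochner_Integration.integral_sum Cpos_integrable P g)
    finally have "N * (L f - (LINT x|P. f x)) = (\<Sum>j<J. L (g j) - (LINT x|P. g j x))"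
      using 1 by (simp add: right_diff_distrib sum_subtractf)
    \<comment> \<open>The layer errors telescope, so their sum is at most the mass V of the support
      ball however fine the layers are. Dividing by N makes the error for f itself arbitrarily
      small.\<close>
    then have "\<bar>N * (L f - (LINT x|P. f x))\<bar> \<le> (\<Sum>j<J. measure P (A j) - measure P (A (Suc j)))"
      using d by (simp only:) (intro order_trans[OF sum_abs] sum_mono)
    also have "\<dots> = measure P (A 0) - measure P (A J)" by (rule sum_lessThan_telescope')
    also have "\<dots> \<le> measure P (A 0)" by simp
    also have "\<dots> \<le> V"
    proof -
      have "ennreal (measure P (A 0)) \<le> ennreal V"
        using emeasure_mono[OF Asub[of 0], of P] s fin(2)[OF Asub[of 0] Am] fin(2)[of "cball 0 R"] by (simp add: V_def)
      then show ?thesis by (simp add: V_def)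
    qed
    finally have "\<bar>L f - (LINT x|P. f x)\<bar> * N \<le> V" using N unfolding abs_mult by (simp add: mult.commute)
    then show ?thesis using N unfolding N_def[symmetric] by (simp add: pos_le_divide_eq)
  qed
  have "(\<lambda>n. V / real (Suc n)) \<longlonglongrightarrow> 0" by (rule LIMSEQ_Suc[OF lim_const_over_n])
  then have "\<bar>L f - (LINT x|P. f x)\<bar> \<le> 0"
    using est by (intro LIMSEQ_le_const) auto
  then show ?thesis by simp
qed

text \<open>The upper estimate for sets is kept as a third conclusion because it later turns bounds
  on the functional into bounds on the mass of balls.\<close>

lemma riesz:
  obtains P where "loc_finite P"
    "\<And>f. f \<in> Cpos \<Longrightarrow> (LINT x|P. f x) = L f"
    "\<And>A g. A \<in> sets borel \<Longrightarrow> g \<in> Cpos \<Longrightarrow> (\<And>x. indicator A x \<le> g x) \<Longrightarrow> emeasure P A \<le> ennreal (L g)"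
proof (rule representing_measure)
  fix P :: "'a measure"
  assume P: "sets P = sets borel"
    "\<And>A g. A \<in> sets borel \<Longrightarrow> g \<in> Cpos \<Longrightarrow> (\<And>x. g x \<le> indicator A x) \<Longrightarrow> ennreal (L g) \<le> emeasure P A"
    "\<And>A g. A \<in> sets borel \<Longrightarrow> g \<in> Cpos \<Longrightarrow> (\<And>x. indicator A x \<le> g x) \<Longrightarrow> emeasure P A \<le> ennreal (L g)"
  have "loc_finite P" unfolding loc_finite_def using P(1) emeasure_plateau_finite[of P L, OF P(3)] by blast
  then show thesis using integral_eq[OF P] P(3) by (rule that)
qed

end

text \<open>Continuity appears as boundedness on order intervals: one constant for all g dominated
  by a given u. This is what makes the supremum defining the positive part finite.\<close>

locale complex_functional =
  fixes \<Phi> :: "('a::euclidean_space \<Rightarrow> complex) \<Rightarrow> complex"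
  assumes \<Phi>_add: "f \<in> Cc \<Longrightarrow> g \<in> Cc \<Longrightarrow> \<Phi> (\<lambda>x. f x + g x) = \<Phi> f + \<Phi> g"
    and \<Phi>_cmult: "f \<in> Cc \<Longrightarrow> \<Phi> (\<lambda>x. c * f x) = c * \<Phi> f"
    and \<Phi>_bounded: "u \<in> Cpos \<Longrightarrow> \<exists>C. \<forall>g\<in>Cc. (\<forall>x. norm (g x) \<le> u x) \<longrightarrow> norm (\<Phi> g) \<le> C"
begin

definition re :: "('a \<Rightarrow> real) \<Rightarrow> real" where
  "re u = Re (\<Phi> (\<lambda>x. of_real (u x)))"

text \<open>The positive part in the Jordan decomposition of the real functional \<open>re\<close>,
  as a supremum over the order interval from 0 to f.\<close>

definition re_pos :: "('a \<Rightarrow> real) \<Rightarrow> real" where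
  "re_pos f = (SUP g\<in>{g \<in> Cpos. \<forall>x. g x \<le> f x}. re g)"

lemma re_add: "f \<in> Cpos \<Longrightarrow> g \<in> Cpos \<Longrightarrow> re (\<lambda>x. f x + g x) = re f + re g"
  using \<Phi>_add[OF CposD(3) CposD(3), of f g] by (simp add: re_def)

lemma re_zero: "re (\<lambda>x. 0) = 0"
  using re_add[of "\<lambda>x. 0" "\<lambda>x. 0"] by simp

lemma re_bound:
  assumes "\<And>g. g \<in> Cc \<Longrightarrow> (\<And>x. norm (g x) \<le> f x) \<Longrightarrow> norm (\<Phi> g) \<le> C" "g \<in> Cpos" "\<And>x. g x \<le> f x"
  shows "\<bar>re g\<bar> \<le> C"
proof -
  have "norm (\<Phi> (\<lambda>x. of_real (g x))) \<le> C"
    using assms(3) CposD(2)[OF assms(2)] by (intro assms(1) CposD(3)[OF assms(2)]) simp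
  then show ?thesis unfolding re_def using abs_Re_le_cmod order_trans by blast
qed

lemma re_bdd:
  assumes "f \<in> Cpos"
  shows "bdd_above (re ` {g \<in> Cpos. \<forall>x. g x \<le> f x})"
proof -
  obtain C where "\<And>g. g \<in> Cc \<Longrightarrow> (\<And>x. norm (g x) \<le> f x) \<Longrightarrow> norm (\<Phi> g) \<le> C"
    using \<Phi>_bounded[OF assms] by blast
  from re_bound[OF this] show ?thesis by (intro bdd_aboveI2[where M=C]) (auto simp: abs_le_iff)
qed

lemma re_pos_upper: "f \<in> Cpos \<Longrightarrow> g \<in> Cpos \<Longrightarrow> (\<And>x. g x \<le> f x) \<Longrightarrow> re g \<le> re_pos f"
  unfolding re_pos_def by (rule cSUP_upper[OF _ re_bdd]) auto

lemma re_pos_least: "f \<in> Cpos \<Longrightarrow> (\<And>g. g \<in> Cpos \<Longrightarrow> (\<And>x. g x \<le> f x) \<Longrightarrow> re g \<le> c) \<Longrightarrow> re_pos f \<le> c"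
  unfolding re_pos_def by (rule cSUP_least) (auto intro!: exI[of _ f])

sublocale pos: positive_functional re_pos
proof
  show "0 \<le> re_pos f" if "f \<in> Cpos" for f
    using re_pos_upper[OF that Cpos_zero] CposD(2)[OF that] by (simp add: re_zero)
  fix f g :: "'a \<Rightarrow> real" assume f: "f \<in> Cpos" and g: "g \<in> Cpos"
  show "re_pos (\<lambda>x. f x + g x) = re_pos f + re_pos g"
  proof (rule antisym)
    show "re_pos (\<lambda>x. f x + g x) \<le> re_pos f + re_pos g"
    proof (rule re_pos_least[OF Cpos_add[OF f g]])
      fix u assume u: "u \<in> Cpos" "\<And>x. u x \<le> f x + g x"
      \<comment> \<open>Riesz decomposition: a function below f + g splits into its minimum with f
        and a remainder, and the remainder is below g.\<close>
      let ?v = "\<lambda>x. min (u x) (f x)" and ?w = "\<lambda>x. u x - min (u x) (f x)"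
      have v: "?v \<in> Cpos" by (intro Cpos_min u f)
      have w: "?w \<in> Cpos" by (intro Cpos_diff u v) simp
      have "u = (\<lambda>x. ?v x + ?w x)" by auto
      then have "re u = re ?v + re ?w" using re_add[OF v w] by simp
      moreover have "re ?v \<le> re_pos f" by (intro re_pos_upper f v) simp
      moreover have "re ?w \<le> re_pos g"
      proof (intro re_pos_upper g w)
        show "?w x \<le> g x" for x using u(2)[of x] CposD(2)[OF g, of x] by (simp add: min_def)
      qed
      ultimately show "re u \<le> re_pos f + re_pos g" by simp
    qed
    have "re u + re v \<le> re_pos (\<lambda>x. f x + g x)"
      if "u \<in> Cpos" "\<And>x. u x \<le> f x" "v \<in> Cpos" "\<And>x. v x \<le> g x" for u v
      using that re_pos_upper[OF Cpos_add[OF f g] Cpos_add[of u v]] re_add[of u v] by (auto intro: add_mono)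
    then have "re_pos f \<le> re_pos (\<lambda>x. f x + g x) - re v" if "v \<in> Cpos" "\<And>x. v x \<le> g x" for v
      using that by (intro re_pos_least f) (simp add: le_diff_eq)
    then have "re_pos g \<le> re_pos (\<lambda>x. f x + g x) - re_pos f"
      by (intro re_pos_least g) (simp add: le_diff_eq add.commute)
    then show "re_pos f + re_pos g \<le> re_pos (\<lambda>x. f x + g x)" by simp
  qed
qed

sublocale neg: positive_functional "\<lambda>f. re_pos f - re f"
proof
  show "0 \<le> re_pos f - re f" if "f \<in> Cpos" for f using re_pos_upper[OF that that] by simp
qed (simp add: pos.add re_add)

text \<open>Both parts obey the bound of the functional without loss. For the negative part, re g -
  re f equals - re (f - g), and f - g is again dominated by f when g lies between 0 and f.\<close>

lemma re_pos_bounds: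
  assumes "\<And>g. g \<in> Cc \<Longrightarrow> (\<And>x. norm (g x) \<le> f x) \<Longrightarrow> norm (\<Phi> g) \<le> C" "f \<in> Cpos"
  shows "re_pos f \<le> C" "re_pos f - re f \<le> C"
proof -
  show "re_pos f \<le> C"
    using re_bound[of f C] assms by (intro re_pos_least) (auto simp: abs_le_iff)
  have "re_pos f \<le> C + re f"
  proof (rule re_pos_least[OF assms(2)])
    fix g assume g: "g \<in> Cpos" "\<And>x. g x \<le> f x"
    have d: "(\<lambda>x. f x - g x) \<in> Cpos" by (intro Cpos_diff assms g)
    have "\<bar>re (\<lambda>x. f x - g x)\<bar> \<le> C"
      using CposD(2)[OF g(1)] by (intro re_bound[of f C] assms(1) d) auto
    moreover have "re f = re (\<lambda>x. f x - g x) + re g" using re_add[OF d g(1)] by simp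
    ultimately show "re g \<le> C + re f" by (simp add: abs_le_iff)
  qed
  then show "re_pos f - re f \<le> C" by simp
qed

lemma re_riesz:
  obtains P Q where "loc_finite P" "loc_finite Q"
    "\<And>f. f \<in> Cpos \<Longrightarrow> Re (\<Phi> (\<lambda>x. of_real (f x))) = (LINT x|P. f x) - (LINT x|Q. f x)"
    "\<And>A f C. A \<in> sets borel \<Longrightarrow> f \<in> Cpos \<Longrightarrow> (\<And>x. indicator A x \<le> f x) \<Longrightarrow>
       (\<And>g. g \<in> Cc \<Longrightarrow> (\<And>x. norm (g x) \<le> f x) \<Longrightarrow> norm (\<Phi> g) \<le> C) \<Longrightarrow>
       emeasure P A \<le> ennreal C \<and> emeasure Q A \<le> ennreal C"
proof -
  obtain P where P: "loc_finite P" "\<And>f. f \<in> Cpos \<Longrightarrow> (LINT x|P. f x) = re_pos f"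
    "\<And>A g. A \<in> sets borel \<Longrightarrow> g \<in> Cpos \<Longrightarrow> (\<And>x. indicator A x \<le> g x) \<Longrightarrow> emeasure P A \<le> ennreal (re_pos g)"
    using pos.riesz by blast
  obtain Q where Q: "loc_finite Q" "\<And>f. f \<in> Cpos \<Longrightarrow> (LINT x|Q. f x) = re_pos f - re f"
    "\<And>A g. A \<in> sets borel \<Longrightarrow> g \<in> Cpos \<Longrightarrow> (\<And>x. indicator A x \<le> g x) \<Longrightarrow> emeasure Q A \<le> ennreal (re_pos g - re g)"
    using neg.riesz by blast
  show thesis
  proof (rule that[OF P(1) Q(1)])
    show "Re (\<Phi> (\<lambda>x. of_real (f x))) = (LINT x|P. f x) - (LINT x|Q. f x)" if "f \<in> Cpos" for f
      using P(2)[OF that] Q(2)[OF that] by (simp add: re_def)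
    fix A :: "'a set" and f :: "'a \<Rightarrow> real" and C :: real
    assume A: "A \<in> sets borel" "f \<in> Cpos" "\<And>x. indicator A x \<le> f x"
      and C: "\<And>g. g \<in> Cc \<Longrightarrow> (\<And>x. norm (g x) \<le> f x) \<Longrightarrow> norm (\<Phi> g) \<le> C"
    show "emeasure P A \<le> ennreal C \<and> emeasure Q A \<le> ennreal C"
      using P(3)[OF A] Q(3)[OF A] re_pos_bounds[OF C A(2)] ennreal_leI order_trans by blast
  qed
qed

end

section \<open>Dominating measures and densities\<close>

lemma sum_of_measures:
  fixes P Q :: "'a::euclidean_space measure"
  assumes "sets P = sets borel" "sets Q = sets borel"
  obtains S where "sets S = sets borel" "\<And>A. A \<in> sets borel \<Longrightarrow> emeasure S A = emeasure P A + emeasure Q A"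
proof -
  define S where "S = measure_of UNIV (sets (borel :: 'a measure)) (\<lambda>A. emeasure P A + emeasure Q A)"
  have ca: "countably_additive (sets borel) (\<lambda>A. emeasure P A + emeasure Q A)"
    unfolding countably_additive_def
  proof (intro allI impI)
    fix A :: "nat \<Rightarrow> 'a set" assume A: "range A \<subseteq> sets borel" "disjoint_family A"
    have "(\<Sum>i. emeasure P (A i) + emeasure Q (A i)) = (\<Sum>i. emeasure P (A i)) + (\<Sum>i. emeasure Q (A i))"
      by (intro suminf_add[symmetric] summableI)
    also have "\<dots> = emeasure P (\<Union> (range A)) + emeasure Q (\<Union> (range A))"
      using A assms by (simp add: suminf_emeasure)
    finally show "(\<Sum>i. emeasure P (A i) + emeasure Q (A i)) = emeasure P (\<Union> (range A)) + emeasure Q (\<Union> (range A))" .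
  qed
  have sa: "sigma_algebra UNIV (sets (borel :: 'a measure))"
    using sets.sigma_algebra_axioms[of "borel :: 'a measure"] by simp
  show thesis
  proof (rule that[of S])
    show "sets S = sets borel" unfolding S_def using sigma_algebra.sets_measure_of_eq[OF sa] by simp
    show "emeasure S A = emeasure P A + emeasure Q A" if "A \<in> sets borel" for A
      unfolding S_def by (rule emeasure_measure_of_sigma[OF sa _ ca that]) (simp add: positive_def)
  qed
qed

text \<open>Domination gives absolute continuity, and \<sigma>-finiteness of P makes the
  Radon-Nikodym density finite almost everywhere, so passing to a real function alters it on a null
  set only.\<close>

lemma real_density_exists:
  assumes S: "loc_finite S" and P: "loc_finite P" and le: "\<And>A. A \<in> sets borel \<Longrightarrow> emeasure P A \<le> emeasure S A"
  obtains r :: "'a::euclidean_space \<Rightarrow> real" where "r \<in> borel_measurable borel" "\<And>x. 0 \<le> r x" "P = density S (\<lambda>x. ennreal (r x))"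
proof -
  have s: "sets P = sets S" "sets S = sets borel" using S P by (auto simp: loc_finite_sets)
  interpret S: sigma_finite_measure S by (rule loc_finite_sigma_finite[OF S])
  have ac: "absolutely_continuous S P"
    unfolding absolutely_continuous_def
  proof
    fix A assume A: "A \<in> null_sets S"
    then have "emeasure P A \<le> 0" using le[of A] s by (auto simp: null_sets_def)
    with A show "A \<in> null_sets P" using s by (auto simp: null_sets_def)
  qed
  define r where "r x = enn2real (RN_deriv S P x)" for x
  have "AE x in S. RN_deriv S P x \<noteq> \<infinity>"
    by (rule S.RN_deriv_finite[OF loc_finite_sigma_finite[OF P] ac s(1)])
  then have ae: "AE x in S. RN_deriv S P x = ennreal (r x)"
    by eventually_elim (simp add: r_def less_top)
  have m: "r \<in> borel_measurable S" unfolding r_def by measurable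
  have "P = density S (RN_deriv S P)" using S.density_RN_deriv[OF ac s(1)] by simp
  also have "\<dots> = density S (\<lambda>x. ennreal (r x))" using m ae by (intro density_cong) auto
  finally show thesis using m s(2) by (intro that[of r]) (auto simp: r_def cong: measurable_cong_sets)
qed

section \<open>Riesz representation of complex functionals\<close>

text \<open>Agreement on the positive cone suffices: f is a combination with coefficients 1, -1,
  \<i> and -\<i> of the positive and negative parts of its real and imaginary parts.\<close>

lemma complex_functional_eqI:
  fixes \<Phi> :: "('a::euclidean_space \<Rightarrow> complex) \<Rightarrow> complex"
  assumes "complex_functional \<Phi>" and A: "\<And>h. h \<in> Cpos \<Longrightarrow> I (\<lambda>x. of_real (h x)) = \<Phi> (\<lambda>x. of_real (h x))"
    and I: "\<And>f g. f \<in> Cc \<Longrightarrow> g \<in> Cc \<Longrightarrow> I (\<lambda>x. f x + g x) = I f + I g" "\<And>f c. I (\<lambda>x. c * f x) = c * I f"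
    and f: "f \<in> Cc"
  shows "I f = \<Phi> f"
proof -
  interpret complex_functional \<Phi> by fact
  have c: "continuous_on UNIV f" by (rule Cc_continuous[OF f])
  obtain R where R: "\<And>x. norm x > R \<Longrightarrow> f x = 0" using CcE[OF f] by blast
  let ?a = "\<lambda>x. max 0 (Re (f x))" and ?b = "\<lambda>x. max 0 (- Re (f x))"
    and ?c = "\<lambda>x. max 0 (Im (f x))" and ?d = "\<lambda>x. max 0 (- Im (f x))"
  have p: "?a \<in> Cpos" "?b \<in> Cpos" "?c \<in> Cpos" "?d \<in> Cpos"
    using c R by (auto intro!: CposI[of _ R] continuous_intros)
  let ?A = "\<lambda>x. complex_of_real (?a x)" and ?B = "\<lambda>x. complex_of_real (?b x)"
    and ?C = "\<lambda>x. complex_of_real (?c x)" and ?D = "\<lambda>x. complex_of_real (?d x)"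
  have q: "?A \<in> Cc" "?B \<in> Cc" "?C \<in> Cc" "?D \<in> Cc" using p[THEN CposD(3)] by blast+
  have f_eq: "f = (\<lambda>x. (?A x + (-1) * ?B x) + (\<i> * ?C x + (- \<i>) * ?D x))"
    by (rule ext, rule complex_eqI) auto
  have "I (\<lambda>x. (?A x + (-1) * ?B x) + (\<i> * ?C x + (- \<i>) * ?D x)) = (I ?A + (-1) * I ?B) + (\<i> * I ?C + (- \<i>) * I ?D)"
    by (simp only: I Cc_add Cc_cmult q)
  moreover have "\<Phi> (\<lambda>x. (?A x + (-1) * ?B x) + (\<i> * ?C x + (- \<i>) * ?D x)) = (\<Phi> ?A + (-1) * \<Phi> ?B) + (\<i> * \<Phi> ?C + (- \<i>) * \<Phi> ?D)"
    by (simp only: \<Phi>_add \<Phi>_cmult Cc_add Cc_cmult q)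
  ultimately have "I (\<lambda>x. (?A x + (-1) * ?B x) + (\<i> * ?C x + (- \<i>) * ?D x)) = \<Phi> (\<lambda>x. (?A x + (-1) * ?B x) + (\<i> * ?C x + (- \<i>) * ?D x))"
    by (simp only: A[OF p(1)] A[OF p(2)] A[OF p(3)] A[OF p(4)])
  then show ?thesis unfolding f_eq[symmetric] .
qed

text \<open>The four positive measures coming from the real and imaginary parts may overlap, so they
  are written as densities over their sum S; the resulting complex density is split into modulus and
  phase, which is the required polar form. The factor 4 in the mass bound counts the four
  parts.\<close>

theorem complex_riesz:
  fixes \<Phi> :: "('a::euclidean_space \<Rightarrow> complex) \<Rightarrow> complex"
  assumes "complex_functional \<Phi>"
  obtains \<nu> where "radon_cmeasure \<nu>" "\<And>f. f \<in> Cc \<Longrightarrow> cm_integral \<nu> f = \<Phi> f"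
    "\<And>A f C. A \<in> sets borel \<Longrightarrow> f \<in> Cpos \<Longrightarrow> 0 \<le> C \<Longrightarrow> (\<And>x. indicator A x \<le> f x) \<Longrightarrow>
       (\<And>g. g \<in> Cc \<Longrightarrow> (\<And>x. norm (g x) \<le> f x) \<Longrightarrow> norm (\<Phi> g) \<le> C) \<Longrightarrow>
       emeasure (fst \<nu>) A \<le> ennreal (4 * C)"
proof -
  interpret R: complex_functional \<Phi> by fact
  \<comment> \<open>The real part of -\<i> \<Phi> f is the imaginary part of \<Phi> f, so the real
    theory applies a second time.\<close>
  interpret I: complex_functional "\<lambda>f. - \<i> * \<Phi> f"
  proof
    show "- \<i> * \<Phi> (\<lambda>x. f x + g x) = - \<i> * \<Phi> f + - \<i> * \<Phi> g" if "f \<in> Cc" "g \<in> Cc" for f g :: "'a \<Rightarrow> complex"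
      using R.\<Phi>_add[OF that] by (simp add: distrib_left)
    show "- \<i> * \<Phi> (\<lambda>x. c * f x) = c * (- \<i> * \<Phi> f)" if "f \<in> Cc" for c and f :: "'a \<Rightarrow> complex"
      using R.\<Phi>_cmult[OF that, of c] by simp
    show "\<exists>C. \<forall>g\<in>Cc. (\<forall>x. norm (g x) \<le> f x) \<longrightarrow> norm (- \<i> * \<Phi> g) \<le> C" if "f \<in> Cpos" for f
      using R.\<Phi>_bounded[OF that] by (simp add: norm_mult)
  qed
  obtain P1 P2 where P12: "loc_finite P1" "loc_finite P2"
    "\<And>f. f \<in> Cpos \<Longrightarrow> Re (\<Phi> (\<lambda>x. of_real (f x))) = (LINT x|P1. f x) - (LINT x|P2. f x)"
    "\<And>A f C. A \<in> sets borel \<Longrightarrow> f \<in> Cpos \<Longrightarrow> (\<And>x. indicator A x \<le> f x) \<Longrightarrow>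
       (\<And>g. g \<in> Cc \<Longrightarrow> (\<And>x. norm (g x) \<le> f x) \<Longrightarrow> norm (\<Phi> g) \<le> C) \<Longrightarrow>
       emeasure P1 A \<le> ennreal C \<and> emeasure P2 A \<le> ennreal C"
    using R.re_riesz by blast
  obtain P3 P4 where P34: "loc_finite P3" "loc_finite P4"
    "\<And>f. f \<in> Cpos \<Longrightarrow> Re (- \<i> * \<Phi> (\<lambda>x. of_real (f x))) = (LINT x|P3. f x) - (LINT x|P4. f x)"
    "\<And>A f C. A \<in> sets borel \<Longrightarrow> f \<in> Cpos \<Longrightarrow> (\<And>x. indicator A x \<le> f x) \<Longrightarrow>
       (\<And>g. g \<in> Cc \<Longrightarrow> (\<And>x. norm (g x) \<le> f x) \<Longrightarrow> norm (- \<i> * \<Phi> g) \<le> C) \<Longrightarrow>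
       emeasure P3 A \<le> ennreal C \<and> emeasure P4 A \<le> ennreal C"
    using I.re_riesz by blast
  note lf = P12(1) P12(2) P34(1) P34(2)
  note sP = lf[THEN loc_finite_sets]
  obtain S12 where S12: "sets S12 = sets borel" "\<And>A. A \<in> sets borel \<Longrightarrow> emeasure S12 A = emeasure P1 A + emeasure P2 A"
    using sum_of_measures[OF sP(1,2)] by blast
  obtain S34 where S34: "sets S34 = sets borel" "\<And>A. A \<in> sets borel \<Longrightarrow> emeasure S34 A = emeasure P3 A + emeasure P4 A"
    using sum_of_measures[OF sP(3,4)] by blast
  obtain S where S: "sets S = sets borel" "\<And>A. A \<in> sets borel \<Longrightarrow> emeasure S A = emeasure S12 A + emeasure S34 A"
    using sum_of_measures[OF S12(1) S34(1)] by blast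
  have SA: "emeasure S A = (emeasure P1 A + emeasure P2 A) + (emeasure P3 A + emeasure P4 A)" if "A \<in> sets borel" for A
    using that by (simp add: S(2) S12(2) S34(2))
  have Slf: "loc_finite S"
    unfolding loc_finite_def
  proof (intro conjI allI impI S(1))
    fix K :: "'a set" assume K: "compact K"
    show "emeasure S K < \<infinity>"
      using lf[THEN loc_finite_compact, OF K] by (simp add: SA borel_compact K)
  qed
  have le: "emeasure P1 A \<le> emeasure S A" "emeasure P2 A \<le> emeasure S A" "emeasure P3 A \<le> emeasure S A" "emeasure P4 A \<le> emeasure S A"
    if "A \<in> sets borel" for A
    unfolding SA[OF that] by (auto intro: add_increasing add_increasing2)
  obtain r1 where r1: "r1 \<in> borel_measurable borel" "\<And>x. 0 \<le> r1 x" "P1 = density S (\<lambda>x. ennreal (r1 x))"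
    using real_density_exists[OF Slf lf(1) le(1)] by blast
  obtain r2 where r2: "r2 \<in> borel_measurable borel" "\<And>x. 0 \<le> r2 x" "P2 = density S (\<lambda>x. ennreal (r2 x))"
    using real_density_exists[OF Slf lf(2) le(2)] by blast
  obtain r3 where r3: "r3 \<in> borel_measurable borel" "\<And>x. 0 \<le> r3 x" "P3 = density S (\<lambda>x. ennreal (r3 x))"
    using real_density_exists[OF Slf lf(3) le(3)] by blast
  obtain r4 where r4: "r4 \<in> borel_measurable borel" "\<And>x. 0 \<le> r4 x" "P4 = density S (\<lambda>x. ennreal (r4 x))"
    using real_density_exists[OF Slf lf(4) le(4)] by blast
  define h where "h x = complex_of_real (r1 x - r2 x) + \<i> * complex_of_real (r3 x - r4 x)" for x
  \<comment> \<open>Where h vanishes the phase is set to 1. That set is null for the measure with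
    density norm h, and s has modulus 1 everywhere.\<close>
  define s where "s x = (if h x = 0 then 1 else h x / of_real (norm (h x)))" for x
  have hm: "h \<in> borel_measurable borel" unfolding h_def using r1(1) r2(1) r3(1) r4(1) by measurable
  have sm: "s \<in> borel_measurable borel" unfolding s_def using hm by measurable
  have hs: "of_real (norm (h x)) * s x = h x" "norm (s x) = 1" for x
    by (auto simp: s_def norm_divide)
  have hle: "norm (h x) \<le> (r1 x + r2 x) + (r3 x + r4 x)" for x
  proof -
    have "norm (h x) \<le> \<bar>r1 x - r2 x\<bar> + \<bar>r3 x - r4 x\<bar>"
      unfolding h_def using norm_triangle_ineq[of "complex_of_real (r1 x - r2 x)" "\<i> * complex_of_real (r3 x - r4 x)"]
      by (simp only: norm_mult norm_ii norm_of_real mult_1)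
    then show ?thesis using r1(2)[of x] r2(2)[of x] r3(2)[of x] r4(2)[of x] by linarith
  qed
  define M where "M = density S (\<lambda>x. ennreal (norm (h x)))"
  have Ms: "sets M = sets borel" by (simp add: M_def S(1))
  have rmS: "r1 \<in> borel_measurable S" "r2 \<in> borel_measurable S" "r3 \<in> borel_measurable S" "r4 \<in> borel_measurable S"
    "h \<in> borel_measurable S" "s \<in> borel_measurable S"
    using r1(1) r2(1) r3(1) r4(1) hm sm S(1) by (simp_all cong: measurable_cong_sets)
  have Mle: "emeasure M A \<le> (emeasure P1 A + emeasure P2 A) + (emeasure P3 A + emeasure P4 A)" if A: "A \<in> sets borel" for A
  proof -
    have AS: "A \<in> sets S" using A S(1) by simp
    have "emeasure M A = (\<integral>\<^sup>+x. ennreal (norm (h x)) * indicator A x \<partial>S)"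
      unfolding M_def using rmS AS by (intro emeasure_density) auto
    also have "\<dots> \<le> (\<integral>\<^sup>+x. (ennreal (r1 x) * indicator A x + ennreal (r2 x) * indicator A x)
        + (ennreal (r3 x) * indicator A x + ennreal (r4 x) * indicator A x) \<partial>S)"
    proof (intro nn_integral_mono)
      fix x
      have "ennreal (norm (h x)) \<le> (ennreal (r1 x) + ennreal (r2 x)) + (ennreal (r3 x) + ennreal (r4 x))"
        using ennreal_leI[OF hle[of x]] r1(2) r2(2) r3(2) r4(2) by (simp add: ennreal_plus)
      then show "ennreal (norm (h x)) * indicator A x \<le> (ennreal (r1 x) * indicator A x + ennreal (r2 x) * indicator A x)
        + (ennreal (r3 x) * indicator A x + ennreal (r4 x) * indicator A x)"
        by (auto simp: indicator_def)
    qed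
    also have "\<dots> = ((\<integral>\<^sup>+x. ennreal (r1 x) * indicator A x \<partial>S) + (\<integral>\<^sup>+x. ennreal (r2 x) * indicator A x \<partial>S))
        + ((\<integral>\<^sup>+x. ennreal (r3 x) * indicator A x \<partial>S) + (\<integral>\<^sup>+x. ennreal (r4 x) * indicator A x \<partial>S))"
    proof -
      have m: "(\<lambda>x. ennreal (r x) * indicator A x) \<in> borel_measurable S" if "r \<in> borel_measurable S" for r
        using that AS by measurable
      show ?thesis using m rmS by (simp add: nn_integral_add)
    qed
    also have "\<dots> = (emeasure P1 A + emeasure P2 A) + (emeasure P3 A + emeasure P4 A)"
    proof -
      have e: "emeasure (density S (\<lambda>x. ennreal (r x))) A = (\<integral>\<^sup>+x. ennreal (r x) * indicator A x \<partial>S)"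
        if "r \<in> borel_measurable S" for r :: "'a \<Rightarrow> real"
        using that AS by (intro emeasure_density) auto
      show ?thesis unfolding r1(3) r2(3) r3(3) r4(3) using rmS by (simp add: e)
    qed
    finally show ?thesis .
  qed
  define \<nu> where "\<nu> = (M, s)"
  have Mlf: "emeasure M K < \<infinity>" if K: "compact K" for K
  proof -
    have "emeasure M K \<le> emeasure S K" using Mle[of K] SA[of K] K by (simp add: borel_compact)
    also have "\<dots> < \<infinity>" by (rule loc_finite_compact[OF Slf K])
    finally show ?thesis .
  qed
  have rad: "radon_cmeasure \<nu>"
    unfolding radon_cmeasure_def \<nu>_def using Ms Mlf sm hs(2) by simp
  have dens: "integrable S (\<lambda>x. r x * u x) \<and> (LINT x|density S (\<lambda>x. ennreal (r x)). u x) = (LINT x|S. r x * u x)"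
    if r: "r \<in> borel_measurable S" "\<And>x. 0 \<le> r x" and lfr: "loc_finite (density S (\<lambda>x. ennreal (r x)))" and u: "u \<in> Cpos"
    for r u :: "'a \<Rightarrow> real"
  proof -
    have um: "u \<in> borel_measurable S"
      using borel_measurable_continuous_onI[OF CposD(1)[OF u]] S(1) by (simp cong: measurable_cong_sets)
    have "integrable (density S (\<lambda>x. ennreal (r x))) u" by (rule Cpos_integrable[OF lfr u])
    then have "integrable S (\<lambda>x. r x * u x)"
      using integrable_density[OF um, of r] r by simp
    moreover have "(LINT x|density S (\<lambda>x. ennreal (r x)). u x) = (LINT x|S. r x * u x)"
      using integral_density[OF um, of r] r by simp
    ultimately show ?thesis ..
  qed
  have pos: "cm_integral \<nu> (\<lambda>x. of_real (u x)) = \<Phi> (\<lambda>x. of_real (u x))" if u: "u \<in> Cpos" for u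
  proof -
    have um: "(\<lambda>x. complex_of_real (u x) * s x) \<in> borel_measurable S"
      using borel_measurable_continuous_onI[OF CposD(1)[OF u]] S(1) rmS(6)
      by (intro borel_measurable_times borel_measurable_of_real) (simp_all cong: measurable_cong_sets)
    note d1 = dens[OF rmS(1) r1(2) lf(1)[unfolded r1(3)] u, folded r1(3)]
    note d2 = dens[OF rmS(2) r2(2) lf(2)[unfolded r2(3)] u, folded r2(3)]
    note d3 = dens[OF rmS(3) r3(2) lf(3)[unfolded r3(3)] u, folded r3(3)]
    note d4 = dens[OF rmS(4) r4(2) lf(4)[unfolded r4(3)] u, folded r4(3)]
    have "cm_integral \<nu> (\<lambda>x. of_real (u x)) = (LINT x|S. norm (h x) *\<^sub>R (of_real (u x) * s x))"
      unfolding cm_integral_def \<nu>_def M_def fst_conv snd_conv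
      using rmS by (intro integral_density um) auto
    also have "\<dots> = (LINT x|S. complex_of_real (r1 x * u x - r2 x * u x) + \<i> * complex_of_real (r3 x * u x - r4 x * u x))"
    proof (intro Bochner_Integration.integral_cong refl)
      fix x
      have "norm (h x) *\<^sub>R (of_real (u x) * s x) = of_real (u x) * (of_real (norm (h x)) * s x)"
        by (simp add: scaleR_conv_of_real)
      also have "\<dots> = of_real (u x) * h x" by (simp only: hs(1))
      finally show "norm (h x) *\<^sub>R (of_real (u x) * s x) = complex_of_real (r1 x * u x - r2 x * u x) + \<i> * complex_of_real (r3 x * u x - r4 x * u x)"
        by (simp add: h_def algebra_simps)
    qed
    also have "\<dots> = complex_of_real ((LINT x|P1. u x) - (LINT x|P2. u x)) + \<i> * complex_of_real ((LINT x|P3. u x) - (LINT x|P4. u x))"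
    proof -
      have i: "integrable S (\<lambda>x. r1 x * u x - r2 x * u x)" "integrable S (\<lambda>x. r3 x * u x - r4 x * u x)"
        using d1 d2 d3 d4 by auto
      have "(LINT x|S. complex_of_real (r1 x * u x - r2 x * u x) + \<i> * complex_of_real (r3 x * u x - r4 x * u x))
        = (LINT x|S. complex_of_real (r1 x * u x - r2 x * u x)) + (LINT x|S. \<i> * complex_of_real (r3 x * u x - r4 x * u x))"
        by (intro Bochner_Integration.integral_add integrable_of_real integrable_mult_right i)
      also have "\<dots> = complex_of_real (LINT x|S. r1 x * u x - r2 x * u x) + \<i> * complex_of_real (LINT x|S. r3 x * u x - r4 x * u x)"
        by (simp only: integral_mult_right_zero integral_complex_of_real)
      also have "(LINT x|S. r1 x * u x - r2 x * u x) = (LINT x|P1. u x) - (LINT x|P2. u x)" using d1 d2 by simp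
      also have "(LINT x|S. r3 x * u x - r4 x * u x) = (LINT x|P3. u x) - (LINT x|P4. u x)" using d3 d4 by simp
      finally show ?thesis .
    qed
    also have "\<dots> = \<Phi> (\<lambda>x. of_real (u x))"
      using P12(3)[OF u] P34(3)[OF u] by (intro complex_eqI) auto
    finally show ?thesis .
  qed
  show thesis
  proof (rule that[OF rad])
    show "cm_integral \<nu> f = \<Phi> f" if "f \<in> Cc" for f
    proof (rule complex_functional_eqI[OF assms pos _ _ that])
      show "cm_integral \<nu> (\<lambda>x. f x + g x) = cm_integral \<nu> f + cm_integral \<nu> g" if "f \<in> Cc" "g \<in> Cc" for f g
        using that by (intro cm_integral_add rad Cc_integrable radon_loc_finite)
    qed (auto simp: cm_integral_cmult)
    fix A :: "'a set" and f :: "'a \<Rightarrow> real" and C :: real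
    assume A: "A \<in> sets borel" "f \<in> Cpos" "0 \<le> C" "\<And>x. indicator A x \<le> f x"
      and C: "\<And>g. g \<in> Cc \<Longrightarrow> (\<And>x. norm (g x) \<le> f x) \<Longrightarrow> norm (\<Phi> g) \<le> C"
    have C': "norm (- \<i> * \<Phi> g) \<le> C" if "g \<in> Cc" "\<And>x. norm (g x) \<le> f x" for g
      using C[OF that] by (simp add: norm_mult)
    have "emeasure M A \<le> (emeasure P1 A + emeasure P2 A) + (emeasure P3 A + emeasure P4 A)" by (rule Mle[OF A(1)])
    also have "\<dots> \<le> (ennreal C + ennreal C) + (ennreal C + ennreal C)"
      using P12(4)[OF A(1,2,4) C] P34(4)[OF A(1,2,4) C'] by (intro add_mono) auto
    also have "\<dots> = ennreal (4 * C)" using A(3) by (simp flip: ennreal_plus)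
    finally show "emeasure (fst \<nu>) A \<le> ennreal (4 * C)" by (simp add: \<nu>_def)
  qed
qed

section \<open>Uniform convergence of the transforms\<close>

lemma one_plus_norm_add: "1 + norm (a + b) \<le> (1 + norm a) * (1 + norm b)"
proof -
  have "0 \<le> norm a * norm b" by simp
  moreover have "(1 + norm a) * (1 + norm b) = 1 + (norm a + norm b) + norm a * norm b"
    by (simp add: distrib_left distrib_right)
  ultimately show ?thesis using norm_triangle_ineq[of a b] by linarith
qed

text \<open>A Peetre-type inequality: recentring the weight by b costs only a power of 1 + norm b,
  because 1 + norm is submultiplicative.\<close>

lemma wt_shift:
  fixes y b :: "'a::euclidean_space"
  shows "wt y \<le> (1 + norm b) ^ (DIM('a) + 2) * wt (y + b)"
proof -
  have "(1 + norm (y + b)) ^ (DIM('a) + 2) \<le> ((1 + norm y) * (1 + norm b)) ^ (DIM('a) + 2)"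
    by (intro power_mono one_plus_norm_add) auto
  moreover have "0 < (1 + norm (y + b)) ^ (DIM('a) + 2)" "0 < (1 + norm y) ^ (DIM('a) + 2)"
    by (intro zero_less_power add_pos_nonneg; simp)+
  ultimately show ?thesis
    unfolding wt_def power_mult_distrib
    by (simp only: mult_1_right times_divide_eq_right divide_le_eq le_divide_eq if_True mult_1 times_divide_eq_left mult.commute)
qed

lemma le_wt_iff:
  fixes y :: "'a::euclidean_space"
  shows "a \<le> B * wt y \<longleftrightarrow> (1 + norm y) ^ (DIM('a) + 2) * a \<le> B"
proof -
  have "0 < (1 + norm y) ^ (DIM('a) + 2)" by (intro zero_less_power add_pos_nonneg) auto
  then show ?thesis
    unfolding wt_def by (simp only: mult_1_right times_divide_eq_right le_divide_eq if_True mult.commute)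
qed

text \<open>Translation bounded measures act boundedly on the weighted supremum norm, and K depends
  neither on the measure nor on the centre t. The estimate therefore applies to a whole sequence and
  to all translates at once.\<close>

lemma cm_integral_wt_bound:
  obtains K :: real where "K \<ge> 0"
    "\<And>(\<nu> :: 'a::euclidean_space cmeasure) C (u :: 'a \<Rightarrow> complex) e t. radon_cmeasure \<nu> \<Longrightarrow> tbound (fst \<nu>) C \<Longrightarrow> u \<in> borel_measurable borel \<Longrightarrow>
       (\<And>y. norm (u y) \<le> e * wt (y - t)) \<Longrightarrow> integrable (fst \<nu>) u \<and> norm (cm_integral \<nu> u) \<le> e * (C * K)"
proof -
  obtain K :: real where K: "K \<ge> 0"
    "\<And>(M :: 'a measure) C t. tbound M C \<Longrightarrow> integrable M (\<lambda>y. wt (y - t))"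
    "\<And>(M :: 'a measure) C t. tbound M C \<Longrightarrow> (LINT y|M. wt (y - t)) \<le> C * K"
    using tbound_wt_integral by blast
  show thesis
  proof (rule that[OF K(1)])
    fix \<nu> :: "'a cmeasure" and C e :: real and u :: "'a \<Rightarrow> complex" and t
    assume \<nu>: "radon_cmeasure \<nu>" and tb: "tbound (fst \<nu>) C" and u: "u \<in> borel_measurable borel"
      and b: "\<And>y. norm (u y) \<le> e * wt (y - t)"
    have e: "e \<ge> 0" using order_trans[OF norm_ge_zero b[of t]] wt_pos[of "t - t"] by (simp add: zero_le_mult_iff)
    have i: "integrable (fst \<nu>) u"
    proof (rule Bochner_Integration.integrable_bound[OF integrable_mult_right[OF K(2)[OF tb], of e t]])
      show "u \<in> borel_measurable (fst \<nu>)" using u tb by (simp add: tbound_def cong: measurable_cong_sets)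
      show "AE y in fst \<nu>. norm (u y) \<le> norm (e * wt (y - t))" using b e by (intro AE_I2) simp
    qed
    have "norm (cm_integral \<nu> u) \<le> (LINT y|fst \<nu>. norm (u y))" by (rule cm_integral_norm_le[OF \<nu> i])
    also have "\<dots> \<le> (LINT y|fst \<nu>. e * wt (y - t))"
      by (intro integral_mono integrable_norm i integrable_mult_right K(2)[OF tb] b)
    also have "\<dots> \<le> e * (C * K)" using mult_left_mono[OF K(3)[OF tb, of t] e] by simp
    finally show "integrable (fst \<nu>) u \<and> norm (cm_integral \<nu> u) \<le> e * (C * K)" using i by blast
  qed
qed

text \<open>The kernel is the normalised square of the (real, even) transform of a bump, so that its
  dilated translates are transforms of modulated test functions.\<close>

lemma fourier_kernel:
  obtains kern :: "'a::euclidean_space \<Rightarrow> real"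
  where "continuous_on UNIV kern" "\<And>y. kern y \<ge> 0" "\<And>y. kern (- y) = kern y"
    "integrable lborel kern" "(LINT y|lborel. kern y) = 1"
    "\<And>k. \<exists>B\<ge>0. \<forall>y. (1 + norm y) ^ k * kern y \<le> B * wt y"
    "\<And>r. r > 0 \<Longrightarrow> \<exists>\<eta>\<in>Cc_inf. \<forall>t y. complex_of_real (r ^ DIM('a) * kern (r *\<^sub>R (y - t)))
        = inv_fourier (\<lambda>x. cnj (echar (t \<bullet> x)) * \<eta> x) y"
proof -
  define \<phi> where "\<phi> = (bump 1 :: 'a \<Rightarrow> complex)"
  define X where "X = fconv \<phi> \<phi>"
  have \<phi>: "\<phi> \<in> Cc_inf" "\<phi> \<in> Cc" unfolding \<phi>_def using bump_Cc_inf Cc_inf_Cc by blast+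
  have X: "X \<in> Cc_inf" unfolding X_def by (intro fconv_Cc_inf \<phi>)
  have rc: "refl_conj \<phi> = \<phi>" by (auto simp: refl_conj_def \<phi>_def bump_def)
  define F where "F y = Re (inv_fourier \<phi> y)" for y
  have F: "inv_fourier \<phi> y = of_real (F y)" for y
    using inv_fourier_refl_conj[OF \<phi>(2), of y] unfolding rc F_def
    by (metis Reals_cnj_iff of_real_Re)
  have even: "F (- y) = F y" for y
  proof -
    have "inv_fourier \<phi> (- y) = (LINT x|lborel. (\<lambda>x. \<phi> x * echar (x \<bullet> y)) (- x))"
      unfolding inv_fourier_echar by (simp add: \<phi>_def bump_def)
    also have "\<dots> = inv_fourier \<phi> y"
      unfolding inv_fourier_echar
      by (intro lborel_translate_integral(3) borel_measurable_continuous_onI continuous_intros Cc_continuous \<phi>)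
    finally show ?thesis by (simp add: F_def)
  qed
  have XF: "inv_fourier X y = of_real ((F y)\<^sup>2)" for y
    unfolding X_def inv_fourier_fconv[OF \<phi>(2) \<phi>(2)] F by (simp add: power2_eq_square)
  \<comment> \<open>At 0 the transform is the integral of the bump. Positivity at this single point
    makes the integral of the continuous square positive, so the kernel can be normalised.\<close>
  have F0: "F 0 > 0"
  proof -
    have "inv_fourier \<phi> 0 = (LINT x|lborel. complex_of_real (flat_exp 0 (1 - x \<bullet> (x :: 'a))))"
      by (simp add: inv_fourier_echar \<phi>_def bump_def)
    also have "\<dots> = complex_of_real (LINT x|lborel. flat_exp 0 (1 - x \<bullet> (x :: 'a)))"
      by (rule integral_complex_of_real)
    finally have "F 0 = (LINT x|lborel. flat_exp 0 (1 - x \<bullet> (x :: 'a)))" by (simp add: F_def)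
    then show ?thesis using bump_integral_pos[of 1, where 'a='a] by simp
  qed
  have cF: "continuous_on UNIV F" unfolding F_def by (intro continuous_intros inv_fourier_continuous \<phi>)
  have iF: "integrable lborel (\<lambda>y. (F y)\<^sup>2)"
    using integrable_Re[OF tbound_inv_fourier_integrable[OF tbound_lborel X]] by (simp add: XF)
  define c where "c = (LINT y|lborel. (F y)\<^sup>2)"
  have c: "c > 0" unfolding c_def
    by (rule integral_pos_continuous[OF _ _ iF, of 0]) (use cF F0 in \<open>auto intro!: continuous_intros\<close>)
  define kern where "kern y = (F y)\<^sup>2 / c" for y
  show thesis
  proof (rule that[of kern])
    show "continuous_on UNIV kern" unfolding kern_def using c by (intro continuous_intros cF) auto
    show "kern y \<ge> 0" for y using c by (simp add: kern_def)
    show "kern (- y) = kern y" for y by (simp add: kern_def even)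
    show "integrable lborel kern" unfolding kern_def using iF by simp
    show "(LINT y|lborel. kern y) = 1" unfolding kern_def using c by (simp add: c_def)
    show "\<exists>B\<ge>0. \<forall>y. (1 + norm y) ^ k * kern y \<le> B * wt y" for k
    proof -
      obtain B where B: "B \<ge> 0" "\<And>y. (1 + norm y) ^ k * norm (inv_fourier X y) \<le> B * wt y"
        using inv_fourier_wt_bound[OF X] by metis
      have "(1 + norm y) ^ k * kern y \<le> (B / c) * wt y" for y
        using divide_right_mono[OF B(2)[of y], of c] c unfolding XF kern_def by (simp add: norm_power)
      then show ?thesis using B(1) c by (intro exI[of _ "B / c"]) simp
    qed
    fix r :: real assume r: "r > 0"
    \<comment> \<open>Stretching the argument by r compresses the transform by r and multiplies it
      by r^d, which is exactly the dilation that preserves the integral of the kernel.\<close>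
    define \<eta> where "\<eta> x = of_real (1 / c) * X (x /\<^sub>R r)" for x
    have s: "(\<lambda>x. X (x /\<^sub>R r)) \<in> Cc"
    proof -
      obtain R where R: "\<And>x. norm x > R \<Longrightarrow> X x = 0" using CcE[OF Cc_inf_Cc[OF X]] by blast
      show ?thesis
      proof (rule CcI[of _ "r * R"])
        show "continuous_on UNIV (\<lambda>x. X (x /\<^sub>R r))"
          by (intro Cc_compose_continuous[OF Cc_inf_Cc[OF X]] continuous_intros)
        show "X (x /\<^sub>R r) = 0" if "norm x > r * R" for x using that r by (intro R) (simp add: field_simps)
      qed
    qed
    have "(\<lambda>x. X (x /\<^sub>R r)) \<in> Cc_inf"
      using smooth_scale[of X "inverse r"] X s by (simp add: Cc_inf_iff)
    then have \<eta>: "\<eta> \<in> Cc_inf" unfolding \<eta>_def[abs_def] by (intro Cc_inf_mult smooth_const)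
    have "complex_of_real (r ^ DIM('a) * kern (r *\<^sub>R (y - t))) = inv_fourier (\<lambda>x. cnj (echar (t \<bullet> x)) * \<eta> x) y" for t y
      unfolding inv_fourier_modulate \<eta>_def inv_fourier_cmult inv_fourier_scale[OF Cc_inf_Cc[OF X] r] XF
      by (simp add: kern_def)
    with \<eta> show "\<exists>\<eta>\<in>Cc_inf. \<forall>t y. complex_of_real (r ^ DIM('a) * kern (r *\<^sub>R (y - t)))
        = inv_fourier (\<lambda>x. cnj (echar (t \<bullet> x)) * \<eta> x) y" by blast
  qed
qed

text \<open>The approximation must hold relative to \<open>wt\<close>, also far from the support of
  g, where the convolution has tails. The decay of the kernel pays for the weight there, and
  dilation by a large r makes that contribution small.\<close>

lemma weighted_approximation:
  fixes g :: "'a::euclidean_space \<Rightarrow> complex" and kern :: "'a \<Rightarrow> real"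
  assumes g: "g \<in> Cc" and e: "e > 0"
    and kern: "continuous_on UNIV kern" "\<And>y. kern y \<ge> 0" "integrable lborel kern" "(LINT y|lborel. kern y) = 1"
    and decay: "\<And>k. \<exists>B\<ge>0. \<forall>y. (1 + norm y) ^ k * kern y \<le> B * wt y"
  obtains r where "r \<ge> 1"
    "\<And>z. norm ((LINT s|lborel. g s * of_real (r ^ DIM('a) * kern (r *\<^sub>R (z - s)))) - g z) \<le> e * wt z"
proof -
  let ?p = "DIM('a) + 2"
  obtain R where R: "R > 0" "\<And>x. norm x > R \<Longrightarrow> g x = 0" using CcE[OF g] by blast
  have "(\<lambda>x. of_real ((1 + norm x) ^ ?p) * g x) \<in> Cc" by (intro Cc_mult_left g continuous_intros)
  then obtain G where G: "G > 0" "\<And>x. norm (of_real ((1 + norm x) ^ ?p) * g x) \<le> G" by (rule Cc_bounded) blast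
  have G': "(1 + norm x) ^ ?p * norm (g x) \<le> G" for x
    using G(2)[of x] unfolding norm_mult norm_of_real by (simp del: power_Suc power_add)
  \<comment> \<open>For norm z at most R + 1 the weight factor is at most (R + 2)^(d+2), so an
    oscillation of g below w contributes at most e / 2.\<close>
  define w where "w = e / (2 * (R + 2) ^ ?p)"
  have w: "w > 0" using e R(1) by (simp add: w_def)
  obtain d' where d': "d' > 0" "\<And>x y. norm (x - y) < d' \<Longrightarrow> norm (g x - g y) < w"
    using Cc_uniformly_continuous[OF g w] by blast
  define d where "d = min 1 d'"
  have d: "d > 0" "d \<le> 1" using d' by (auto simp: d_def)
  \<comment> \<open>Small shifts use uniform continuity near the support. For the others the factor
    norm s / d, at least 1, is inserted and the weight factor is split by submultiplicativity; the
    outcome is a bound for all s whose second term vanishes with s.\<close>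
  have est: "(1 + norm z) ^ ?p * norm (g (z - s) - g z) \<le> e / 2 + (2 * G / d) * (norm s * (1 + norm s) ^ ?p)" for z s
  proof (cases "norm s < d")
    case True
    have "(1 + norm z) ^ ?p * norm (g (z - s) - g z) \<le> e / 2"
    proof (cases "norm z > R + 1")
      case z: True
      then have "norm (z - s) > R" using norm_triangle_ineq2[of z s] True d by linarith
      then show ?thesis using z R e by simp
    next
      case z: False
      have "(1 + norm z) ^ ?p * norm (g (z - s) - g z) \<le> (R + 2) ^ ?p * w"
        using d'(2)[of "z - s" z] True z R(1) by (intro mult_mono power_mono) (auto simp: d_def less_imp_le)
      also have "\<dots> = e / 2" using R(1) by (simp add: w_def)
      finally show ?thesis .
    qed
    also have "\<dots> \<le> e / 2 + (2 * G / d) * (norm s * (1 + norm s) ^ ?p)" using G d by simp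
    finally show ?thesis .
  next
    case False
    have one: "1 \<le> (1 + norm s) ^ ?p" by (intro one_le_power) simp
    have "(1 + norm z) ^ ?p * norm (g (z - s)) \<le> ((1 + norm (z - s)) * (1 + norm s)) ^ ?p * norm (g (z - s))"
      using one_plus_norm_add[of "z - s" s] by (intro mult_right_mono power_mono) auto
    also have "\<dots> = (1 + norm s) ^ ?p * ((1 + norm (z - s)) ^ ?p * norm (g (z - s)))"
      by (simp only: power_mult_distrib mult_ac)
    also have "\<dots> \<le> (1 + norm s) ^ ?p * G" by (intro mult_left_mono G') auto
    finally have 1: "(1 + norm z) ^ ?p * norm (g (z - s)) \<le> (1 + norm s) ^ ?p * G" .
    have "(1 + norm z) ^ ?p * norm (g z) \<le> 1 * G" using G' by simp
    also have "\<dots> \<le> (1 + norm s) ^ ?p * G" using one G(1) by (intro mult_right_mono) auto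
    finally have 2: "(1 + norm z) ^ ?p * norm (g z) \<le> (1 + norm s) ^ ?p * G" .
    have "(1 + norm z) ^ ?p * norm (g (z - s) - g z) \<le> (1 + norm z) ^ ?p * (norm (g (z - s)) + norm (g z))"
      by (intro mult_left_mono norm_triangle_ineq4) auto
    also have "\<dots> \<le> (1 + norm s) ^ ?p * G + (1 + norm s) ^ ?p * G"
      using add_mono[OF 1 2] by (simp only: distrib_left)
    also have "\<dots> = 2 * G * (1 + norm s) ^ ?p" by (simp only: mult_2 distrib_right mult.commute)
    also have "\<dots> \<le> 2 * G * (1 + norm s) ^ ?p * (norm s / d)"
    proof -
      have "1 \<le> norm s / d" using False d(1) by (simp add: field_simps)
      from mult_left_mono[OF this, of "2 * G * (1 + norm s) ^ ?p"] G(1) show ?thesis by simp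
    qed
    also have "\<dots> = (2 * G / d) * (norm s * (1 + norm s) ^ ?p)" by (simp only: times_divide_eq_left times_divide_eq_right mult_ac)
    also have "\<dots> \<le> e / 2 + \<dots>" using e by simp
    finally show ?thesis .
  qed
  \<comment> \<open>Exponent d + 3: d + 2 powers pay for the split weight and one for the factor
    norm s, and what is left is still below the integrable weight.\<close>
  obtain B where B: "B \<ge> 0" "\<And>y. (1 + norm y) ^ (?p + 1) * kern y \<le> B * wt y" using decay[of "?p + 1"] by blast
  define W where "W = (LINT y|lborel. wt (y :: 'a))"
  have W: "W \<ge> 0" by (simp add: W_def)
  \<comment> \<open>After the substitution s = z - u / r the far term carries a factor 1 / r, and
    this r brings it below e / 2. Taking r at least 1 ensures that norm (u / r) does not exceed norm
    u.\<close>
  define r where "r = max 1 (4 * G * B * W / (d * e) + 1)"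
  have r: "r \<ge> 1" by (simp add: r_def)
  have rB: "(2 * G / d) / r * (B * W) \<le> e / 2"
  proof -
    have "4 * G * B * W / (d * e) \<le> r" by (simp add: r_def)
    then have "4 * G * B * W \<le> r * (d * e)" using d(1) e by (simp add: divide_le_eq)
    then show ?thesis using r d(1) by (simp add: field_simps)
  qed
  show thesis
  proof (rule that[of r])
    show "r \<ge> 1" by (rule r)
    fix z :: 'a
    have "continuous_on UNIV (\<lambda>s. g s * of_real (r ^ DIM('a) * kern (r *\<^sub>R (z - s))))"
      by (intro continuous_intros Cc_continuous g continuous_on_compose2[OF kern(1)]) auto
    then have m: "(\<lambda>s. g s * of_real (r ^ DIM('a) * kern (r *\<^sub>R (z - s)))) \<in> borel_measurable borel"
      by (rule borel_measurable_continuous_onI)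
    have rr: "r *\<^sub>R (z - (z + (- (1 / r)) *\<^sub>R u)) = u" "z + (- (1 / r)) *\<^sub>R u = z - u /\<^sub>R r" for u
      using r by (auto simp: divide_inverse)
    have "(LINT s|lborel. g s * of_real (r ^ DIM('a) * kern (r *\<^sub>R (z - s))))
       = (1 / r) ^ DIM('a) *\<^sub>R (LINT u|lborel. g (z - u /\<^sub>R r) * of_real (r ^ DIM('a) * kern u))"
      using lborel_affine_integral(1)[OF m, of "- (1 / r)" z] r unfolding rr(1) unfolding rr(2) by simp
    also have "\<dots> = (LINT u|lborel. g (z - u /\<^sub>R r) * of_real (kern u))"
      using r by (simp add: scaleR_conv_of_real power_one_over mult.left_commute)
    finally have eq: "(LINT s|lborel. g s * of_real (r ^ DIM('a) * kern (r *\<^sub>R (z - s)))) = (LINT u|lborel. g (z - u /\<^sub>R r) * of_real (kern u))" .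
    obtain Bg where Bg: "Bg > 0" "\<And>x. norm (g x) \<le> Bg" using Cc_bounded[OF g] by blast
    have i1: "integrable lborel (\<lambda>u. g (z - u /\<^sub>R r) * complex_of_real (kern u))"
    proof (rule Bochner_Integration.integrable_bound[OF integrable_mult_right[OF kern(3), of Bg]])
      have "continuous_on UNIV (\<lambda>u. g (z - u /\<^sub>R r) * complex_of_real (kern u))"
        by (intro continuous_intros Cc_compose_continuous[OF g] kern(1))
      then show "(\<lambda>u. g (z - u /\<^sub>R r) * complex_of_real (kern u)) \<in> borel_measurable lborel"
        using borel_measurable_continuous_onI by auto
      show "AE u in lborel. norm (g (z - u /\<^sub>R r) * complex_of_real (kern u)) \<le> norm (Bg * kern u)"
        using Bg kern(2) by (intro AE_I2) (auto simp: norm_mult abs_mult intro!: mult_right_mono)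
    qed
    have i2: "integrable lborel (\<lambda>u. g z * complex_of_real (kern u))"
      using kern(3) by (intro integrable_mult_right integrable_of_real)
    have "(LINT u|lborel. g z * complex_of_real (kern u)) = g z"
      using kern(4) by (simp add: integral_complex_of_real)
    then have "(LINT s|lborel. g s * of_real (r ^ DIM('a) * kern (r *\<^sub>R (z - s)))) - g z
      = (LINT u|lborel. (g (z - u /\<^sub>R r) - g z) * of_real (kern u))"
      unfolding eq left_diff_distrib using i1 i2 by simp
    then have "(1 + norm z) ^ ?p * norm ((LINT s|lborel. g s * of_real (r ^ DIM('a) * kern (r *\<^sub>R (z - s)))) - g z)
      \<le> (1 + norm z) ^ ?p * (LINT u|lborel. norm ((g (z - u /\<^sub>R r) - g z) * complex_of_real (kern u)))"
      using integral_norm_bound by (intro mult_left_mono) auto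
    also have "\<dots> = (LINT u|lborel. (1 + norm z) ^ ?p * norm ((g (z - u /\<^sub>R r) - g z) * complex_of_real (kern u)))"
      by simp
    also have "\<dots> \<le> (LINT u|lborel. e / 2 * kern u + (2 * G / d) / r * (B * wt u))"
    proof (rule integral_mono)
      show "integrable lborel (\<lambda>u. (1 + norm z) ^ ?p * norm ((g (z - u /\<^sub>R r) - g z) * complex_of_real (kern u)))"
        by (rule integrable_mult_right[OF integrable_norm[OF Bochner_Integration.integrable_diff[OF i1 i2, folded left_diff_distrib]]])
      show "integrable lborel (\<lambda>u::'a. e / 2 * kern u + (2 * G / d) / r * (B * wt u))"
        by (intro Bochner_Integration.integrable_add integrable_mult_right kern(3) integrable_wt_lborel)
      fix u :: 'a
      have nu: "norm (u /\<^sub>R r) = norm u / r" using r by (simp add: divide_inverse mult.commute)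
      have "norm u / r * (1 + norm u / r) ^ ?p \<le> norm u / r * (1 + norm u) ^ ?p"
        using r by (intro mult_left_mono power_mono) (auto simp: divide_le_eq mult_left_le_one_le mult_le_cancel_left1)
      also have "\<dots> = (norm u * (1 + norm u) ^ ?p) / r" by simp
      also have "\<dots> \<le> (1 + norm u) ^ (?p + 1) / r"
        using r by (intro divide_right_mono) (auto intro!: mult_right_mono simp: power_add mult.commute)
      finally have *: "norm u / r * (1 + norm u / r) ^ ?p \<le> (1 + norm u) ^ (?p + 1) / r" .
      have "(1 + norm z) ^ ?p * norm (g (z - u /\<^sub>R r) - g z) \<le> e / 2 + (2 * G / d) * ((1 + norm u) ^ (?p + 1) / r)"
        using est[of z "u /\<^sub>R r"] mult_left_mono[OF *, of "2 * G / d"] G(1) d(1) unfolding nu by simp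
      from mult_right_mono[OF this kern(2)[of u]]
      have "(1 + norm z) ^ ?p * norm ((g (z - u /\<^sub>R r) - g z) * complex_of_real (kern u))
         \<le> e / 2 * kern u + (2 * G / d) / r * ((1 + norm u) ^ (?p + 1) * kern u)"
        using kern(2)[of u] by (simp add: norm_mult distrib_right mult.assoc)
      also have "\<dots> \<le> e / 2 * kern u + (2 * G / d) / r * (B * wt u)"
        using B(2)[of u] G(1) d(1) r by (intro add_left_mono mult_left_mono) auto
      finally show "(1 + norm z) ^ ?p * norm ((g (z - u /\<^sub>R r) - g z) * complex_of_real (kern u)) \<le> \<dots>" .
    qed
    also have "\<dots> = e / 2 * (LINT u|lborel. kern u) + (2 * G / d) / r * (B * W)"
    proof -
      have "(LINT u|lborel. e / 2 * kern u + (2 * G / d) / r * (B * wt u))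
        = (LINT u|lborel. e / 2 * kern u) + (LINT u|lborel. (2 * G / d) / r * (B * wt (u :: 'a)))"
        by (intro Bochner_Integration.integral_add integrable_mult_right kern(3) integrable_wt_lborel)
      then show ?thesis by (simp add: W_def)
    qed
    also have "\<dots> \<le> e" using rB unfolding kern(4) by linarith
    finally show "norm ((LINT s|lborel. g s * of_real (r ^ DIM('a) * kern (r *\<^sub>R (z - s)))) - g z) \<le> e * wt z"
      unfolding le_wt_iff .
  qed
qed

lemma wt_scale_le:
  fixes a :: "'a::euclidean_space"
  assumes "r \<ge> 1" shows "wt (r *\<^sub>R a) \<le> wt a"
proof -
  have "1 * norm a \<le> r * norm a" using assms by (intro mult_right_mono) auto
  then have "(1 + norm a) ^ (DIM('a) + 2) \<le> (1 + norm (r *\<^sub>R a)) ^ (DIM('a) + 2)"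
    using assms by (intro power_mono) auto
  moreover have "0 < (1 + norm (r *\<^sub>R a)) ^ (DIM('a) + 2)" "0 < (1 + norm a) ^ (DIM('a) + 2)"
    by (intro zero_less_power add_pos_nonneg; simp)+
  ultimately show ?thesis
    unfolding wt_def by (intro divide_left_mono mult_pos_pos) auto
qed

lemma Cc_wt_bound:
  fixes g :: "'a::euclidean_space \<Rightarrow> complex"
  assumes "g \<in> Cc"
  obtains B where "\<And>x. norm (g x) \<le> B * wt x"
proof -
  have "(\<lambda>x. of_real ((1 + norm x) ^ (DIM('a) + 2)) * g x) \<in> Cc" by (intro Cc_mult_left assms continuous_intros)
  then obtain B where B: "\<And>x. norm (of_real ((1 + norm x) ^ (DIM('a) + 2)) * g x) \<le> B" by (rule Cc_bounded) blast
  have "(1 + norm x) ^ (DIM('a) + 2) * norm (g x) \<le> B" for x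
    using B[of x] unfolding norm_mult norm_of_real by (simp del: power_Suc power_add)
  then show thesis unfolding le_wt_iff[symmetric] by (rule that)
qed

lemma tbound_mono: "tbound M C \<Longrightarrow> C \<le> C' \<Longrightarrow> tbound M C'"
  unfolding tbound_def by (meson ennreal_leI order_trans)

text \<open>The kernel couples y and s, while Fubini wants a dominating product.
  \<open>wt_shift\<close> recentres the weight at x, and the price (1 + norm s)^(d+2) is harmless
  against g of compact support. Evenness of the kernel puts its centre at x - s.\<close>

lemma smoothed_cm_integral:
  fixes g :: "'a::euclidean_space \<Rightarrow> complex" and kern :: "'a \<Rightarrow> real"
  assumes \<nu>: "radon_cmeasure \<nu>" and tb: "tbound (fst \<nu>) C" and g: "g \<in> Cc" and r: "r \<ge> 1"
    and kern: "continuous_on UNIV kern" "\<And>y. kern y \<ge> 0" "\<And>y. kern (- y) = kern y" "\<And>y. kern y \<le> B * wt y"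
  shows "cm_integral \<nu> (\<lambda>y. LINT s|lborel. g s * of_real (r ^ DIM('a) * kern (r *\<^sub>R ((x - y) - s))))
      = (LINT s|lborel. g s * cm_integral \<nu> (\<lambda>y. of_real (r ^ DIM('a) * kern (r *\<^sub>R (y - (x - s))))))"
    and "integrable lborel (\<lambda>s. g s * cm_integral \<nu> (\<lambda>y. of_real (r ^ DIM('a) * kern (r *\<^sub>R (y - (x - s))))))"
proof -
  let ?p = "DIM('a) + 2"
  let ?F = "\<lambda>y s. g s * complex_of_real (r ^ DIM('a) * kern (r *\<^sub>R (y - (x - s))))"
  have B: "B \<ge> 0" using order_trans[OF kern(2) kern(4)[of 0]] wt_pos[of "0::'a"] by (simp add: zero_le_mult_iff)
  have sym: "kern (r *\<^sub>R ((x - y) - s)) = kern (r *\<^sub>R (y - (x - s)))" for y s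
    using kern(3)[of "r *\<^sub>R (y - (x - s))"] by (simp add: algebra_simps)
  have c: "continuous_on UNIV (\<lambda>p. ?F (fst p) (snd p))"
    by (intro continuous_intros Cc_compose_continuous[OF g] continuous_on_compose2[OF kern(1)]) auto
  have iu: "integrable (fst \<nu>) (\<lambda>y. r ^ DIM('a) * B * wt (y - x))"
    using tbound_wt_integral[where 'a='a] tb by (metis integrable_mult_right)
  have "(\<lambda>s. of_real ((1 + norm s) ^ ?p) * g s) \<in> Cc" by (intro Cc_mult_left g continuous_intros)
  from integrable_norm[OF Cc_integrable[OF loc_finite_lborel this]]
  have iv: "integrable lborel (\<lambda>s. norm (g s) * (1 + norm s) ^ ?p)"
    unfolding norm_mult norm_of_real by (simp add: mult.commute del: power_Suc power_add)
  have b: "norm (?F y s) \<le> (r ^ DIM('a) * B * wt (y - x)) * (norm (g s) * (1 + norm s) ^ ?p)" for y s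
  proof -
    have "kern (r *\<^sub>R (y - (x - s))) \<le> B * wt (r *\<^sub>R (y - (x - s)))" by (rule kern(4))
    also have "\<dots> \<le> B * wt (y - (x - s))" using B by (intro mult_left_mono wt_scale_le r)
    also have "\<dots> \<le> B * ((1 + norm (- s)) ^ ?p * wt (y - (x - s) + - s))" using B by (intro mult_left_mono wt_shift)
    finally have k: "kern (r *\<^sub>R (y - (x - s))) \<le> B * ((1 + norm s) ^ ?p * wt (y - x))" by (simp add: algebra_simps)
    have "norm (?F y s) = norm (g s) * (r ^ DIM('a) * kern (r *\<^sub>R (y - (x - s))))"
      unfolding norm_mult norm_of_real using r kern(2) by (simp add: abs_mult)
    also have "\<dots> \<le> norm (g s) * (r ^ DIM('a) * (B * ((1 + norm s) ^ ?p * wt (y - x))))"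
      using r by (intro mult_left_mono k) auto
    finally show ?thesis by (simp only: mult_ac)
  qed
  have u0: "0 \<le> r ^ DIM('a) * B * wt (y - x)" for y using r B by simp
  note Fub = cm_integral_Fubini[OF \<nu> loc_finite_lborel c iu iv b u0]
  show "cm_integral \<nu> (\<lambda>y. LINT s|lborel. g s * of_real (r ^ DIM('a) * kern (r *\<^sub>R ((x - y) - s))))
      = (LINT s|lborel. g s * cm_integral \<nu> (\<lambda>y. of_real (r ^ DIM('a) * kern (r *\<^sub>R (y - (x - s))))))"
    unfolding sym Fub(1) cm_integral_cmult ..
  show "integrable lborel (\<lambda>s. g s * cm_integral \<nu> (\<lambda>y. of_real (r ^ DIM('a) * kern (r *\<^sub>R (y - (x - s))))))"
    using Fub(2) unfolding cm_integral_cmult .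
qed

lemma norm_triangle_four: "norm (a - b) \<le> norm (a - a') + norm (a' - b') + norm (b - b')"
  for a :: "'a::real_normed_vector"
  using norm_triangle_ineq[of "a - a'" "a' - b"] norm_triangle_ineq[of "a' - b'" "b' - b"]
  by (simp add: norm_minus_commute)

text \<open>The Cauchy property is used because no candidate for the limit measure exists yet. The
  smoothed convolutions are averages over s of \<open>T n (x - s)\<close>, so they inherit uniform
  closeness in x at the price of the L1 norm of g.\<close>

lemma mconv_uniformly_Cauchy:
  fixes \<nu>s :: "nat \<Rightarrow> 'a::euclidean_space cmeasure"
  assumes rad: "\<And>n. radon_cmeasure (\<nu>s n)" and tb: "\<And>n. tbound (fst (\<nu>s n)) C"
    and conv: "\<And>\<eta>. \<eta> \<in> Cc_inf \<Longrightarrow>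
      uniformly_Cauchy_on UNIV (\<lambda>n t. cm_integral (\<nu>s n) (inv_fourier (\<lambda>x. cnj (echar (t \<bullet> x)) * \<eta> x)))"
    and g: "g \<in> Cc"
  shows "uniformly_Cauchy_on UNIV (\<lambda>n. mconv (\<nu>s n) g)"
proof (rule uniformly_Cauchy_onI)
  fix e :: real assume e: "e > 0"
  obtain kern :: "'a \<Rightarrow> real" where kern: "continuous_on UNIV kern" "\<And>y. kern y \<ge> 0" "\<And>y. kern (- y) = kern y"
    "integrable lborel kern" "(LINT y|lborel. kern y) = 1"
    and decay: "\<And>k. \<exists>B\<ge>0. \<forall>y. (1 + norm y) ^ k * kern y \<le> B * wt y"
    and test: "\<And>r. r > 0 \<Longrightarrow> \<exists>\<eta>\<in>Cc_inf. \<forall>t y. complex_of_real (r ^ DIM('a) * kern (r *\<^sub>R (y - t)))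
        = inv_fourier (\<lambda>x. cnj (echar (t \<bullet> x)) * \<eta> x) y"
    by (rule fourier_kernel) blast
  obtain K :: real where K: "K \<ge> 0"
    "\<And>(\<nu> :: 'a cmeasure) C (u :: 'a \<Rightarrow> complex) e t. radon_cmeasure \<nu> \<Longrightarrow> tbound (fst \<nu>) C \<Longrightarrow> u \<in> borel_measurable borel \<Longrightarrow>
       (\<And>y. norm (u y) \<le> e * wt (y - t)) \<Longrightarrow> integrable (fst \<nu>) u \<and> norm (cm_integral \<nu> u) \<le> e * (C * K)"
    by (rule cm_integral_wt_bound) blast
  have C: "C \<ge> 0" using tb[of 0] by (simp add: tbound_def)
  define I where "I = (LINT s|lborel. norm (g s))"
  have I: "I \<ge> 0" by (simp add: I_def)
  have CK: "C * K \<ge> 0" using C K(1) by simp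
  \<comment> \<open>Two smoothing errors and one difference of smoothed terms are each held to e /
    4. The added 1 in the denominators covers C K = 0 and I = 0.\<close>
  define e1 where "e1 = e / (4 * (C * K + 1))"
  define e2 where "e2 = e / (4 * (I + 1))"
  have e1: "e1 > 0" "e1 * (C * K) \<le> e / 4" using e CK unfolding e1_def
    by (simp, simp only: times_divide_eq_left, subst divide_le_eq) (auto simp: algebra_simps)
  have e2: "e2 > 0" "e2 * I \<le> e / 4" using e I unfolding e2_def
    by (simp, simp only: times_divide_eq_left, subst divide_le_eq) (auto simp: algebra_simps)
  define G where "G r z = (LINT s|lborel. g s * of_real (r ^ DIM('a) * kern (r *\<^sub>R (z - s))))" for r z
  obtain r where r: "r \<ge> 1" "\<And>z. norm (G r z - g z) \<le> e1 * wt z"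
    unfolding G_def using weighted_approximation[OF g e1(1) kern(1,2,4,5) decay] by blast
  obtain B where B: "\<And>y. kern y \<le> B * wt y" using decay[of 0] by auto
  define T where "T n t = cm_integral (\<nu>s n) (\<lambda>y. of_real (r ^ DIM('a) * kern (r *\<^sub>R (y - t))))" for n t
  \<comment> \<open>Once r is fixed, all translates of the dilated kernel come from modulations of
    one test function, so a single use of the hypothesis controls T at every point.\<close>
  obtain \<eta> where \<eta>: "\<eta> \<in> Cc_inf" "\<And>t y. complex_of_real (r ^ DIM('a) * kern (r *\<^sub>R (y - t)))
        = inv_fourier (\<lambda>x. cnj (echar (t \<bullet> x)) * \<eta> x) y"
    using test[of r] r(1) by auto
  have T: "uniformly_Cauchy_on UNIV T" unfolding T_def[abs_def] \<eta>(2) using conv[OF \<eta>(1)] by simp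
  then obtain N where N: "\<And>t m n. m \<ge> N \<Longrightarrow> n \<ge> N \<Longrightarrow> dist (T m t) (T n t) < e2"
    unfolding uniformly_Cauchy_on_def using e2(1) by blast
  have sm: "cm_integral (\<nu>s n) (\<lambda>y. G r (x - y)) = (LINT s|lborel. g s * T n (x - s))"
    "integrable lborel (\<lambda>s. g s * T n (x - s))" for n x
    unfolding G_def T_def using smoothed_cm_integral[OF rad tb g r(1) kern(1,2,3) B] by blast+
  have approx: "norm (mconv (\<nu>s n) g x - (LINT s|lborel. g s * T n (x - s))) \<le> e / 4" for n x
  proof -
    have cg: "continuous_on UNIV (\<lambda>y. g (x - y))" by (intro Cc_compose_continuous[OF g] continuous_intros)
    have gi: "integrable (fst (\<nu>s n)) (\<lambda>y. g (x - y))"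
      using Cc_integrable[OF radon_loc_finite[OF rad] Cc_reflect[OF Cc_translate[OF g, of "- x"]], of n] by simp
    have Gm: "(\<lambda>y. G r (x - y)) \<in> borel_measurable borel"
      unfolding G_def
    proof (rule lborel.borel_measurable_lebesgue_integral)
      have "continuous_on UNIV (\<lambda>p. g (snd p) * complex_of_real (r ^ DIM('a) * kern (r *\<^sub>R ((x - fst p) - snd p))))"
        by (intro continuous_intros Cc_compose_continuous[OF g] continuous_on_compose2[OF kern(1)]) auto
      from borel_measurable_continuous_pair(2)[OF this, of borel lborel]
      show "(\<lambda>(y, s). g s * complex_of_real (r ^ DIM('a) * kern (r *\<^sub>R ((x - y) - s)))) \<in> borel_measurable (borel \<Otimes>\<^sub>M lborel)"
        by simp
    qed
    \<comment> \<open>The error weight is centred at x, and the bound C K does not see the centre;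
      this is where uniformity in x is gained.\<close>
    have "norm (g (x - y) - G r (x - y)) \<le> e1 * wt (y - x)" for y
      using r(2)[of "x - y"] wt_minus[of "x - y"] by (simp add: norm_minus_commute)
    then have *: "integrable (fst (\<nu>s n)) (\<lambda>y. g (x - y) - G r (x - y)) \<and>
       norm (cm_integral (\<nu>s n) (\<lambda>y. g (x - y) - G r (x - y))) \<le> e1 * (C * K)"
      by (intro K(2)[OF rad tb, where t=x] borel_measurable_diff Gm borel_measurable_continuous_onI[OF cg])
    then have Gi: "integrable (fst (\<nu>s n)) (\<lambda>y. G r (x - y))"
      using Bochner_Integration.integrable_diff[OF gi, of "\<lambda>y. g (x - y) - G r (x - y)"] by simp
    have "mconv (\<nu>s n) g x - (LINT s|lborel. g s * T n (x - s)) = cm_integral (\<nu>s n) (\<lambda>y. g (x - y) - G r (x - y))"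
      unfolding mconv_def sm(1)[symmetric] by (rule cm_integral_diff[OF rad gi Gi, symmetric])
    then show ?thesis using *[THEN conjunct2] e1(2) by simp
  qed
  show "\<exists>M. \<forall>x\<in>UNIV. \<forall>m\<ge>M. \<forall>n\<ge>M. dist (mconv (\<nu>s m) g x) (mconv (\<nu>s n) g x) < e"
  proof (intro exI[of _ N] ballI allI impI)
    fix x m n assume mn: "N \<le> m" "N \<le> n"
    have "norm ((LINT s|lborel. g s * T m (x - s)) - (LINT s|lborel. g s * T n (x - s)))
      = norm (LINT s|lborel. g s * T m (x - s) - g s * T n (x - s))"
      using sm(2) by simp
    also have "\<dots> \<le> (LINT s|lborel. norm (g s * T m (x - s) - g s * T n (x - s)))" by (rule integral_norm_bound)
    also have "\<dots> \<le> (LINT s|lborel. norm (g s) * e2)"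
    proof (rule integral_mono)
      show "integrable lborel (\<lambda>s. norm (g s * T m (x - s) - g s * T n (x - s)))"
        by (intro integrable_norm Bochner_Integration.integrable_diff sm(2))
      show "integrable lborel (\<lambda>s. norm (g s) * e2)"
        by (intro integrable_mult_left integrable_norm Cc_integrable loc_finite_lborel g)
      show "norm (g s * T m (x - s) - g s * T n (x - s)) \<le> norm (g s) * e2" for s
        using N[OF mn, of "x - s"] unfolding right_diff_distrib[symmetric] norm_mult dist_norm
        by (intro mult_left_mono) auto
    qed
    also have "\<dots> \<le> e / 4" using e2(2) by (simp add: I_def mult.commute)
    finally have "norm ((LINT s|lborel. g s * T m (x - s)) - (LINT s|lborel. g s * T n (x - s))) \<le> e / 4" .
    then show "dist (mconv (\<nu>s m) g x) (mconv (\<nu>s n) g x) < e"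
      using approx[of m x] approx[of n x] e unfolding dist_norm
      by (intro le_less_trans[OF norm_triangle_four[of _ _ "LINT s|lborel. g s * T m (x - s)" "LINT s|lborel. g s * T n (x - s)"]]) linarith
  qed
qed

text \<open>The measure is built from the limits of the integrals alone. The uniform limits of the
  convolutions, known to exist by completeness, are identified with those of the new measure
  pointwise.\<close>

lemma uniform_limit_measure:
  fixes \<nu>s :: "nat \<Rightarrow> 'a::euclidean_space cmeasure"
  assumes rad: "\<And>n. radon_cmeasure (\<nu>s n)" and tb: "\<And>n. tbound (fst (\<nu>s n)) C"
    and cau: "\<And>g. g \<in> Cc \<Longrightarrow> uniformly_Cauchy_on UNIV (\<lambda>n. mconv (\<nu>s n) g)"
  obtains \<nu> C' where "radon_cmeasure \<nu>" "tbound (fst \<nu>) C'" "product_converges \<nu>s \<nu>"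
    "\<And>g. g \<in> Cc \<Longrightarrow> (\<lambda>n. cm_integral (\<nu>s n) g) \<longlonglongrightarrow> cm_integral \<nu> g"
proof -
  obtain K :: real where K: "K \<ge> 0"
    "\<And>(\<nu> :: 'a cmeasure) C (u :: 'a \<Rightarrow> complex) e t. radon_cmeasure \<nu> \<Longrightarrow> tbound (fst \<nu>) C \<Longrightarrow> u \<in> borel_measurable borel \<Longrightarrow>
       (\<And>y. norm (u y) \<le> e * wt (y - t)) \<Longrightarrow> integrable (fst \<nu>) u \<and> norm (cm_integral \<nu> u) \<le> e * (C * K)"
    by (rule cm_integral_wt_bound) blast
  have C: "C \<ge> 0" using tb[of 0] by (simp add: tbound_def)
  define L where "L g = lim (\<lambda>n. cm_integral (\<nu>s n) g)" for g :: "'a \<Rightarrow> complex"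
  have lim: "(\<lambda>n. cm_integral (\<nu>s n) g) \<longlonglongrightarrow> L g" if g: "g \<in> Cc" for g
  proof -
    \<comment> \<open>Evaluating the convolution with the reflected function at the origin returns
      the integral of g.\<close>
    have "Cauchy (\<lambda>n. mconv (\<nu>s n) (\<lambda>x. g (- x)) 0)"
      by (rule uniformly_Cauchy_imp_Cauchy[OF cau[OF Cc_reflect[OF g]]]) simp
    then have "convergent (\<lambda>n. cm_integral (\<nu>s n) g)"
      by (simp add: mconv_def Cauchy_convergent_iff)
    then show ?thesis unfolding L_def by (simp add: convergent_LIMSEQ_iff)
  qed
  \<comment> \<open>The centre t is left free: centred at 0 the bound gives continuity of the
    functional, centred at an arbitrary point it gives translation boundedness of the limit.\<close>
  have Lbound: "norm (L g) \<le> e * (C * K)" if g: "g \<in> Cc" and b: "\<And>y. norm (g y) \<le> e * wt (y - t)" for g e t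
    using lim[OF g] K(2)[OF rad tb Cc_measurable[OF g] b]
    by (intro Lim_norm_ubound[OF _ lim[OF g]] always_eventually allI) auto
  have int: "integrable (fst (\<nu>s n)) g" if "g \<in> Cc" for g n
    by (rule Cc_integrable[OF radon_loc_finite[OF rad] that])
  have "complex_functional L"
  proof
    show "L (\<lambda>x. f x + g x) = L f + L g" if "f \<in> Cc" "g \<in> Cc" for f g
    proof (rule LIMSEQ_unique[OF lim[OF Cc_add[OF that]]])
      show "(\<lambda>n. cm_integral (\<nu>s n) (\<lambda>x. f x + g x)) \<longlonglongrightarrow> L f + L g"
        using tendsto_add[OF lim[OF that(1)] lim[OF that(2)]] int that by (simp add: cm_integral_add[OF rad])
    qed
    show "L (\<lambda>x. c * f x) = c * L f" if "f \<in> Cc" for c f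
      by (rule LIMSEQ_unique[OF lim[OF Cc_cmult[OF that]]])
         (use tendsto_mult_left[OF lim[OF that], of c] in \<open>simp add: cm_integral_cmult\<close>)
    show "\<exists>C. \<forall>g\<in>Cc. (\<forall>x. norm (g x) \<le> u x) \<longrightarrow> norm (L g) \<le> C" if u: "u \<in> Cpos" for u
    proof -
      obtain B where B: "\<And>x. norm (complex_of_real (u x)) \<le> B * wt x" by (rule Cc_wt_bound[OF CposD(3)[OF u]]) blast
      have "norm (L g) \<le> B * (C * K)" if "g \<in> Cc" "\<forall>x. norm (g x) \<le> u x" for g
      proof (rule Lbound[OF that(1), where t=0])
        show "norm (g y) \<le> B * wt (y - 0)" for y using that(2)[rule_format, of y] B[of y] by (simp add: abs_le_iff)
      qed
      then show ?thesis by blast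
    qed
  qed
  from complex_riesz[OF this] obtain \<nu> where \<nu>: "radon_cmeasure \<nu>" "\<And>f. f \<in> Cc \<Longrightarrow> cm_integral \<nu> f = L f"
    "\<And>A f C. A \<in> sets borel \<Longrightarrow> f \<in> Cpos \<Longrightarrow> 0 \<le> C \<Longrightarrow> (\<And>x. indicator A x \<le> f x) \<Longrightarrow>
       (\<And>g. g \<in> Cc \<Longrightarrow> (\<And>x. norm (g x) \<le> f x) \<Longrightarrow> norm (L g) \<le> C) \<Longrightarrow>
       emeasure (fst \<nu>) A \<le> ennreal (4 * C)" by blast
  \<comment> \<open>The translated plateau is at most 1 and vanishes beyond distance 2 from t, where
    1 + norm (x - t) has reached 3. The further factor 4 is the one of
    \<open>complex_riesz\<close>.\<close>
  let ?c = "3 ^ (DIM('a) + 2) :: real"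
  have tb\<nu>: "tbound (fst \<nu>) (4 * (?c * (C * K)))"
    unfolding tbound_def
  proof (intro conjI allI)
    show "sets (fst \<nu>) = sets borel" using \<nu>(1) by (simp add: radon_cmeasure_def)
    show "0 \<le> 4 * (?c * (C * K))" using C K(1) by simp
    fix t :: 'a
    let ?f = "\<lambda>x. plateau 1 (x - t)"
    have fle: "?f x \<le> ?c * wt (x - t)" for x
      unfolding le_wt_iff
    proof (cases "norm (x - t) \<le> 2")
      case True
      then have "(1 + norm (x - t)) ^ (DIM('a) + 2) * ?f x \<le> ?c * 1"
        by (intro mult_mono power_mono) (auto simp: plateau_def)
      then show "(1 + norm (x - t)) ^ (DIM('a) + 2) * ?f x \<le> ?c" by simp
    qed (simp add: plateau_def)
    show "emeasure (fst \<nu>) (cball t 1) \<le> ennreal (4 * (?c * (C * K)))"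
    proof (rule \<nu>(3))
      show "?f \<in> Cpos"
      proof (rule CposI[of _ "2 + norm t"])
        show "continuous_on UNIV ?f" unfolding plateau_def by (intro continuous_intros)
        show "?f x = 0" if "norm x > 2 + norm t" for x
          using that norm_triangle_ineq2[of x t] by (simp add: plateau_def)
      qed (simp add: plateau_def)
      show "0 \<le> ?c * (C * K)" using C K(1) by simp
      show "indicator (cball t 1) x \<le> ?f x" for x
        by (auto simp: indicator_def plateau_def dist_norm norm_minus_commute)
      show "norm (L g) \<le> ?c * (C * K)" if "g \<in> Cc" "\<And>x. norm (g x) \<le> ?f x" for g
        by (rule Lbound[OF that(1)]) (rule order_trans[OF that(2) fle])
    qed simp
  qed
  have "product_converges \<nu>s \<nu>"
    unfolding product_converges_def
  proof
    fix g :: "'a \<Rightarrow> complex" assume g: "g \<in> Cc"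
    obtain l where l: "uniform_limit UNIV (\<lambda>n. mconv (\<nu>s n) g) l sequentially"
      using Cauchy_uniformly_convergent[OF cau[OF g]] by (auto simp: uniformly_convergent_on_def)
    have "l = mconv \<nu> g"
    proof
      fix x
      have gx: "(\<lambda>y. g (x - y)) \<in> Cc" using Cc_reflect[OF Cc_translate[OF g, of "- x"]] by simp
      have "(\<lambda>n. mconv (\<nu>s n) g x) \<longlonglongrightarrow> l x" by (rule tendsto_uniform_limitI[OF l]) simp
      moreover have "(\<lambda>n. mconv (\<nu>s n) g x) \<longlonglongrightarrow> mconv \<nu> g x"
        unfolding mconv_def \<nu>(2)[OF gx] by (rule lim[OF gx])
      ultimately show "l x = mconv \<nu> g x" by (rule LIMSEQ_unique)
    qed
    with l show "uniform_limit UNIV (\<lambda>n. mconv (\<nu>s n) g) (mconv \<nu> g) sequentially" by simp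
  qed
  moreover have "(\<lambda>n. cm_integral (\<nu>s n) g) \<longlonglongrightarrow> cm_integral \<nu> g" if "g \<in> Cc" for g
    using lim[OF that] \<nu>(2)[OF that] by simp
  ultimately show thesis using that[OF \<nu>(1) tb\<nu>] by blast
qed

text \<open>The extra factor 1 + norm y is the margin over the weight: outside the ball of radius R
  it makes u at most B / (1 + R) times the weight, so the cut-off error is small for all measures
  with the same constant simultaneously.\<close>

lemma vague_limit_extends:
  fixes \<nu>s :: "nat \<Rightarrow> 'a::euclidean_space cmeasure"
  assumes rad: "\<And>n. radon_cmeasure (\<nu>s n)" "radon_cmeasure \<nu>" and tb: "\<And>n. tbound (fst (\<nu>s n)) C" "tbound (fst \<nu>) C"
    and conv: "\<And>g. g \<in> Cc \<Longrightarrow> (\<lambda>n. cm_integral (\<nu>s n) g) \<longlonglongrightarrow> cm_integral \<nu> g"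
    and u: "continuous_on UNIV u" "\<And>y. (1 + norm y) * norm (u y) \<le> B * wt y"
  shows "(\<lambda>n. cm_integral (\<nu>s n) u) \<longlonglongrightarrow> cm_integral \<nu> u"
proof (rule LIMSEQ_I)
  fix e :: real assume e: "e > 0"
  obtain K :: real where K: "K \<ge> 0"
    "\<And>(\<nu> :: 'a cmeasure) C (u :: 'a \<Rightarrow> complex) e t. radon_cmeasure \<nu> \<Longrightarrow> tbound (fst \<nu>) C \<Longrightarrow> u \<in> borel_measurable borel \<Longrightarrow>
       (\<And>y. norm (u y) \<le> e * wt (y - t)) \<Longrightarrow> integrable (fst \<nu>) u \<and> norm (cm_integral \<nu> u) \<le> e * (C * K)"
    by (rule cm_integral_wt_bound) blast
  have C: "C \<ge> 0" using tb(2) by (simp add: tbound_def)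
  have "0 \<le> B * wt (0::'a)" by (rule order_trans[OF _ u(2)[of 0]]) simp
  then have B: "B \<ge> 0" using wt_pos[of "0::'a"] by (simp add: zero_le_mult_iff)
  define R where "R = 4 * B * (C * K) / e"
  have R: "R \<ge> 0" using B C K(1) e by (simp add: R_def)
  have small: "B / (1 + R) * (C * K) \<le> e / 4"
  proof -
    have "B * (C * K) = R * e / 4" using e by (simp add: R_def)
    also have "\<dots> \<le> (1 + R) * e / 4" using e by simp
    finally show ?thesis using R by (simp add: field_simps)
  qed
  define v where "v y = cutoff R y * u y" for y
  have v: "v \<in> Cc" unfolding v_def by (intro Cc_mult_right cutoff_Cc u)
  have um: "u \<in> borel_measurable borel" by (rule borel_measurable_continuous_onI[OF u(1)])
  have d: "norm (u y - v y) \<le> B / (1 + R) * wt (y - 0)" for y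
  proof (cases "norm y \<le> R")
    case True
    then show ?thesis using B R by (simp add: v_def cutoff_1)
  next
    case False
    have "1 - cutoff R y = of_real (1 - max 0 (min 1 (R + 1 - norm y)))" by (simp add: cutoff_def)
    then have le1: "norm (1 - cutoff R y) \<le> 1" by (simp only: norm_of_real)
    have "u y - v y = (1 - cutoff R y) * u y" by (simp add: v_def left_diff_distrib)
    then have "norm (u y - v y) = norm (1 - cutoff R y) * norm (u y)" by (simp only: norm_mult)
    also have "norm (1 - cutoff R y) * norm (u y) \<le> 1 * norm (u y)" using le1 by (intro mult_right_mono) auto
    also have "1 * norm (u y) \<le> B / (1 + R) * wt y"
    proof -
      have "(1 + R) * norm (u y) \<le> (1 + norm y) * norm (u y)" using False by (intro mult_right_mono) auto
      then have "(1 + R) * norm (u y) \<le> B * wt y" using u(2)[of y] by linarith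
      then show ?thesis using R by (simp add: field_simps)
    qed
    finally show ?thesis by simp
  qed
  have approx: "norm (cm_integral \<kappa> u - cm_integral \<kappa> v) \<le> e / 4" if "radon_cmeasure \<kappa>" "tbound (fst \<kappa>) C" for \<kappa> :: "'a cmeasure"
  proof -
    have *: "integrable (fst \<kappa>) (\<lambda>y. u y - v y) \<and> norm (cm_integral \<kappa> (\<lambda>y. u y - v y)) \<le> B / (1 + R) * (C * K)"
      by (rule K(2)[OF that _ d]) (intro borel_measurable_diff um Cc_measurable v)
    have vi: "integrable (fst \<kappa>) v" by (rule Cc_integrable[OF radon_loc_finite[OF that(1)] v])
    then have "integrable (fst \<kappa>) u"
      using Bochner_Integration.integrable_add[OF vi, of "\<lambda>y. u y - v y"] * by simp
    from order_trans[OF *[THEN conjunct2] small] show ?thesis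
      unfolding cm_integral_diff[OF that(1) \<open>integrable (fst \<kappa>) u\<close> vi] .
  qed
  obtain N where N: "\<And>n. n \<ge> N \<Longrightarrow> norm (cm_integral (\<nu>s n) v - cm_integral \<nu> v) < e / 4"
    using LIMSEQ_D[OF conv[OF v], of "e / 4"] e by auto
  show "\<exists>N. \<forall>n\<ge>N. norm (cm_integral (\<nu>s n) u - cm_integral \<nu> u) < e"
  proof (intro exI[of _ N] allI impI)
    fix n assume "n \<ge> N"
    then show "norm (cm_integral (\<nu>s n) u - cm_integral \<nu> u) < e"
      using N[of n] approx[OF rad(1) tb(1), of n] approx[OF rad(2) tb(2)] e
      by (intro le_less_trans[OF norm_triangle_four[of _ _ "cm_integral (\<nu>s n) v" "cm_integral \<nu> v"]]) linarith
  qed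
qed

section \<open>Square integrability of transforms and the main theorem\<close>

text \<open>The bound does not depend on the total mass of N, which makes it survive the exhaustion by balls.\<close>

lemma fourier_square_integral_finite_measure:
  fixes f :: "'a::euclidean_space \<Rightarrow> complex"
  assumes f: "f \<in> Cc"
  obtains D where "\<And>N :: 'a measure. finite_measure N \<Longrightarrow> tbound N C \<Longrightarrow> (LINT y|N. (norm (inv_fourier f y))\<^sup>2) \<le> D"
proof -
  obtain R where R: "R > 0" "\<And>x. norm x > R \<Longrightarrow> f x = 0" using CcE[OF f] by blast
  \<comment> \<open>A smooth substitute for the indicator of the support of f. The radius R + 1
    keeps it bounded below on the ball of radius R, since a bump vanishes at the edge of its own
    ball.\<close>
  define \<rho> where "\<rho> x = flat_exp 0 ((R + 1)\<^sup>2 - x \<bullet> x)" for x :: 'a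
  have \<rho>b: "(\<lambda>x. complex_of_real (\<rho> x)) = bump ((R + 1)\<^sup>2)" by (auto simp: \<rho>_def bump_def)
  have \<rho>C: "(\<lambda>x. complex_of_real (\<rho> x)) \<in> Cc_inf" unfolding \<rho>b by (rule bump_Cc_inf)
  have \<rho>0: "\<rho> x \<ge> 0" for x by (simp add: \<rho>_def flat_exp_nonneg)
  have \<rho>c: "continuous_on UNIV \<rho>"
    using continuous_on_Re[OF Cc_continuous[OF Cc_inf_Cc[OF \<rho>C], of UNIV]] by simp
  have \<rho>i: "integrable lborel \<rho>"
    using integrable_Re[OF Cc_integrable[OF loc_finite_lborel Cc_inf_Cc[OF \<rho>C]]] by simp
  define m where "m = flat_exp 0 ((R + 1)\<^sup>2 - R\<^sup>2)"
  have pos: "(R + 1)\<^sup>2 - R\<^sup>2 > 0" using R(1) by (simp add: power2_eq_square algebra_simps)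
  have m: "m > 0" using pos by (simp add: m_def flat_exp_def)
  have \<rho>m: "\<rho> x \<ge> m" if "norm x \<le> R" for x
  proof -
    have "x \<bullet> x \<le> R\<^sup>2" using that power_mono[of "norm x" R 2] by (simp add: power2_norm_eq_inner)
    then have le: "(R + 1)\<^sup>2 - R\<^sup>2 \<le> (R + 1)\<^sup>2 - x \<bullet> x" by simp
    then have "exp (1 / ((R + 1)\<^sup>2 - x \<bullet> x)) \<le> exp (1 / ((R + 1)\<^sup>2 - R\<^sup>2))" using pos by (simp add: frac_le)
    then show ?thesis using pos le unfolding \<rho>_def m_def flat_exp_def by (simp add: frac_le)
  qed
  \<comment> \<open>Unlike the transform of f, the transform of the smooth \<rho> is dominated by
    the integrable weight.\<close>
  define h where "h = inv_fourier (\<lambda>x. complex_of_real (\<rho> x))"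
  obtain B where B: "B \<ge> 0" "\<And>y. norm (h y) \<le> B * wt y"
    using inv_fourier_wt_bound[OF \<rho>C, of 0] unfolding h_def by auto
  obtain K :: real where K: "K \<ge> 0"
    "\<And>(M :: 'a measure) C t. tbound M C \<Longrightarrow> integrable M (\<lambda>y. wt (y - t))"
    "\<And>(M :: 'a measure) C t. tbound M C \<Longrightarrow> (LINT y|M. wt (y - t)) \<le> C * K"
    using tbound_wt_integral by blast
  define I where "I = (LINT x|lborel. norm (f x))"
  have fi: "integrable lborel (\<lambda>x. norm (f x))" by (intro integrable_norm Cc_integrable loc_finite_lborel f)
  have f2: "integrable lborel (\<lambda>x. (norm (f x))\<^sup>2)"
    using integrable_norm[OF Cc_integrable[OF loc_finite_lborel Cc_mult_left[OF f Cc_continuous[OF f]]]]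
    by (simp add: norm_mult power2_eq_square)
  define J where "J = (LINT x|lborel. (norm (f x))\<^sup>2)"
  \<comment> \<open>The Schur bound of the kernel h (y - y'), raised to at least 1 so that it may be
    divided by.\<close>
  define s where "s = max 1 (B * (C * K))"
  have s: "s > 0" "B * (C * K) \<le> s" by (auto simp: s_def)
  show thesis
  proof (rule that[of "s / m * J"])
    fix N :: "'a measure" assume fin: "finite_measure N" and tb: "tbound N C"
    interpret N: finite_measure N by fact
    have sN: "sets N = sets borel" using tb by (simp add: tbound_def)
    have C: "C \<ge> 0" using tb by (simp add: tbound_def)
    note sf = N.sigma_finite_measure_axioms lborel.sigma_finite_measure_axioms
    define a where "a = inv_fourier f"
    have ac: "continuous_on UNIV a" unfolding a_def by (rule inv_fourier_continuous[OF f])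
    have aI: "norm (a y) \<le> I" for y unfolding a_def I_def by (rule inv_fourier_bound)
    have bi: "integrable N g" if "continuous_on UNIV g" "\<And>y. norm (g y) \<le> b" for g :: "'a \<Rightarrow> 'e::{banach,second_countable_topology}" and b
      using that borel_measurable_continuous_onI[OF that(1)] sN
      by (intro N.integrable_const_bound[of _ b]) (auto cong: measurable_cong_sets)
    have ai: "integrable N (\<lambda>y. norm (a y))" using aI by (intro bi[of _ I] continuous_intros ac) auto
    have a2i: "integrable N (\<lambda>y. (norm (a y))\<^sup>2)"
      using aI by (intro bi[of _ "I\<^sup>2"] continuous_intros ac) (auto intro: power_mono)
    define A where "A = (LINT y|N. (norm (a y))\<^sup>2)"
    \<comment> \<open>The adjoint transform, applied to the conjugate of the transform of f. Pairing
      it with f returns A, so A can be estimated through the size of G on the support of f.\<close>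
    define G where "G x = (LINT y|N. cnj (a y) * echar (x \<bullet> y))" for x
    have Gb: "norm (G x) \<le> (LINT y|N. norm (a y))" for x
      unfolding G_def using integral_norm_bound[of N "\<lambda>y. cnj (a y) * echar (x \<bullet> y)"] by (simp add: norm_mult)
    define G0 where "G0 = (LINT y|N. norm (a y))"
    have G00: "G0 \<ge> 0" by (simp add: G0_def)
    have Gm: "G \<in> borel_measurable borel"
      unfolding G_def
    proof (rule N.borel_measurable_lebesgue_integral)
      have "continuous_on UNIV (\<lambda>p::'a \<times> 'a. cnj (a (snd p)) * echar (fst p \<bullet> snd p))"
        by (intro continuous_intros continuous_on_compose2[OF ac]) auto
      from borel_measurable_continuous_pair(2)[OF this refl sN]
      show "(\<lambda>(x, y). cnj (a y) * echar (x \<bullet> y)) \<in> borel_measurable (borel \<Otimes>\<^sub>M N)" .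
    qed
    have Gi: "integrable lborel (\<lambda>x. c x * G x)" if "integrable lborel c" for c
    proof (rule Bochner_Integration.integrable_bound[OF integrable_mult_right[OF integrable_norm[OF that], of G0]])
      show "(\<lambda>x. c x * G x) \<in> borel_measurable lborel" using borel_measurable_integrable[OF that] Gm by measurable
      show "AE x in lborel. norm (c x * G x) \<le> norm (G0 * norm (c x))"
        using mult_left_mono[OF Gb[folded G0_def] norm_ge_zero, of "c _"] G00
        by (intro AE_I2) (simp add: norm_mult abs_mult mult.commute)
    qed
    have dual: "complex_of_real A = (LINT x|lborel. f x * G x)"
    proof -
      have "complex_of_real A = (LINT y|N. complex_of_real ((norm (a y))\<^sup>2))"
        unfolding A_def by (rule integral_complex_of_real[symmetric])
      also have "\<dots> = (LINT y|N. LINT x|lborel. cnj (a y) * (f x * echar (x \<bullet> y)))"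
      proof (intro Bochner_Integration.integral_cong refl)
        fix y
        have "complex_of_real ((norm (a y))\<^sup>2) = cnj (a y) * a y"
          using complex_norm_square[of "a y"] by (simp only: mult.commute)
        then show "complex_of_real ((norm (a y))\<^sup>2) = (LINT x|lborel. cnj (a y) * (f x * echar (x \<bullet> y)))"
          by (simp only: integral_mult_right_zero a_def inv_fourier_echar)
      qed
      also have "\<dots> = (LINT x|lborel. LINT y|N. cnj (a y) * (f x * echar (x \<bullet> y)))"
      proof (rule Fubini_dominated(1)[OF sf _ ai fi])
        have "continuous_on UNIV (\<lambda>p::'a \<times> 'a. cnj (a (fst p)) * (f (snd p) * echar (snd p \<bullet> fst p)))"
          by (intro continuous_intros continuous_on_compose2[OF ac] Cc_compose_continuous[OF f]) auto
        from borel_measurable_continuous_pair(2)[OF this sN, of lborel]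
        show "(\<lambda>(y, x). cnj (a y) * (f x * echar (x \<bullet> y))) \<in> borel_measurable (N \<Otimes>\<^sub>M lborel)" by simp
      qed (simp add: norm_mult)
      also have "\<dots> = (LINT x|lborel. f x * G x)"
        unfolding G_def by (simp add: mult.left_commute)
      finally show ?thesis .
    qed
    \<comment> \<open>With the smooth weight \<rho> instead of an indicator, expanding the square of
      G produces a quadratic form over N in the transform of f, whose kernel is h (y - y').\<close>
    define E where "E = (LINT x|lborel. \<rho> x * (norm (G x))\<^sup>2)"
    have Ei: "integrable lborel (\<lambda>x. \<rho> x * (norm (G x))\<^sup>2)"
    proof (rule Bochner_Integration.integrable_bound[OF integrable_mult_right[OF \<rho>i, of "G0\<^sup>2"]])
      show "(\<lambda>x. \<rho> x * (norm (G x))\<^sup>2) \<in> borel_measurable lborel"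
        using borel_measurable_integrable[OF \<rho>i] Gm by measurable
      show "AE x in lborel. norm (\<rho> x * (norm (G x))\<^sup>2) \<le> norm (G0\<^sup>2 * \<rho> x)"
        using Gb \<rho>0 by (intro AE_I2) (auto simp: abs_mult G0_def mult.commute intro!: mult_left_mono power_mono)
    qed
    define H where "H y = (LINT y'|N. a y' * h (y - y'))" for y
    have hc: "continuous_on UNIV h" unfolding h_def by (rule inv_fourier_continuous[OF Cc_inf_Cc[OF \<rho>C]])
    have H: "(LINT x|lborel. complex_of_real (\<rho> x) * cnj (G x) * echar (x \<bullet> y)) = H y" for y
    proof -
      have "(LINT x|lborel. complex_of_real (\<rho> x) * cnj (G x) * echar (x \<bullet> y))
        = (LINT x|lborel. LINT y'|N. complex_of_real (\<rho> x) * echar (x \<bullet> y) * (a y' * cnj (echar (x \<bullet> y'))))"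
      proof (intro Bochner_Integration.integral_cong refl)
        fix x
        have "cnj (G x) = (LINT y'|N. cnj (cnj (a y') * echar (x \<bullet> y')))" unfolding G_def by (simp del: complex_cnj_mult)
        then show "complex_of_real (\<rho> x) * cnj (G x) * echar (x \<bullet> y)
          = (LINT y'|N. complex_of_real (\<rho> x) * echar (x \<bullet> y) * (a y' * cnj (echar (x \<bullet> y'))))" by simp
      qed
      also have "\<dots> = (LINT y'|N. LINT x|lborel. complex_of_real (\<rho> x) * echar (x \<bullet> y) * (a y' * cnj (echar (x \<bullet> y'))))"
      proof (rule Fubini_dominated(1)[OF sf(2,1) _ \<rho>i ai])
        have "continuous_on UNIV (\<lambda>p::'a \<times> 'a. complex_of_real (\<rho> (fst p)) * echar (fst p \<bullet> y) * (a (snd p) * cnj (echar (fst p \<bullet> snd p))))"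
          by (intro continuous_intros continuous_on_compose2[OF ac] continuous_on_compose2[OF \<rho>c]) auto
        from borel_measurable_continuous_pair(2)[OF this _ sN, of lborel]
        show "(\<lambda>(x, y'). complex_of_real (\<rho> x) * echar (x \<bullet> y) * (a y' * cnj (echar (x \<bullet> y')))) \<in> borel_measurable (lborel \<Otimes>\<^sub>M N)" by simp
      qed (simp add: norm_mult \<rho>0)
      also have "\<dots> = H y"
        unfolding H_def
      proof (intro Bochner_Integration.integral_cong refl)
        fix y'
        have "complex_of_real (\<rho> x) * echar (x \<bullet> y) * (a y' * cnj (echar (x \<bullet> y'))) = a y' * (complex_of_real (\<rho> x) * echar (x \<bullet> (y - y')))" for x
          by (simp add: inner_diff_right echar_diff mult_ac)
        then show "(LINT x|lborel. complex_of_real (\<rho> x) * echar (x \<bullet> y) * (a y' * cnj (echar (x \<bullet> y')))) = a y' * h (y - y')"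
          by (simp only: h_def inv_fourier_echar integral_mult_right_zero)
      qed
      finally show ?thesis .
    qed
    have E_eq: "complex_of_real E = (LINT y|N. cnj (a y) * H y)"
    proof -
      have "complex_of_real E = (LINT x|lborel. complex_of_real (\<rho> x * (norm (G x))\<^sup>2))"
        unfolding E_def by (rule integral_complex_of_real[symmetric])
      also have "\<dots> = (LINT x|lborel. LINT y|N. complex_of_real (\<rho> x) * cnj (G x) * (cnj (a y) * echar (x \<bullet> y)))"
      proof (intro Bochner_Integration.integral_cong refl)
        fix x
        have "complex_of_real (\<rho> x * (norm (G x))\<^sup>2) = complex_of_real (\<rho> x) * cnj (G x) * G x"
          by (simp only: of_real_mult complex_norm_square mult_ac)
        then show "complex_of_real (\<rho> x * (norm (G x))\<^sup>2) = (LINT y|N. complex_of_real (\<rho> x) * cnj (G x) * (cnj (a y) * echar (x \<bullet> y)))"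
          by (simp only: G_def integral_mult_right_zero)
      qed
      also have "\<dots> = (LINT y|N. LINT x|lborel. complex_of_real (\<rho> x) * cnj (G x) * (cnj (a y) * echar (x \<bullet> y)))"
      proof (rule Fubini_dominated(1)[OF sf(2,1) _ integrable_mult_right[OF \<rho>i, of G0] ai])
        have c: "continuous_on UNIV (\<lambda>p::'a \<times> 'a. complex_of_real (\<rho> (fst p)) * (cnj (a (snd p)) * echar (fst p \<bullet> snd p)))"
          by (intro continuous_intros continuous_on_compose2[OF ac] continuous_on_compose2[OF \<rho>c]) auto
        have "(\<lambda>p. cnj (G (fst p)) * (complex_of_real (\<rho> (fst p)) * (cnj (a (snd p)) * echar (fst p \<bullet> snd p)))) \<in> borel_measurable (lborel \<Otimes>\<^sub>M N)"
        proof (rule borel_measurable_times)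
          have "(\<lambda>x. cnj (G x)) \<in> borel_measurable borel"
            by (rule measurable_compose[OF Gm borel_measurable_continuous_onI[OF continuous_on_cnj[OF continuous_on_id]]])
          then have "(\<lambda>x. cnj (G x)) \<in> borel_measurable lborel" by simp
          from measurable_compose[OF measurable_fst this]
          show "(\<lambda>p. cnj (G (fst p))) \<in> borel_measurable (lborel \<Otimes>\<^sub>M N)" .
          show "(\<lambda>p. complex_of_real (\<rho> (fst p)) * (cnj (a (snd p)) * echar (fst p \<bullet> snd p))) \<in> borel_measurable (lborel \<Otimes>\<^sub>M N)"
            by (rule borel_measurable_continuous_pair(1)[OF c sets_lborel sN])
        qed
        then show "(\<lambda>(x, y). complex_of_real (\<rho> x) * cnj (G x) * (cnj (a y) * echar (x \<bullet> y))) \<in> borel_measurable (lborel \<Otimes>\<^sub>M N)"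
          by (simp add: case_prod_beta' mult_ac)
        show "norm (complex_of_real (\<rho> x) * cnj (G x) * (cnj (a y) * echar (x \<bullet> y))) \<le> G0 * \<rho> x * norm (a y)" for x y
          using mult_right_mono[OF mult_left_mono[OF Gb[of x, folded G0_def] \<rho>0[of x]] norm_ge_zero[of "a y"]] \<rho>0[of x]
          by (simp add: norm_mult mult_ac)
      qed
      also have "\<dots> = (LINT y|N. cnj (a y) * H y)"
      proof (intro Bochner_Integration.integral_cong refl)
        fix y
        have "complex_of_real (\<rho> x) * cnj (G x) * (cnj (a y) * echar (x \<bullet> y)) = cnj (a y) * (complex_of_real (\<rho> x) * cnj (G x) * echar (x \<bullet> y))" for x
          by (simp only: mult_ac)
        then show "(LINT x|lborel. complex_of_real (\<rho> x) * cnj (G x) * (cnj (a y) * echar (x \<bullet> y))) = cnj (a y) * H y"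
          by (simp only: integral_mult_right_zero H)
      qed
      finally show ?thesis .
    qed
    \<comment> \<open>Schur's test: the product of the two values of the transform is split into
      half the sum of their squares, and the weight wt (y' - y) integrates in either variable to at
      most C K. The total mass of N does not enter.\<close>
    have E_le: "E \<le> B * (C * K) * A"
    proof -
      let ?w = "\<lambda>y y'. (norm (a y'))\<^sup>2 * wt (y' - y)"
      have wb: "norm (?w y y') \<le> I\<^sup>2" for y y'
        using mult_mono[OF power_mono[OF aI[of y'], of 2] wt_le_1[of "y' - y"]] by (simp add: abs_mult)
      have swap: "(LINT y|N. LINT y'|N. ?w y y') = (LINT y'|N. LINT y|N. ?w y y')" "integrable N (\<lambda>y. LINT y'|N. ?w y y')"
      proof -
        have "continuous_on UNIV (\<lambda>p::'a \<times> 'a. (norm (a (snd p)))\<^sup>2 * wt (snd p - fst p))"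
          by (intro continuous_intros continuous_on_compose2[OF ac]) auto
        note mm = borel_measurable_continuous_pair(2)[OF this sN sN]
        have b: "norm (?w y y') \<le> I\<^sup>2 * 1" for y y' using wb by simp
        note F = Fubini_dominated[OF sf(1) sf(1) mm N.integrable_const N.integrable_const b]
        show "(LINT y|N. LINT y'|N. ?w y y') = (LINT y'|N. LINT y|N. ?w y y')" "integrable N (\<lambda>y. LINT y'|N. ?w y y')"
          using F(1,2) by simp_all
      qed
      have wi: "integrable N (\<lambda>y'. wt (y' - y))" for y by (rule K(2)[OF tb])
      have w2i: "integrable N (\<lambda>y'. ?w y y')" for y
        by (rule bi[OF _ wb]) (intro continuous_intros ac)
      have Hb: "norm (cnj (a y) * H y) \<le> B / 2 * ((C * K) * (norm (a y))\<^sup>2 + (LINT y'|N. ?w y y'))" for y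
      proof -
        have "norm (cnj (a y) * H y) = norm (LINT y'|N. cnj (a y) * (a y' * h (y - y')))" by (simp add: H_def)
        also have "\<dots> \<le> (LINT y'|N. norm (cnj (a y) * (a y' * h (y - y'))))" by (rule integral_norm_bound)
        also have "\<dots> \<le> (LINT y'|N. B / 2 * ((norm (a y))\<^sup>2 * wt (y' - y) + ?w y y'))"
        proof (rule integral_mono)
          have hb: "norm (h z) \<le> B" for z using B(2)[of z] mult_left_mono[OF wt_le_1 B(1), of z] by simp
          show "integrable N (\<lambda>y'. norm (cnj (a y) * (a y' * h (y - y'))))"
          proof (rule bi[of _ "I * (I * B)"])
            show "continuous_on UNIV (\<lambda>y'. norm (cnj (a y) * (a y' * h (y - y'))))"
              by (intro continuous_intros ac continuous_on_compose2[OF hc]) auto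
            show "norm (norm (cnj (a y) * (a y' * h (y - y')))) \<le> I * (I * B)" for y'
              using aI hb order_trans[OF norm_ge_zero aI] by (auto simp: norm_mult intro!: mult_mono)
          qed
          show "integrable N (\<lambda>y'. B / 2 * ((norm (a y))\<^sup>2 * wt (y' - y) + ?w y y'))"
            by (intro integrable_mult_right Bochner_Integration.integrable_add wi w2i)
          fix y'
          have "norm (a y) * norm (a y') \<le> ((norm (a y))\<^sup>2 + (norm (a y'))\<^sup>2) / 2"
            using sum_squares_bound[of "norm (a y)" "norm (a y')"] by simp
          then have "(norm (a y) * norm (a y')) * norm (h (y - y')) \<le> ((norm (a y))\<^sup>2 + (norm (a y'))\<^sup>2) / 2 * (B * wt (y - y'))"
            using B(2)[of "y - y'"] by (intro mult_mono) auto
          moreover have "wt (y - y') = wt (y' - y)" using wt_minus[of "y - y'"] by simp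
          ultimately show "norm (cnj (a y) * (a y' * h (y - y'))) \<le> B / 2 * ((norm (a y))\<^sup>2 * wt (y' - y) + ?w y y')"
            by (simp add: norm_mult field_simps)
        qed
        also have "\<dots> = B / 2 * ((norm (a y))\<^sup>2 * (LINT y'|N. wt (y' - y)) + (LINT y'|N. ?w y y'))"
          using wi w2i by simp
        also have "\<dots> \<le> B / 2 * ((C * K) * (norm (a y))\<^sup>2 + (LINT y'|N. ?w y y'))"
          using B(1) mult_left_mono[OF K(3)[OF tb, of y], of "(norm (a y))\<^sup>2"] by (intro mult_left_mono) (auto simp: mult.commute)
        finally show ?thesis .
      qed
      have "E \<le> norm (complex_of_real E)" by simp
      also have "\<dots> \<le> (LINT y|N. norm (cnj (a y) * H y))" unfolding E_eq by (rule integral_norm_bound)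
      also have "\<dots> \<le> (LINT y|N. B / 2 * ((C * K) * (norm (a y))\<^sup>2 + (LINT y'|N. ?w y y')))"
      proof (rule Bochner_Integration.integral_mono')
        show "integrable N (\<lambda>y. B / 2 * ((C * K) * (norm (a y))\<^sup>2 + (LINT y'|N. ?w y y')))"
          by (intro integrable_mult_right Bochner_Integration.integrable_add a2i swap(2))
      qed (rule Hb, rule order_trans[OF norm_ge_zero Hb])
      also have "\<dots> = B / 2 * ((C * K) * A + (LINT y|N. LINT y'|N. ?w y y'))"
        using a2i swap(2) by (simp add: A_def)
      also have "(LINT y|N. LINT y'|N. ?w y y') \<le> (C * K) * A"
      proof -
        have "(LINT y'|N. LINT y|N. ?w y y') \<le> (LINT y'|N. (C * K) * (norm (a y'))\<^sup>2)"
        proof (rule Bochner_Integration.integral_mono')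
          show "integrable N (\<lambda>y'. (C * K) * (norm (a y'))\<^sup>2)" by (intro integrable_mult_right a2i)
          fix y'
          have "(LINT y|N. ?w y y') = (norm (a y'))\<^sup>2 * (LINT y|N. wt (y - y'))"
            using wt_minus[of "_ - y'"] by simp
          also have "\<dots> \<le> (norm (a y'))\<^sup>2 * (C * K)" by (intro mult_left_mono K(3)[OF tb]) auto
          finally show "(LINT y|N. ?w y y') \<le> (C * K) * (norm (a y'))\<^sup>2" by (simp add: mult.commute)
          show "0 \<le> (C * K) * (norm (a y'))\<^sup>2" using C K(1) by simp
        qed
        then show ?thesis unfolding swap(1) by (simp add: A_def)
      qed
      then have "B / 2 * ((C * K) * A + (LINT y|N. LINT y'|N. ?w y y')) \<le> B / 2 * ((C * K) * A + (C * K) * A)"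
        using B(1) by (intro mult_left_mono add_left_mono) auto
      also have "\<dots> = B * (C * K) * A" by simp
      finally show ?thesis .
    qed
    have A0: "A \<ge> 0" by (simp add: A_def)
    have "A = norm (complex_of_real A)" using A0 by simp
    also have "\<dots> \<le> (LINT x|lborel. norm (f x * G x))" unfolding dual by (rule integral_norm_bound)
    \<comment> \<open>The weighted inequality between geometric and arithmetic mean, with m \<le>
      \<rho> x on the support of f. The parameter s / m is balanced so that the second term becomes
      A / 2 by the bound for E.\<close>
    also have "\<dots> \<le> (LINT x|lborel. s / (2 * m) * (norm (f x))\<^sup>2 + 1 / (2 * s) * (\<rho> x * (norm (G x))\<^sup>2))"
    proof (rule integral_mono)
      show "integrable lborel (\<lambda>x. norm (f x * G x))"
        by (intro integrable_norm Gi Cc_integrable loc_finite_lborel f)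
      show "integrable lborel (\<lambda>x. s / (2 * m) * (norm (f x))\<^sup>2 + 1 / (2 * s) * (\<rho> x * (norm (G x))\<^sup>2))"
        by (intro Bochner_Integration.integrable_add integrable_mult_right f2 Ei)
      fix x
      show "norm (f x * G x) \<le> s / (2 * m) * (norm (f x))\<^sup>2 + 1 / (2 * s) * (\<rho> x * (norm (G x))\<^sup>2)"
      proof (cases "norm x \<le> R")
        case True
        let ?a = "sqrt (s / m) * norm (f x)" and ?b = "sqrt (m / s) * norm (G x)"
        have "2 * (?a * ?b) \<le> ?a\<^sup>2 + ?b\<^sup>2" using sum_squares_bound[of ?a ?b] by simp
        moreover have "?a * ?b = norm (f x) * norm (G x)"
          using s(1) m by (simp add: real_sqrt_mult[symmetric] real_sqrt_divide)
        moreover have "?a\<^sup>2 = s / m * (norm (f x))\<^sup>2" "?b\<^sup>2 = m / s * (norm (G x))\<^sup>2"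
          using s(1) m by (simp_all add: power_mult_distrib)
        moreover have "m / s * (norm (G x))\<^sup>2 \<le> \<rho> x / s * (norm (G x))\<^sup>2"
          using \<rho>m[OF True] s(1) by (intro mult_right_mono divide_right_mono) auto
        ultimately have "2 * (norm (f x) * norm (G x)) \<le> s / m * (norm (f x))\<^sup>2 + \<rho> x / s * (norm (G x))\<^sup>2" by linarith
        moreover have "s / (2 * m) * (norm (f x))\<^sup>2 = (s / m * (norm (f x))\<^sup>2) / 2"
          "1 / (2 * s) * (\<rho> x * (norm (G x))\<^sup>2) = (\<rho> x / s * (norm (G x))\<^sup>2) / 2" by simp_all
        moreover have "p \<le> q + r" if "2 * p \<le> X + Y" "q = X / 2" "r = Y / 2" for p q r X Y :: real
          using that by simp
        ultimately show ?thesis unfolding norm_mult by blast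
      next
        case False
        then show ?thesis using R(2)[of x] \<rho>0[of x] s(1) by simp
      qed
    qed
    also have "\<dots> = s / (2 * m) * J + 1 / (2 * s) * E"
    proof -
      have "(LINT x|lborel. s / (2 * m) * (norm (f x))\<^sup>2 + 1 / (2 * s) * (\<rho> x * (norm (G x))\<^sup>2))
        = (LINT x|lborel. s / (2 * m) * (norm (f x))\<^sup>2) + (LINT x|lborel. 1 / (2 * s) * (\<rho> x * (norm (G x))\<^sup>2))"
        by (intro Bochner_Integration.integral_add integrable_mult_right f2 Ei)
      then show ?thesis by (simp only: integral_mult_right_zero J_def E_def)
    qed
    also have "\<dots> \<le> s / (2 * m) * J + 1 / (2 * s) * (s * A)"
      using E_le mult_right_mono[OF s(2) A0] s(1) by (intro add_left_mono mult_left_mono) auto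
    also have "\<dots> = s / (2 * m) * J + A / 2" using s(1) by simp
    \<comment> \<open>A is an honest finite integral because N is finite, so half of it can be
      absorbed on the left; the remaining bound contains only s, m and J.\<close>
    finally have "A \<le> s / m * J" using m by (simp add: field_simps)
    then show "(LINT y|N. (norm (inv_fourier f y))\<^sup>2) \<le> s / m * J" by (simp add: A_def a_def)
  qed
qed

text \<open>Restrictions of M to balls are finite and inherit the constant C, hence share one bound
  D; monotone convergence passes it to M.\<close>

lemma fourier_square_integrable:
  fixes f :: "'a::euclidean_space \<Rightarrow> complex"
  assumes f: "f \<in> Cc" and tb: "tbound M C"
  shows "integrable M (\<lambda>y. (norm (inv_fourier f y))\<^sup>2)"
proof -
  obtain D where D: "\<And>N :: 'a measure. finite_measure N \<Longrightarrow> tbound N C \<Longrightarrow> (LINT y|N. (norm (inv_fourier f y))\<^sup>2) \<le> D"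
    using fourier_square_integral_finite_measure[OF f, of C] by blast
  have sM: "sets M = sets borel" using tb by (simp add: tbound_def)
  have cont: "continuous_on UNIV (\<lambda>y. (norm (inv_fourier f y))\<^sup>2)"
    by (intro continuous_intros inv_fourier_continuous f)
  then have mb: "(\<lambda>y. (norm (inv_fourier f y))\<^sup>2) \<in> borel_measurable borel" by (rule borel_measurable_continuous_onI)
  then have m: "(\<lambda>y. (norm (inv_fourier f y))\<^sup>2) \<in> borel_measurable M" using sM by (simp cong: measurable_cong_sets)
  define u where "u y = ennreal ((norm (inv_fourier f y))\<^sup>2)" for y
  have um: "u \<in> borel_measurable M" unfolding u_def using m by measurable
  define I where "I = (LINT x|lborel. norm (f x))"
  have bound: "(\<integral>\<^sup>+y. indicator (cball 0 (real q)) y * u y \<partial>M) \<le> ennreal D" for q :: nat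
  proof -
    define N where "N = density M (indicator (cball 0 (real q)))"
    have sN: "sets N = sets borel" by (simp add: N_def sM)
    have im: "indicator (cball 0 (real q)) \<in> borel_measurable M" using sM by (intro borel_measurable_indicator) simp
    have eN: "emeasure N A = emeasure M (cball 0 (real q) \<inter> A)" if "A \<in> sets borel" for A
      unfolding N_def using that sM by (subst emeasure_restricted) auto
    have "emeasure N (space N) \<noteq> \<infinity>"
      using eN[of UNIV] loc_finite_compact[OF tbound_loc_finite[OF tb], of "cball 0 (real q)"] sets_eq_imp_space_eq[OF sN]
      by (simp add: less_top)
    then have fin: "finite_measure N" by (rule finite_measureI)
    have tbN: "tbound N C"
      unfolding tbound_def
    proof (intro conjI allI sN)
      show "0 \<le> C" using tb by (simp add: tbound_def)
      fix t
      have "emeasure N (cball t 1) \<le> emeasure M (cball t 1)"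
        unfolding eN[OF borel_closed[OF closed_cball]] using sM by (intro emeasure_mono) auto
      also have "\<dots> \<le> ennreal C" using tb by (simp add: tbound_def)
      finally show "emeasure N (cball t 1) \<le> ennreal C" .
    qed
    have iN: "integrable N (\<lambda>y. (norm (inv_fourier f y))\<^sup>2)"
    proof (rule finite_measure.integrable_const_bound[OF fin, of _ "I\<^sup>2"])
      show "AE y in N. norm ((norm (inv_fourier f y))\<^sup>2) \<le> I\<^sup>2"
        using inv_fourier_bound[of f] by (intro AE_I2) (auto simp: I_def intro!: power_mono)
      show "(\<lambda>y. (norm (inv_fourier f y))\<^sup>2) \<in> borel_measurable N" using mb sN by (simp cong: measurable_cong_sets)
    qed
    have "(\<integral>\<^sup>+y. indicator (cball 0 (real q)) y * u y \<partial>M) = (\<integral>\<^sup>+y. u y \<partial>N)"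
      unfolding N_def by (rule nn_integral_density[OF im um, symmetric])
    also have "\<dots> = ennreal (LINT y|N. (norm (inv_fourier f y))\<^sup>2)"
      unfolding u_def by (rule nn_integral_eq_integral[OF iN]) simp
    also have "\<dots> \<le> ennreal D" by (intro ennreal_leI D fin tbN)
    finally show ?thesis .
  qed
  have "(\<lambda>q. \<integral>\<^sup>+y. indicator (cball 0 (real q)) y * u y \<partial>M) \<longlonglongrightarrow> (\<integral>\<^sup>+y. u y \<partial>M)"
  proof (rule nn_integral_LIMSEQ)
    show "incseq (\<lambda>q y. indicator (cball 0 (real q)) y * u y)"
      by (auto simp: incseq_def le_fun_def indicator_def)
    show "(\<lambda>y. indicator (cball 0 (real q)) y * u y) \<in> borel_measurable M" for q
      using um sM by (intro borel_measurable_times_ennreal borel_measurable_indicator) auto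
    fix y :: 'a
    obtain q0 :: nat where q0: "norm y \<le> real q0" using real_arch_simple by blast
    show "(\<lambda>q. indicator (cball 0 (real q)) y * u y) \<longlonglongrightarrow> u y"
    proof (rule tendsto_eventually, rule eventually_sequentiallyI[of q0])
      show "indicator (cball 0 (real q)) y * u y = u y" if "q0 \<le> q" for q
        using q0 that by (auto simp: indicator_def)
    qed
  qed
  then have "(\<integral>\<^sup>+y. u y \<partial>M) \<le> ennreal D"
    by (rule LIMSEQ_le_const2) (use bound in blast)
  then show ?thesis
    by (intro integrableI_bounded m) (simp add: u_def le_less_trans[OF _ ennreal_less_top])
qed

text \<open>The function f * f~ is merely continuous, so it is mollified into \<open>Cc_inf\<close>.
  On the transform side this multiplies by factors of modulus at most 1 tending to 1, and the square
  of the transform of f is itself the dominating function.\<close>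

lemma is_fourier_transformI:
  fixes \<mu> \<nu> :: "'a::euclidean_space cmeasure"
  assumes \<mu>: "radon_cmeasure \<mu>" and \<nu>: "radon_cmeasure \<nu>" and tb: "tbound (fst \<nu>) C"
    and eq: "\<And>f. f \<in> Cc_inf \<Longrightarrow> cm_integral \<mu> f = cm_integral \<nu> (inv_fourier f)"
  shows "is_fourier_transform \<mu> \<nu>"
  unfolding is_fourier_transform_def cm_var_def
proof (intro conjI \<nu> ballI)
  fix f :: "'a \<Rightarrow> complex" assume f: "f \<in> Cc"
  let ?q = "\<lambda>y. (norm (inv_fourier f y))\<^sup>2" and ?F = "fconv f (refl_conj f)"
  show i: "integrable (fst \<nu>) ?q" by (rule fourier_square_integrable[OF f tb])
  have F: "?F \<in> Cc" by (intro fconv_Cc f Cc_refl_conj)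
  have hat: "inv_fourier (fconv ?F (mol n)) y = complex_of_real (?q y) * inv_fourier (mol n) y" for n y
    by (simp only: inv_fourier_fconv[OF F mol_Cc] inv_fourier_fconv[OF f Cc_refl_conj[OF f]]
        inv_fourier_refl_conj[OF f] complex_norm_square)
  have "(\<lambda>n. cm_integral \<nu> (\<lambda>y. complex_of_real (?q y) * inv_fourier (mol n) y)) \<longlonglongrightarrow> cm_integral \<nu> (\<lambda>y. complex_of_real (?q y))"
  proof (rule cm_integral_dominated_convergence[OF \<nu>, where w="?q"])
    show "(\<lambda>y. complex_of_real (?q y)) \<in> borel_measurable borel"
      "(\<lambda>y. complex_of_real (?q y) * inv_fourier (mol n) y) \<in> borel_measurable borel" for n
      by (intro borel_measurable_continuous_onI continuous_intros inv_fourier_continuous f mol_Cc)+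
    show "(\<lambda>n. complex_of_real (?q y) * inv_fourier (mol n) y) \<longlonglongrightarrow> complex_of_real (?q y)" for y
      using tendsto_mult_left[OF inv_fourier_mol_tendsto[of y], of "complex_of_real (?q y)"] by simp
    show "norm (complex_of_real (?q y) * inv_fourier (mol n) y) \<le> ?q y" for n y
      using mult_left_mono[OF norm_inv_fourier_mol[of n y], of "?q y"] by (simp add: norm_mult norm_power)
  qed (rule i)
  moreover have "cm_integral \<nu> (\<lambda>y. complex_of_real (?q y) * inv_fourier (mol n) y) = cm_integral \<mu> (fconv ?F (mol n))" for n
    unfolding eq[OF fconv_Cc_inf[OF F mol_Cc_inf]] hat ..
  ultimately show "cm_integral \<mu> ?F = cm_integral \<nu> (\<lambda>y. complex_of_real (?q y))"
    using LIMSEQ_unique[OF cm_integral_mol[OF \<mu> F]] by simp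
qed

theorem theorem5p2:
  fixes \<mu>s :: "nat \<Rightarrow> ('a::euclidean_space) cmeasure"
    and \<mu>hats :: "nat \<Rightarrow> 'a cmeasure"
    and \<mu> :: "'a cmeasure"
  assumes ft: "\<And>n. radon_cmeasure (\<mu>s n) \<and> is_fourier_transform (\<mu>s n) (\<mu>hats n)"
    and mu: "radon_cmeasure \<mu>"
    and i: "\<And>f. f \<in> schwartz \<Longrightarrow>
      uniform_limit UNIV
        (\<lambda>n t. tempered_action (\<mu>s n) (\<lambda>x. exp (- 2 * of_real pi * \<i> * of_real (t \<bullet> x)) * f x))
        (\<lambda>t. tempered_action \<mu> (\<lambda>x. exp (- 2 * of_real pi * \<i> * of_real (t \<bullet> x)) * f x))
        sequentially"
    and ii: "vaguely_bounded (range \<mu>s)"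
    and iii: "tempered \<mu>"
    and iv: "equi_translation_bounded (range \<mu>hats)"
  shows "fourier_transformable \<mu> \<and>
         (\<exists>\<mu>hat. is_fourier_transform \<mu> \<mu>hat \<and> product_converges \<mu>hats \<mu>hat)"
proof -
  have \<mu>s: "\<And>n. radon_cmeasure (\<mu>s n)" and fts: "\<And>n. is_fourier_transform (\<mu>s n) (\<mu>hats n)" using ft by auto
  then have rad: "\<And>n. radon_cmeasure (\<mu>hats n)" by (simp add: is_fourier_transform_def)
  obtain C where tb: "\<And>n. tbound (fst (\<mu>hats n)) C" using equi_translation_bounded_tbound[OF iv rad] by blast
  \<comment> \<open>Temperedness of the approximating measures turns the definite description in
    hypothesis (i) into an ordinary integral on test functions.\<close>
  have temp: "\<And>n. tempered (\<mu>s n)" by (rule fourier_transform_tempered[OF \<mu>s fts tb])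
  have e: "exp (- 2 * of_real pi * \<i> * of_real (t \<bullet> x)) = cnj (echar (t \<bullet> x))" for t x :: 'a
    unfolding echar_minus[symmetric] by (simp add: echar_def)
  have mod: "(\<lambda>x. cnj (echar (t \<bullet> x)) * f x) \<in> Cc_inf" if "f \<in> Cc_inf" for t and f :: "'a \<Rightarrow> complex"
  proof -
    have "smooth_fun (\<lambda>x. cnj (echar (t \<bullet> x)))"
      using smooth_echar_inner[of "- t"] by (simp add: inner_commute echar_minus)
    then show ?thesis by (rule Cc_inf_mult[OF that])
  qed
  have unif: "uniform_limit UNIV (\<lambda>n t. cm_integral (\<mu>s n) (\<lambda>x. cnj (echar (t \<bullet> x)) * f x))
      (\<lambda>t. cm_integral \<mu> (\<lambda>x. cnj (echar (t \<bullet> x)) * f x)) sequentially" if f: "f \<in> Cc_inf" for f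
    using i[OF Cc_inf_schwartz[OF f]]
    unfolding e tempered_action_Cc_inf[OF \<mu>s temp mod[OF f]] tempered_action_Cc_inf[OF mu iii mod[OF f]] .
  have cau: "uniformly_Cauchy_on UNIV (\<lambda>n. mconv (\<mu>hats n) g)" if "g \<in> Cc" for g
  proof (rule mconv_uniformly_Cauchy[OF rad tb _ that])
    fix \<eta> :: "'a \<Rightarrow> complex" assume \<eta>: "\<eta> \<in> Cc_inf"
    show "uniformly_Cauchy_on UNIV (\<lambda>n t. cm_integral (\<mu>hats n) (inv_fourier (\<lambda>x. cnj (echar (t \<bullet> x)) * \<eta> x)))"
      unfolding fourier_transform_Cc_inf[OF \<mu>s fts tb mod[OF \<eta>], symmetric]
      using unif[OF \<eta>] uniformly_convergent_Cauchy uniformly_convergent_on_def by blast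
  qed
  obtain \<nu> C' where \<nu>: "radon_cmeasure \<nu>" "tbound (fst \<nu>) C'" "product_converges \<mu>hats \<nu>"
    "\<And>g. g \<in> Cc \<Longrightarrow> (\<lambda>n. cm_integral (\<mu>hats n) g) \<longlonglongrightarrow> cm_integral \<nu> g"
    using uniform_limit_measure[OF rad tb cau] by blast
  have "cm_integral \<mu> f = cm_integral \<nu> (inv_fourier f)" if f: "f \<in> Cc_inf" for f
  proof (rule LIMSEQ_unique)
    show "(\<lambda>n. cm_integral (\<mu>s n) f) \<longlonglongrightarrow> cm_integral \<mu> f"
      using tendsto_uniform_limitI[OF unif[OF f], of 0] by simp
    \<comment> \<open>The exponent 1 provides the margin over the weight that
      \<open>vague_limit_extends\<close> asks for.\<close>
    obtain B where B: "\<And>y. (1 + norm y) ^ 1 * norm (inv_fourier f y) \<le> B * wt y"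
      by (rule inv_fourier_wt_bound[OF f, of 1]) blast
    \<comment> \<open>One translation bound has to serve the sequence and its limit together, whence
      the maximum of the two constants.\<close>
    show "(\<lambda>n. cm_integral (\<mu>s n) f) \<longlonglongrightarrow> cm_integral \<nu> (inv_fourier f)"
      unfolding fourier_transform_Cc_inf[OF \<mu>s fts tb f]
      by (rule vague_limit_extends[OF rad \<nu>(1) tbound_mono[OF tb] tbound_mono[OF \<nu>(2)] \<nu>(4), of "max C C'"])
         (use B in \<open>auto intro!: inv_fourier_continuous Cc_inf_Cc[OF f]\<close>)
  qed
  then have "is_fourier_transform \<mu> \<nu>" by (rule is_fourier_transformI[OF mu \<nu>(1,2)])
  then show ?thesis using mu \<nu>(3) unfolding fourier_transformable_def by blast
qed

end
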